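(* Let $d\ge 3$ and let $v:\mathbb{R}^d\to\mathbb{R}$ be a bounded Borel measurable function with bounded support. Let $x(t)\in\mathbb{R}^d$ and $y(t)\in\mathbb{R}^d$ be defined for $t>0$, and suppose $x(t)\to x\in\mathbb{R}^d$ and $y(t)\to y\in\mathbb{R}^d$ as $t\to\infty$. For each $t>0$ let $Z(t)=\int_0^t v(X_s)\,ds$, where $(X_s,0\le s\le t)$ is a $d$-dimensional Brownian bridge running for time $t$ with $X_0=x(t)$ and $X_t=y(t)$. Let $Y_x$ and $Y_y$ be the Brownian motion path integrals defined in the context, and let $Y'_y$ be a random variable independent of $Y_x$ with the same distribution as $Y_y$. Let $\alpha_0>0$ be such that $$E\exp\Big\{\alpha\int_0^\infty |v(W_z(s))|\,ds\Big\}<\infty\quad\text{for all } z\in\mathbb{R}^d \text{ and all } |\alpha|<\alpha_0 .$$ Then: (i) for every positive integer $k$, $E[Z(t)^k]\to E[(Y_x+Y'_y)^k]$ as $t\to\infty$; (ii) for every $\alpha\in(-\alpha_0,\alpha_0)$, $$E e^{\alpha Z(t)}\to E e^{\alpha(Y_x+Y'_y)}=E e^{\alpha Y_x}\,E e^{\alpha Y_y}\quad\text{as } t\to\infty;$$ (iii) if moreover $v$ is nonnegative and not almost everywhere zero, the convergence in (ii) holds for every $\alpha\in(-\infty,\alpha_1)$, where $\alpha_1\in(0,\infty)$ is the number such that $E e^{\alpha Y_z}<\infty$ for all $\alpha<\alpha_1$ and $z\in\mathbb{R}^d$, and $E e^{\alpha Y_z}=\infty$ for all $\alpha>\alpha_1$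 and $z\in\mathbb{R}^d$.
   Context: For $z\in\mathbb{R}^d$, $(W_z(s),s\ge0)$ denotes a standard $d$-dimensional Brownian motion (Wiener process) with $W_z(0)=z$, and $Y_z=\int_0^\infty v(W_z(s))\,ds$. A Brownian bridge of duration $t$ from $a$ to $b$ is standard Brownian motion started at $a$ and conditioned to be at $b$ at time $t$: with $q(t;x)=(2\pi t)^{-d/2}\exp(-|x|^2/(2t))$, its joint density at times $0<s_1<\dots<s_k<t$ and positions $z_1,\dots,z_k$ is $\big[\prod_{j=0}^{k}q(s_{j+1}-s_j;z_{j+1}-z_j)\big]/q(t;b-a)$, where $s_0=0$, $z_0=a$, $s_{k+1}=t$, $z_{k+1}=b$. The family $\{Z(t)\}$ is regarded only as a family of distributions indexed by $t$. A number $\alpha_0>0$ with the stated property exists, and when $v$ is nonnegative and not almost everywhere zero a number $\alpha_1\in(0,\infty)$ with the stated property exists. *)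

theory Defs
  imports "HOL-Probability.Probability"
begin

definition heat_kernel :: "real \<Rightarrow> 'a::euclidean_space \<Rightarrow> real" where
  "heat_kernel t x = (2 * pi * t) powr (- real DIM('a) / 2) * exp (- (norm x)\<^sup>2 / (2 * t))"

(* All paths are required to be continuous, not merely almost all of them: together with
   the measurability of each W s this makes (s, w) \<mapsto> W s w jointly measurable on
   [0, \<infinity>), so that path integrals are random variables even if M is not complete. *)
definition brownian_motion ::
  "'w measure \<Rightarrow> 'a::euclidean_space \<Rightarrow> (real \<Rightarrow> 'w \<Rightarrow> 'a) \<Rightarrow> bool" where
  "brownian_motion M z W \<longleftrightarrow>
     prob_space M \<and>
     (\<forall>s\<ge>0. W s \<in> borel_measurable M) \<and>
     (\<forall>\<omega>\<in>space M. W 0 \<omega> = z) \<and>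
     (\<forall>\<omega>\<in>space M. continuous_on {0..} (\<lambda>s. W s \<omega>)) \<and>
     (\<forall>r s. 0 \<le> r \<and> r < s \<longrightarrow>
        distributed M lborel (\<lambda>\<omega>. W s \<omega> - W r \<omega>) (\<lambda>u. ennreal (heat_kernel (s - r) u))) \<and>
     (\<forall>(n::nat) \<tau>. 0 \<le> \<tau> 0 \<and> (\<forall>i<n. \<tau> i < \<tau> (Suc i)) \<longrightarrow>
        prob_space.indep_vars M (\<lambda>_. borel) (\<lambda>i \<omega>. W (\<tau> (Suc i)) \<omega> - W (\<tau> i) \<omega>) {..<n})"

(* Only the times s in [0, t] matter. The sequence \<sigma> carries s_0 = 0, s_1, ..., s_k,
   s_{k+1} = t; the positions z_1, ..., z_k are extended by z_0 = a and z_{k+1} = b. *)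
definition brownian_bridge ::
  "'w measure \<Rightarrow> real \<Rightarrow> 'a::euclidean_space \<Rightarrow> 'a \<Rightarrow> (real \<Rightarrow> 'w \<Rightarrow> 'a) \<Rightarrow> bool" where
  "brownian_bridge M t a b X \<longleftrightarrow>
     prob_space M \<and>
     (\<forall>s\<in>{0..t}. X s \<in> borel_measurable M) \<and>
     (\<forall>\<omega>\<in>space M. X 0 \<omega> = a \<and> X t \<omega> = b) \<and>
     (\<forall>\<omega>\<in>space M. continuous_on {0..t} (\<lambda>s. X s \<omega>)) \<and>
     (\<forall>(k::nat) \<sigma>. 1 \<le> k \<and> \<sigma> 0 = 0 \<and> \<sigma> (Suc k) = t \<and> (\<forall>j\<le>k. \<sigma> j < \<sigma> (Suc j)) \<longrightarrow>
        distributed M (Pi\<^sub>M {1..k} (\<lambda>_. lborel))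
          (\<lambda>\<omega>. \<lambda>j\<in>{1..k}. X (\<sigma> j) \<omega>)
          (\<lambda>z. let \<zeta> = z(0 := a, Suc k := b) in
             ennreal ((\<Prod>j=0..k. heat_kernel (\<sigma> (Suc j) - \<sigma> j) (\<zeta> (Suc j) - \<zeta> j))
                      / heat_kernel t (b - a))))"

(* A Bochner integral, hence 0 by convention where v along the path is not integrable over A.
   For bounded A this does not occur when v is bounded and measurable; for A = [0, \<infinity>) and
   v of bounded support it has probability 0 for Brownian motion in dimension at least 3. *)
definition path_integral ::
  "real set \<Rightarrow> ('a \<Rightarrow> real) \<Rightarrow> (real \<Rightarrow> 'w \<Rightarrow> 'a) \<Rightarrow> 'w \<Rightarrow> real" where
  "path_integral A v W \<omega> = (LINT s:A|lborel. v (W s \<omega>))"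

(* Extended-valued, so that an infinite exponential moment is not confused with 0. *)
definition exp_moment :: "'w measure \<Rightarrow> real \<Rightarrow> ('w \<Rightarrow> real) \<Rightarrow> ennreal" where
  "exp_moment M \<alpha> Y = (\<integral>\<^sup>+ \<omega>. ennreal (exp (\<alpha> * Y \<omega>)) \<partial>M)"

end

theory Submission
  imports Defs
begin

text \<open>
  For \<open>v \<ge> 0\<close> write the \<open>k\<close>-th moment of \<open>Z(t)\<close> as \<open>k!\<close> times an integral over ordered times
  \<open>0 < s\<^sub>1 < \<dots> < s\<^sub>k < t\<close>. The \<open>k + 1\<close> gaps add up to \<open>t\<close>, and since Brownian motion is transient
  exactly one of them is long. The heat kernel of the long gap cancels against the normalization
  \<open>q(t; y - x)\<close>, and the gaps before and after it give the iterated Green potentials of \<open>v\<close> at \<open>x\<close>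
  and at \<open>y\<close>, that is, the moments of \<open>Y\<^sub>x\<close> and \<open>Y\<^sub>y\<close>. Bounding the kernel of the longest gap by
  its value at \<open>t / (k + 1)\<close> costs only a factor polynomial in \<open>k\<close>, so together with a Harnack type
  inequality for the potentials, exponential moments of \<open>\<integral> |v(W)|\<close> bound those of \<open>Z(t)\<close> uniformly
  in \<open>t\<close>; the exponential series then converges termwise. Signed \<open>v\<close> reduce to nonnegative ones
  because \<open>(a - b)\<^sup>k\<close> is a fixed linear combination of the \<open>(a + j b)\<^sup>k\<close>. For \<open>v \<ge> 0\<close> and very
  negative \<open>\<alpha>\<close>, the factor \<open>e\<^sup>\<alpha>\<^sup>Z\<close> is split into bounded factors that are expanded one at a time.
\<close>

subsection \<open>The heat kernel\<close>

text \<open>Three obstacles shape the estimates. The admissible range of \<alpha> is the one in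
  which the exponential moments of the integral of |v(W)| are finite. A bound on the potentials by
  powers of a constant has a radius of convergence that may be smaller, so it serves only as
  domination for fixed k; the uniform bound must come from the potentials themselves, with exponents
  \<beta> < \<gamma> whose ratio leaves room for the polynomial factor. The moving endpoints x(t)
  and y(t) also call for control on a whole ball, although the power series is used only at the
  origin; the Harnack estimate bridges this gap. The reduction of signed v to nonnegative functions
  is confined to fixed moments: its coefficients and weights grow with k, and estimating them term
  by term would destroy the exponential series. Uniform exponential bounds for signed v are taken
  from |v| instead. For \<alpha> far below zero the factor e^(\<alpha> Z) is bounded, but its series
  cannot be dominated, since E e^(|\<alpha>| Z) may be infinite. Carrying a bounded weight through
  the series argument makes that argument repeatable in small steps.\<close>

definition heat :: "real \<Rightarrow> 'a::euclidean_space \<Rightarrow> ennreal" where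
  "heat t x = (if 0 < t then ennreal (heat_kernel t x) else 0)"

lemma heat_kernel_pos: "0 < t \<Longrightarrow> 0 < heat_kernel t (x::'a::euclidean_space)"
  by (simp add: heat_kernel_def)

text \<open>This convention encodes the order of times: time integrals run over the whole line, and
  gaps that are not positive contribute nothing.\<close>

lemma heat_nonpos [simp]: "t \<le> 0 \<Longrightarrow> heat t x = 0"
  by (simp add: heat_def)

lemma heat_eq: "0 < t \<Longrightarrow> heat t x = ennreal (heat_kernel t x)"
  by (simp add: heat_def)

lemma heat_neq_0: "0 < t \<Longrightarrow> heat t x \<noteq> 0"
  using heat_kernel_pos[of t x] by (simp add: heat_def)

lemma heat_less_top [simp]: "heat t x < \<top>"
  by (simp add: heat_def)

lemma heat_neq_top [simp]: "heat t x \<noteq> \<top>"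
  by (simp add: heat_def)

lemma heat_commute: "heat t (x - y) = heat t (y - x)"
  by (simp add: heat_def heat_kernel_def norm_minus_commute)

lemma heat_measurable [measurable (raw)]:
  assumes [measurable]: "g \<in> borel_measurable M" "h \<in> borel_measurable M"
  shows "(\<lambda>w. heat (g w) (h w :: 'a::euclidean_space)) \<in> borel_measurable M"
  unfolding heat_def heat_kernel_def by measurable

lemma heat_zero: "0 < t \<Longrightarrow> heat t (0::'a::euclidean_space) = ennreal ((2 * pi * t) powr (- real DIM('a) / 2))"
  by (simp add: heat_def heat_kernel_def)

lemma heat_le: "heat t (x::'a::euclidean_space) \<le> heat t (0::'a)"
  by (auto simp: heat_def heat_kernel_def intro!: ennreal_leI mult_left_le)

lemma heat_zero_antimono: "0 < s \<Longrightarrow> s \<le> t \<Longrightarrow> heat t (0::'a::euclidean_space) \<le> heat s (0::'a)"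
  by (auto simp: heat_zero intro!: ennreal_leI powr_mono2')

text \<open>With c = 1 / (k + 1) this turns the kernel at the shortest possible longest gap into the
  polynomial factor (k + 1)^(d/2).\<close>

lemma heat_zero_scale:
  assumes "0 < c" "0 < t"
  shows "heat (c * t) (0::'a::euclidean_space) = ennreal (c powr (- real DIM('a) / 2)) * heat t (0::'a)"
proof -
  have "2 * pi * (c * t) = c * (2 * pi * t)" by simp
  then show ?thesis
    using assms by (simp add: heat_zero powr_mult ennreal_mult'' ac_simps)
qed

lemma tendsto_heat [tendsto_intros]:
  assumes "(g \<longlongrightarrow> t) F" "(h \<longlongrightarrow> (x::'a::euclidean_space)) F" "0 < t"
  shows "((\<lambda>n. heat (g n) (h n)) \<longlongrightarrow> heat t x) F"
proof -
  have "((\<lambda>n. ennreal (heat_kernel (g n) (h n))) \<longlongrightarrow> ennreal (heat_kernel t x)) F"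
    unfolding heat_kernel_def using assms by (intro tendsto_intros) auto
  moreover have "\<forall>\<^sub>F n in F. 0 < g n"
    using assms order_tendstoD(1) by blast
  then have "\<forall>\<^sub>F n in F. ennreal (heat_kernel (g n) (h n)) = heat (g n) (h n)"
    by eventually_elim (simp add: heat_eq)
  ultimately show ?thesis
    using assms(3) by (simp add: heat_eq tendsto_cong)
qed

lemma nn_integral_lborel_shift:
  assumes [measurable]: "F \<in> borel_measurable borel"
  shows "(\<integral>\<^sup>+x. F (x - a) \<partial>lborel) = (\<integral>\<^sup>+x. F (x::'a::euclidean_space) \<partial>lborel)"
proof -
  have "(\<integral>\<^sup>+x. F x \<partial>lborel) = (\<integral>\<^sup>+x. F x \<partial>distr lborel borel ((+) (- a)))"
    by (simp add: lborel_distr_plus)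
  also have "\<dots> = (\<integral>\<^sup>+x. F (x - a) \<partial>lborel)"
    by (subst nn_integral_distr) (auto simp: add.commute)
  finally show ?thesis by simp
qed

lemma nn_integral_lborel_reflect:
  assumes [measurable]: "F \<in> borel_measurable borel"
  shows "(\<integral>\<^sup>+s. F (t - s) \<partial>lborel) = (\<integral>\<^sup>+s. F (s::real) \<partial>lborel)"
  using nn_integral_real_affine[OF assms, of "-1" t] by simp

lemma nn_integral_heat_origin:
  assumes "0 < t"
  shows "(\<integral>\<^sup>+x. heat t (x::'a::euclidean_space) \<partial>lborel) = 1"
proof -
  \<comment> \<open>The kernel factors over the coordinates into normal densities of variance t, so
    its integral is a product of ones.\<close>
  have *: "heat t x = (\<Prod>b\<in>Basis. ennreal (normal_density 0 (sqrt t) (x \<bullet> b)))" for x :: 'a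
  proof -
    have "(\<Prod>b\<in>(Basis::'a set). normal_density 0 (sqrt t) (x \<bullet> b))
        = (1 / sqrt (2 * pi * t)) ^ DIM('a) * exp (\<Sum>b\<in>Basis. - (x \<bullet> b)\<^sup>2 / (2 * t))"
      using assms by (simp add: normal_density_def prod.distrib exp_sum prod_dividef power_one_over)
    also have "(\<Sum>b\<in>(Basis::'a set). - (x \<bullet> b)\<^sup>2 / (2 * t)) = - (norm x)\<^sup>2 / (2 * t)"
    proof -
      have "(norm x)\<^sup>2 = (\<Sum>b\<in>Basis. (x \<bullet> b)\<^sup>2)"
        by (subst power2_norm_eq_inner, subst euclidean_inner) (simp add: power2_eq_square)
      then show ?thesis by (simp add: sum_divide_distrib sum_negf)
    qed
    also have "(1 / sqrt (2 * pi * t)) ^ DIM('a) = (2 * pi * t) powr (- real DIM('a) / 2)"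
    proof -
      have "1 / sqrt (2 * pi * t) = (2 * pi * t) powr (- 1 / 2)"
        using assms by (simp add: powr_half_sqrt powr_minus_divide)
      then show ?thesis
        using assms by (simp add: powr_realpow[symmetric] powr_powr)
    qed
    finally show ?thesis
      using assms by (simp add: heat_eq heat_kernel_def prod_ennreal)
  qed
  have "(\<integral>\<^sup>+x. ennreal (normal_density 0 (sqrt t) x) \<partial>lborel) = 1"
    using assms prob_space.emeasure_space_1[OF prob_space_normal_density[of "sqrt t" 0]]
    by (simp add: emeasure_density)
  then show ?thesis
    unfolding * by (subst nn_integral_lborel_prod) auto
qed

lemma nn_integral_heat:
  assumes "0 < t"
  shows "(\<integral>\<^sup>+x. heat t (x - a :: 'a::euclidean_space) \<partial>lborel) = 1"
  using nn_integral_heat_origin[OF assms, where 'a='a] by (subst nn_integral_lborel_shift) auto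

lemma nn_integral_heat': "(\<integral>\<^sup>+x. heat t (x - a :: 'a::euclidean_space) \<partial>lborel) \<le> 1"
  using nn_integral_heat[of t a] by (cases "0 < t") auto

text \<open>From |w|^2 \<le> 2 |w - a|^2 + 2 |a|^2: the first factor 2 is absorbed by doubling the
  time, at the price 2^(d/2), and the second term stays bounded because s does not drop below
  e.\<close>

lemma heat_recenter:
  assumes e: "0 < e" "e \<le> s" and a: "norm a \<le> R"
  shows "heat s (w - a) \<le> ennreal (exp (R\<^sup>2 / (2 * e)) * 2 powr (real DIM('a) / 2)) * heat (2 * s) (w::'a::euclidean_space)"
proof -
  have "norm w \<le> norm (w - a) + norm a" by (metis diff_add_cancel norm_triangle_ineq)
  then have "(norm w)\<^sup>2 \<le> (norm (w - a) + norm a)\<^sup>2" by (intro power_mono) auto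
  also have "\<dots> \<le> 2 * (norm (w - a))\<^sup>2 + 2 * (norm a)\<^sup>2"
    using sum_squares_bound[of "norm (w-a)" "norm a"] by (simp add: power2_sum)
  also have "(norm a)\<^sup>2 \<le> R\<^sup>2" using a by (intro power_mono) auto
  finally have "(norm w)\<^sup>2 / (4 * s) \<le> (norm (w - a))\<^sup>2 / (2 * s) + R\<^sup>2 / (2 * s)"
    using e by (simp add: field_simps)
  also have "R\<^sup>2 / (2 * s) \<le> R\<^sup>2 / (2 * e)"
    using e by (intro divide_left_mono) auto
  finally have "- (norm (w - a))\<^sup>2 / (2 * s) \<le> R\<^sup>2 / (2 * e) + - (norm w)\<^sup>2 / (2 * (2 * s))"
    by simp
  then have *: "exp (- (norm (w - a))\<^sup>2 / (2 * s)) \<le> exp (R\<^sup>2 / (2 * e)) * exp (- (norm w)\<^sup>2 / (2 * (2 * s)))"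
    by (simp flip: exp_add)
  have "2 * pi * (2 * s) = 2 * (2 * pi * s)" by simp
  then have **: "(2 * pi * (2 * s)) powr (- real DIM('a) / 2) = 2 powr (- real DIM('a) / 2) * (2 * pi * s) powr (- real DIM('a) / 2)"
    using e by (simp only: powr_mult)
  have one: "2 powr (real DIM('a) / 2) * 2 powr (- real DIM('a) / 2) = (1::real)"
    by (simp flip: powr_add)
  have "heat_kernel s (w - a) \<le> (2 * pi * s) powr (- real DIM('a) / 2) * (exp (R\<^sup>2 / (2 * e)) * exp (- (norm w)\<^sup>2 / (2 * (2 * s))))"
    unfolding heat_kernel_def by (intro mult_left_mono *) auto
  also have "\<dots> = (2 powr (real DIM('a) / 2) * 2 powr (- real DIM('a) / 2)) * \<dots>" unfolding one by simp
  also have "\<dots> = exp (R\<^sup>2 / (2 * e)) * 2 powr (real DIM('a) / 2) * heat_kernel (2 * s) w"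
    unfolding heat_kernel_def ** by (simp only: ac_simps)
  finally show ?thesis
    using e by (simp add: heat_eq ennreal_mult''[symmetric] heat_kernel_pos less_imp_le)
qed

subsection \<open>Iterated potentials of Brownian motion and of the bridge\<close>

text \<open>Iterated Green potential, with the gaps between consecutive times as integration
  variables. Since the times are ordered, it is the k-th moment of the occupation integral divided
  by k!.\<close>

primrec green :: "('a::euclidean_space \<Rightarrow> ennreal) \<Rightarrow> nat \<Rightarrow> 'a \<Rightarrow> ennreal" where
  "green f 0 a = 1"
| "green f (Suc k) a = (\<integral>\<^sup>+s. \<integral>\<^sup>+w. heat s (w - a) * f w * green f k w \<partial>lborel \<partial>lborel)"

text \<open>The counterpart for paths forced to be at b after total duration t, before division by
  the kernel from a to b. The last gap is whatever remains of t; if nothing remains, its kernel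
  vanishes.\<close>

primrec pinned :: "('a::euclidean_space \<Rightarrow> ennreal) \<Rightarrow> nat \<Rightarrow> real \<Rightarrow> 'a \<Rightarrow> 'a \<Rightarrow> ennreal" where
  "pinned f 0 t a b = heat t (b - a)"
| "pinned f (Suc k) t a b = (\<integral>\<^sup>+s. \<integral>\<^sup>+w. heat s (w - a) * f w * pinned f k (t - s) w b \<partial>lborel \<partial>lborel)"

lemma green_measurable [measurable]:
  assumes [measurable]: "f \<in> borel_measurable borel"
  shows "green f k \<in> borel_measurable borel"
  by (induction k) auto

lemma pinned_measurable_borel:
  assumes [measurable]: "f \<in> borel_measurable borel"
  shows "(\<lambda>(t, a, b). pinned f k t a b) \<in> borel_measurable (borel \<Otimes>\<^sub>M borel \<Otimes>\<^sub>M borel)"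
proof (induction k)
  case 0
  then show ?case by simp
next
  case (Suc k)
  have [measurable (raw)]: "(\<lambda>x. pinned f k (g x) (h x) (l x)) \<in> borel_measurable M"
    if "g \<in> borel_measurable M" "h \<in> borel_measurable M" "l \<in> borel_measurable M"
    for g h l and M :: "(((real \<times> 'a \<times> 'a) \<times> real) \<times> 'a) measure"
    using measurable_compose[OF measurable_Pair[OF that(1) measurable_Pair[OF that(2,3)]] Suc] by simp
  show ?case by simp
qed

lemma pinned_measurable [measurable (raw)]:
  assumes "f \<in> borel_measurable borel"
    "g \<in> borel_measurable M" "h \<in> borel_measurable M" "l \<in> borel_measurable M"
  shows "(\<lambda>x. pinned f k (g x) (h x) (l x)) \<in> borel_measurable M"
  using measurable_compose[OF measurable_Pair[OF assms(2) measurable_Pair[OF assms(3,4)]]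
      pinned_measurable_borel[OF assms(1)]] by simp

lemma pinned_nonpos: "t \<le> 0 \<Longrightarrow> pinned f k t a b = 0"
proof (induction k arbitrary: t a)
  case (Suc k)
  have "heat s (w - a) * f w * pinned f k (t - s) w b = 0" for s w
    using Suc by (cases "s \<le> 0") auto
  then show ?case by (simp only: pinned.simps) simp
qed simp

lemma nn_integral_lborel_swap4:
  fixes G :: "'b::euclidean_space \<Rightarrow> 'c::euclidean_space \<Rightarrow> 'd::euclidean_space \<Rightarrow> 'e::euclidean_space \<Rightarrow> ennreal"
  assumes G: "(\<lambda>(s, w, r, z). G s w r z) \<in> borel_measurable (borel \<Otimes>\<^sub>M borel \<Otimes>\<^sub>M borel \<Otimes>\<^sub>M borel)"
  shows "(\<integral>\<^sup>+s. \<integral>\<^sup>+w. \<integral>\<^sup>+r. \<integral>\<^sup>+z. G s w r z \<partial>lborel \<partial>lborel \<partial>lborel \<partial>lborel)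
       = (\<integral>\<^sup>+r. \<integral>\<^sup>+z. \<integral>\<^sup>+s. \<integral>\<^sup>+w. G s w r z \<partial>lborel \<partial>lborel \<partial>lborel \<partial>lborel)"
proof -
  note [measurable (raw)] = measurable_compose[OF measurable_Pair[OF _ measurable_Pair[OF _ measurable_Pair]] G, simplified]
  have "(\<integral>\<^sup>+s. \<integral>\<^sup>+w. \<integral>\<^sup>+r. \<integral>\<^sup>+z. G s w r z \<partial>lborel \<partial>lborel \<partial>lborel \<partial>lborel)
      = (\<integral>\<^sup>+s. \<integral>\<^sup>+r. \<integral>\<^sup>+w. \<integral>\<^sup>+z. G s w r z \<partial>lborel \<partial>lborel \<partial>lborel \<partial>lborel)"
    by (intro nn_integral_cong lborel_pair.Fubini') measurable
  also have "\<dots> = (\<integral>\<^sup>+r. \<integral>\<^sup>+s. \<integral>\<^sup>+w. \<integral>\<^sup>+z. G s w r z \<partial>lborel \<partial>lborel \<partial>lborel \<partial>lborel)"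
    by (intro lborel_pair.Fubini') measurable
  also have "\<dots> = (\<integral>\<^sup>+r. \<integral>\<^sup>+s. \<integral>\<^sup>+z. \<integral>\<^sup>+w. G s w r z \<partial>lborel \<partial>lborel \<partial>lborel \<partial>lborel)"
    by (intro nn_integral_cong lborel_pair.Fubini') measurable
  also have "\<dots> = (\<integral>\<^sup>+r. \<integral>\<^sup>+z. \<integral>\<^sup>+s. \<integral>\<^sup>+w. G s w r z \<partial>lborel \<partial>lborel \<partial>lborel \<partial>lborel)"
    by (intro nn_integral_cong lborel_pair.Fubini') measurable
  finally show ?thesis .
qed

text \<open>Splitting off the last gap instead of the first is what makes time reversal provable by
  induction.\<close>

lemma pinned_Suc_right:
  fixes f :: "'a::euclidean_space \<Rightarrow> ennreal"
  assumes [measurable]: "f \<in> borel_measurable borel"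
  shows "pinned f (Suc k) t a b
       = (\<integral>\<^sup>+s. \<integral>\<^sup>+w. pinned f k (t - s) a w * f w * heat s (b - w) \<partial>lborel \<partial>lborel)"
proof (induction k arbitrary: t a b)
  case 0
  show ?case
    using nn_integral_lborel_reflect[of "\<lambda>s. \<integral>\<^sup>+w. heat (t - s) (w - a) * f w * heat s (b - w) \<partial>lborel" t]
    by simp
next
  case (Suc k)
  have "pinned f (Suc (Suc k)) t a b
      = (\<integral>\<^sup>+s. \<integral>\<^sup>+w. heat s (w - a) * f w * pinned f (Suc k) (t - s) w b \<partial>lborel \<partial>lborel)"
    by simp
  also have "\<dots> = (\<integral>\<^sup>+s. \<integral>\<^sup>+w. \<integral>\<^sup>+r. \<integral>\<^sup>+z. heat s (w - a) * f w
          * (pinned f k (t - s - r) w z * f z * heat r (b - z)) \<partial>lborel \<partial>lborel \<partial>lborel \<partial>lborel)"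
    unfolding Suc.IH by (simp add: nn_integral_cmult)
  also have "\<dots> = (\<integral>\<^sup>+r. \<integral>\<^sup>+z. \<integral>\<^sup>+s. \<integral>\<^sup>+w. heat s (w - a) * f w
          * (pinned f k (t - s - r) w z * f z * heat r (b - z)) \<partial>lborel \<partial>lborel \<partial>lborel \<partial>lborel)"
    by (intro nn_integral_lborel_swap4) measurable
  also have "\<dots> = (\<integral>\<^sup>+r. \<integral>\<^sup>+z. \<integral>\<^sup>+s. \<integral>\<^sup>+w. heat s (w - a) * f w
          * pinned f k (t - r - s) w z * (f z * heat r (b - z)) \<partial>lborel \<partial>lborel \<partial>lborel \<partial>lborel)"
    by (simp add: mult.assoc diff_diff_eq add.commute)
  also have "\<dots> = (\<integral>\<^sup>+r. \<integral>\<^sup>+z. pinned f (Suc k) (t - r) a z * f z * heat r (b - z) \<partial>lborel \<partial>lborel)"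
    by (simp add: nn_integral_multc mult.assoc[of _ "f _" "heat _ _", symmetric])
  finally show ?case .
qed

lemma pinned_commute:
  assumes [measurable]: "f \<in> borel_measurable borel"
  shows "pinned f k t a b = pinned f k t b a"
proof (induction k arbitrary: t a b)
  case 0
  then show ?case by (simp add: heat_commute)
next
  case (Suc k)
  have "pinned f (Suc k) t a b
      = (\<integral>\<^sup>+s. \<integral>\<^sup>+w. pinned f k (t - s) a w * f w * heat s (b - w) \<partial>lborel \<partial>lborel)"
    by (rule pinned_Suc_right[OF assms])
  then show ?case by (simp add: Suc[of _ a] heat_commute[of _ b] mult_ac)
qed

text \<open>Shifting the duration r by the first gap s isolates that gap and leaves the same kind of
  expression with one visit fewer and the weight taken at r + s. In the limit theorem H carries the
  normalized kernel of the long gap.\<close>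

lemma nn_integral_pinned_Suc:
  fixes f :: "'a::euclidean_space \<Rightarrow> ennreal"
  assumes [measurable]: "f \<in> borel_measurable borel"
    and H [measurable]: "(\<lambda>(r, w). H r w) \<in> borel_measurable (borel \<Otimes>\<^sub>M borel)"
  shows "(\<integral>\<^sup>+r. \<integral>\<^sup>+w. f w * H r w * pinned f (Suc k) r b w \<partial>lborel \<partial>lborel)
       = (\<integral>\<^sup>+s. \<integral>\<^sup>+z. heat s (z - b) * f z
            * (\<integral>\<^sup>+r. \<integral>\<^sup>+w. f w * H (r + s) w * pinned f k r z w \<partial>lborel \<partial>lborel) \<partial>lborel \<partial>lborel)"
proof -
  note [measurable (raw)] = measurable_compose[OF measurable_Pair H, simplified]
  have "(\<integral>\<^sup>+r. \<integral>\<^sup>+w. f w * H r w * pinned f (Suc k) r b w \<partial>lborel \<partial>lborel)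
     = (\<integral>\<^sup>+r. \<integral>\<^sup>+w. \<integral>\<^sup>+s. \<integral>\<^sup>+z. f w * H r w * (heat s (z - b) * f z * pinned f k (r - s) z w)
          \<partial>lborel \<partial>lborel \<partial>lborel \<partial>lborel)"
    by (simp add: nn_integral_cmult)
  also have "\<dots> = (\<integral>\<^sup>+s. \<integral>\<^sup>+z. \<integral>\<^sup>+r. \<integral>\<^sup>+w. f w * H r w * (heat s (z - b) * f z * pinned f k (r - s) z w)
          \<partial>lborel \<partial>lborel \<partial>lborel \<partial>lborel)"
    by (intro nn_integral_lborel_swap4) measurable
  also have "\<dots> = (\<integral>\<^sup>+s. \<integral>\<^sup>+z. heat s (z - b) * f z
            * (\<integral>\<^sup>+r. \<integral>\<^sup>+w. f w * H r w * pinned f k (r - s) z w \<partial>lborel \<partial>lborel) \<partial>lborel \<partial>lborel)"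
    by (simp add: nn_integral_cmult[symmetric] mult_ac)
  also have "\<dots> = (\<integral>\<^sup>+s. \<integral>\<^sup>+z. heat s (z - b) * f z
            * (\<integral>\<^sup>+r. \<integral>\<^sup>+w. f w * H (r + s) w * pinned f k r z w \<partial>lborel \<partial>lborel) \<partial>lborel \<partial>lborel)"
  proof -
    have "(\<integral>\<^sup>+r. \<integral>\<^sup>+w. f w * H r w * pinned f k (r - s) z w \<partial>lborel \<partial>lborel)
       = (\<integral>\<^sup>+r. \<integral>\<^sup>+w. f w * H (r + s) w * pinned f k r z w \<partial>lborel \<partial>lborel)" for s z
      by (subst (2) nn_integral_lborel_shift[of _ s, symmetric]) auto
    then show ?thesis by simp
  qed
  finally show ?thesis .
qed

text \<open>Once the total duration is integrated out, no constraint ties the gaps together and an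
  ordinary potential remains.\<close>

lemma nn_integral_pinned:
  fixes f :: "'a::euclidean_space \<Rightarrow> ennreal"
  assumes [measurable]: "f \<in> borel_measurable borel"
  shows "(\<integral>\<^sup>+r. \<integral>\<^sup>+w. f w * pinned f k r b w \<partial>lborel \<partial>lborel) = green f (Suc k) b"
proof (induction k arbitrary: b)
  case 0
  then show ?case by (simp add: mult.commute)
next
  case (Suc k)
  show ?case
    using nn_integral_pinned_Suc[OF assms, of "\<lambda>_ _. 1" k b] by (simp add: Suc)
qed

text \<open>Among k + 1 gaps one has length at least t / (k + 1). The index i counts the visits
  before it, charged to the potential at a; the k - i visits after it are charged, in reversed time,
  to b.\<close>

lemma pinned_le:
  fixes f :: "'a::euclidean_space \<Rightarrow> ennreal"
  assumes [measurable]: "f \<in> borel_measurable borel" and "0 < t"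
  shows "pinned f k t a b \<le> heat (t / real (Suc k)) (0::'a) * (\<Sum>i\<le>k. green f i a * green f (k - i) b)"
  using assms(2)
proof (induction k arbitrary: t a)
  case 0
  then show ?case using heat_le by simp
next
  case (Suc k)
  \<comment> \<open>There are k + 2 gaps now. Either the first one exceeds e, or the other k + 1
    have at least t - e = (k + 1) e at their disposal, and the induction hypothesis bounds them by
    the kernel at e.\<close>
  define e where "e = t / real (Suc (Suc k))"
  define c where "c = heat e (0::'a)"
  have e: "0 < e" using Suc by (simp add: e_def)
  have "heat s (w - a) * f w * pinned f k (t - s) w b
      \<le> c * (\<Sum>i\<le>k. heat s (w - a) * f w * green f i w * green f (k - i) b) + c * (f w * pinned f k (t - s) w b)"
    (is "?l \<le> ?r1 + ?r2") for s w
  proof -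
    consider "s \<le> 0" | "0 < s" "s \<le> e" | "e < s" by linarith
    then show ?thesis
    proof cases
      case 2
      have "e * real (Suc k) = t - e" by (simp add: e_def field_simps)
      then have "e \<le> (t - s) / real (Suc k)" using 2 by (simp add: field_simps)
      moreover have "0 < t - s" using \<open>e * real (Suc k) = t - e\<close> 2 e
        by (smt (verit) mult_pos_pos of_nat_0_less_iff zero_less_Suc)
      ultimately have "pinned f k (t - s) w b \<le> c * (\<Sum>i\<le>k. green f i w * green f (k - i) b)"
        using Suc.IH[of "t - s" w] heat_zero_antimono[OF e, where 'a='a] unfolding c_def
        by (meson mult_right_mono order_trans zero_le)
      then have "?l \<le> heat s (w - a) * f w * (c * (\<Sum>i\<le>k. green f i w * green f (k - i) b))"
        by (rule mult_left_mono) simp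
      also have "\<dots> = ?r1" unfolding sum_distrib_left by (intro sum.cong refl) (simp only: mult_ac)
      finally show ?thesis by (rule add_increasing2[OF zero_le])
    next
      case 3
      then have "heat s (w - a) \<le> c" unfolding c_def
        using e by (intro order_trans[OF heat_le heat_zero_antimono]) auto
      then have "?l \<le> c * f w * pinned f k (t - s) w b"
        by (intro mult_right_mono) auto
      then show ?thesis unfolding mult.assoc by (rule add_increasing[OF zero_le])
    qed simp
  qed
  then have "pinned f (Suc k) t a b
      \<le> (\<integral>\<^sup>+s. \<integral>\<^sup>+w. c * (\<Sum>i\<le>k. heat s (w - a) * f w * green f i w * green f (k - i) b)
           + c * (f w * pinned f k (t - s) w b) \<partial>lborel \<partial>lborel)"
    by (auto intro!: nn_integral_mono)
  also have "\<dots> = c * (\<Sum>i\<le>k. green f (Suc i) a * green f (k - i) b)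
      + c * (\<integral>\<^sup>+s. \<integral>\<^sup>+w. f w * pinned f k (t - s) w b \<partial>lborel \<partial>lborel)"
    by (simp add: nn_integral_add nn_integral_cmult nn_integral_sum nn_integral_multc)
  \<comment> \<open>Here the first gap is the long one. Taking t - s as variable frees the duration,
    and swapping the endpoints makes all visits count from b.\<close>
  also have "(\<integral>\<^sup>+s. \<integral>\<^sup>+w. f w * pinned f k (t - s) w b \<partial>lborel \<partial>lborel) = green f (Suc k) b"
    by (subst nn_integral_lborel_reflect[where F="\<lambda>s. \<integral>\<^sup>+w. f w * pinned f k s w b \<partial>lborel"])
      (simp_all add: pinned_commute[of f _ _ _ b] nn_integral_pinned del: green.simps)
  also have "c * (\<Sum>i\<le>k. green f (Suc i) a * green f (k - i) b) + c * green f (Suc k) b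
      = c * (\<Sum>i\<le>Suc k. green f i a * green f (Suc k - i) b)"
    by (subst sum.atMost_Suc_shift) (simp add: distrib_left add.commute del: green.simps(2))
  finally show ?case by (simp add: c_def e_def)
qed

subsection \<open>Long bridges\<close>

text \<open>The quotients are explicit: (1 - r/t)^(-d/2) exp(-|u|^2 / (2 (t - r))) and exp(|u|^2 /
  (2 t)). So neither a bounded loss of time nor a bounded displacement matters for the long
  gap.\<close>

lemma tendsto_heat_ratio:
  fixes u :: "nat \<Rightarrow> 'a::euclidean_space"
  assumes t: "filterlim t at_top sequentially" and u: "u \<longlonglongrightarrow> l"
  shows "(\<lambda>n. heat (t n - r) (u n) / heat (t n) (0::'a)) \<longlonglongrightarrow> 1" (is ?A)
    and "(\<lambda>n. heat (t n) (0::'a) / heat (t n) (u n)) \<longlonglongrightarrow> 1" (is ?B)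
proof -
  have tr: "filterlim (\<lambda>n. t n - r) at_top sequentially" for r
    using filterlim_tendsto_add_at_top[OF tendsto_const[of "- r"] t] by simp
  have q: "(\<lambda>n. (norm (u n))\<^sup>2 / (2 * (t n - r))) \<longlonglongrightarrow> 0" for r
    by (intro real_tendsto_divide_at_top[OF tendsto_power[OF tendsto_norm[OF u]]]
        filterlim_tendsto_pos_mult_at_top[OF tendsto_const _ tr]) auto
  have "(\<lambda>n. 1 - r / t n) \<longlonglongrightarrow> 1 - 0"
    by (intro tendsto_intros real_tendsto_divide_at_top[OF tendsto_const t])
  then have "(\<lambda>n. (1 - r / t n) powr (- real DIM('a) / 2) * exp (- ((norm (u n))\<^sup>2 / (2 * (t n - r)))))
      \<longlonglongrightarrow> (1 - 0) powr (- real DIM('a) / 2) * exp (- 0)"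
    by (intro tendsto_mult tendsto_powr tendsto_exp tendsto_minus tendsto_const q) auto
  then have "(\<lambda>n. ennreal ((1 - r / t n) powr (- real DIM('a) / 2) * exp (- ((norm (u n))\<^sup>2 / (2 * (t n - r))))))
      \<longlonglongrightarrow> ennreal 1"
    by (intro tendsto_ennrealI) simp
  moreover have "\<forall>\<^sub>F n in sequentially. heat (t n - r) (u n) / heat (t n) (0::'a)
      = ennreal ((1 - r / t n) powr (- real DIM('a) / 2) * exp (- ((norm (u n))\<^sup>2 / (2 * (t n - r)))))"
    using filterlim_at_top_dense[THEN iffD1, OF t, rule_format, of "max 0 r"]
  proof eventually_elim
    case (elim n)
    have "2 * pi * (t n - r) = (1 - r / t n) * (2 * pi * t n)"
      using elim by (simp add: field_simps)
    then have "(2 * pi * (t n - r)) powr p = (1 - r / t n) powr p * (2 * pi * t n) powr p" for p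
      by (metis powr_mult)
    then show ?case
      using elim by (simp add: heat_eq heat_kernel_def divide_ennreal)
  qed
  ultimately show ?A
    by (simp add: tendsto_cong)
  have "(\<lambda>n. ennreal (exp ((norm (u n))\<^sup>2 / (2 * (t n - 0))))) \<longlonglongrightarrow> ennreal (exp 0)"
    by (intro tendsto_ennrealI tendsto_intros q)
  moreover have "\<forall>\<^sub>F n in sequentially. heat (t n) (0::'a) / heat (t n) (u n)
      = ennreal (exp ((norm (u n))\<^sup>2 / (2 * (t n - 0))))"
    using filterlim_at_top_dense[THEN iffD1, OF t, rule_format, of 0]
    by eventually_elim (simp add: heat_eq heat_kernel_def divide_ennreal exp_minus field_simps)
  ultimately show ?B
    by (simp add: tendsto_cong)
qed

section \<open>Potentials of bounded functions with bounded support\<close>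

locale bounded_potential =
  fixes f :: "'a::euclidean_space \<Rightarrow> ennreal" and V R :: real
  assumes f_measurable [measurable]: "f \<in> borel_measurable borel"
    and f_le: "f z \<le> ennreal V"
    and f_support: "R < norm z \<Longrightarrow> f z = 0"
    and dim: "DIM('a) \<ge> 3"
begin

text \<open>Bounds the mean of f at time s uniformly in the starting point. The constant V controls
  short times; the maximum of the kernel times the integral of f decays like s^(-d/2) and controls
  long ones.\<close>

definition majorant :: "real \<Rightarrow> ennreal" where
  "majorant s = (if s \<le> 0 then 0 else min (ennreal V) (heat s (0::'a) * integral\<^sup>N lborel f))"

definition total :: ennreal where
  "total = integral\<^sup>N lborel majorant"

lemma f_less_top [simp]: "f z < \<top>" "f z \<noteq> \<top>"
  using f_le[of z] by (auto simp: top_unique order_le_less_trans)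

lemma majorant_measurable [measurable]: "majorant \<in> borel_measurable borel"
  unfolding majorant_def by measurable

lemma integral_f_less_top: "integral\<^sup>N lborel f < \<top>"
proof -
  have "integral\<^sup>N lborel f \<le> (\<integral>\<^sup>+z. ennreal V * indicator (cball (0::'a) R) z \<partial>lborel)"
    using f_le f_support by (intro nn_integral_mono) (auto simp: indicator_def not_le)
  also have "\<dots> = ennreal V * emeasure lborel (cball (0::'a) R)"
    by (simp add: nn_integral_cmult_indicator)
  also have "\<dots> < \<top>"
    using emeasure_bounded_finite[of "cball (0::'a) R"] by (simp add: ennreal_mult_less_top)
  finally show ?thesis .
qed

lemma nn_integral_heat_f_le: "(\<integral>\<^sup>+w. heat s (w - a) * f w \<partial>lborel) \<le> majorant s"
proof (cases "s \<le> 0")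
  case False
  have "(\<integral>\<^sup>+w. heat s (w - a) * f w \<partial>lborel) \<le> (\<integral>\<^sup>+w. heat s (w - a) * ennreal V \<partial>lborel)"
    by (intro nn_integral_mono mult_left_mono f_le) auto
  also have "\<dots> = ennreal V" using False by (simp add: nn_integral_multc nn_integral_heat)
  moreover have "(\<integral>\<^sup>+w. heat s (w - a) * f w \<partial>lborel) \<le> (\<integral>\<^sup>+w. heat s (0::'a) * f w \<partial>lborel)"
    by (intro nn_integral_mono mult_right_mono heat_le) auto
  ultimately show ?thesis
    using False by (simp add: majorant_def nn_integral_cmult)
qed (simp add: majorant_def)

text \<open>Transience: the only place where the dimension enters.\<close>

lemma total_less_top: "total < \<top>"
proof -
  have *: "majorant s \<le> ennreal V * indicator {0..1} s
      + integral\<^sup>N lborel f * (ennreal (s powr (- 3 / 2)) * indicator {1..} s)" for s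
  proof -
    consider "s \<le> 0" | "0 < s" "s < 1" | "1 \<le> s" by linarith
    then show ?thesis
    proof cases
      case 3
      have "(2 * pi * s) powr (- real DIM('a) / 2) \<le> s powr (- real DIM('a) / 2)"
        using 3 pi_gt3 by (intro powr_mono2') (auto simp: mult_ge1_I)
      also have "\<dots> \<le> s powr (- 3 / 2)" using 3 dim by (intro powr_mono) auto
      finally have "heat s (0::'a) \<le> ennreal (s powr (- 3 / 2))"
        using 3 by (simp add: heat_zero ennreal_leI)
      then have "majorant s \<le> integral\<^sup>N lborel f * ennreal (s powr (- 3 / 2))"
        using 3 by (auto simp: majorant_def mult.commute intro!: min.coboundedI2 mult_left_mono)
      then show ?thesis using 3 by (auto intro!: add_increasing)
    qed (auto simp: majorant_def)
  qed
  have "total \<le> ennreal V * 1 + integral\<^sup>N lborel f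
       * (\<integral>\<^sup>+s. ennreal (s powr (- 3 / 2)) * indicator {1..} s \<partial>lborel)"
    unfolding total_def
    by (rule order_trans[OF nn_integral_mono[OF *]])
      (simp add: nn_integral_add nn_integral_cmult nn_integral_cmult_indicator)
  also have "(\<integral>\<^sup>+s. ennreal (s powr (- 3 / 2)) * indicator {1..} s \<partial>lborel)
     = ennreal (0 - (- 2) * 1 powr (- 1 / 2))"
  proof (rule nn_integral_FTC_atLeast[where F="\<lambda>s. (- 2) * s powr (- 1 / 2)"])
    show "DERIV (\<lambda>s. (- 2) * s powr (- 1 / 2)) s :> s powr (- 3 / 2)" if "1 \<le> s" for s :: real
      using DERIV_cmult[OF has_real_derivative_powr[of s "- 1 / 2"], of "- 2"] that by simp
    have "((\<lambda>s::real. (- 2) * s powr (- 1 / 2)) \<longlongrightarrow> (- 2) * 0) at_top"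
      by (intro tendsto_intros tendsto_neg_powr filterlim_ident) auto
    then show "((\<lambda>s::real. (- 2) * s powr (- 1 / 2)) \<longlongrightarrow> 0) at_top" by simp
  qed auto
  finally show ?thesis
    using integral_f_less_top by (auto simp: ennreal_mult_less_top order_le_less_trans)
qed

text \<open>A geometric bound from integrating the majorant once per visit. It gives finiteness and
  dominating constants for fixed k, but its radius of convergence is too crude for the exponential
  moments.\<close>

lemma green_le: "green f k a \<le> total ^ k"
proof (induction k arbitrary: a)
  case (Suc k)
  have "green f (Suc k) a \<le> (\<integral>\<^sup>+s. \<integral>\<^sup>+w. heat s (w - a) * f w * total ^ k \<partial>lborel \<partial>lborel)"
    unfolding green.simps by (intro nn_integral_mono mult_left_mono Suc) auto
  also have "\<dots> \<le> (\<integral>\<^sup>+s. majorant s * total ^ k \<partial>lborel)"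
    by (simp add: nn_integral_multc nn_integral_mono mult_right_mono nn_integral_heat_f_le)
  also have "\<dots> = total ^ Suc k" by (simp add: nn_integral_multc total_def)
  finally show ?case .
qed simp

lemma green_less_top [simp]: "green f k a < \<top>" "green f k a \<noteq> \<top>"
proof -
  have "total ^ k < \<top>" using total_less_top by (simp add: power_less_top_ennreal)
  then show "green f k a < \<top>" "green f k a \<noteq> \<top>" using green_le[of k a] by (auto simp: top_unique)
qed

text \<open>Dominated convergence twice: in space at fixed time, dominated by the maximum of the
  kernel times f, and then in time, dominated by the majorant. Both dominating functions ignore the
  moving starting point.\<close>

lemma tendsto_potential:
  assumes F: "\<And>n. (\<lambda>(s, w). F n s w) \<in> borel_measurable (borel \<Otimes>\<^sub>M borel)"
    and F': "(\<lambda>(s, w). F' s w) \<in> borel_measurable (borel \<Otimes>\<^sub>M borel)"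
    and le: "\<And>n s w. F n s w \<le> K * f w" and K: "K < \<top>"
    and lim: "\<And>s w. 0 < s \<Longrightarrow> (\<lambda>n. F n s w) \<longlonglongrightarrow> F' s w"
    and a: "a \<longlonglongrightarrow> x"
  shows "(\<lambda>n. \<integral>\<^sup>+s. \<integral>\<^sup>+w. heat s (w - a n) * F n s w \<partial>lborel \<partial>lborel)
         \<longlonglongrightarrow> (\<integral>\<^sup>+s. \<integral>\<^sup>+w. heat s (w - x) * F' s w \<partial>lborel \<partial>lborel)"
proof -
  note [measurable (raw)] = measurable_compose[OF measurable_Pair F, simplified]
    measurable_compose[OF measurable_Pair F', simplified]
  show ?thesis
  proof (rule nn_integral_dominated_convergence[where w="\<lambda>s. K * majorant s"])
    fix n
    have "(\<integral>\<^sup>+w. heat s (w - a n) * F n s w \<partial>lborel) \<le> (\<integral>\<^sup>+w. K * (heat s (w - a n) * f w) \<partial>lborel)" for s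
      by (intro nn_integral_mono) (metis le mult.left_commute mult_left_mono zero_le)
    also have "\<dots> s \<le> K * majorant s" for s
      by (simp add: nn_integral_cmult mult_left_mono nn_integral_heat_f_le)
    finally show "AE s in lborel. (\<integral>\<^sup>+w. heat s (w - a n) * F n s w \<partial>lborel) \<le> K * majorant s" by simp
  next
    show "(\<integral>\<^sup>+s. K * majorant s \<partial>lborel) < \<infinity>"
      using K total_less_top by (simp add: nn_integral_cmult total_def[symmetric] ennreal_mult_less_top)
  next
    have "(\<lambda>n. \<integral>\<^sup>+w. heat s (w - a n) * F n s w \<partial>lborel) \<longlonglongrightarrow> (\<integral>\<^sup>+w. heat s (w - x) * F' s w \<partial>lborel)" for s
    proof (cases "0 < s")
      case True
      show ?thesis
      proof (rule nn_integral_dominated_convergence[where w="\<lambda>w. heat s (0::'a) * (K * f w)"])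
        show "AE w in lborel. heat s (w - a n) * F n s w \<le> heat s (0::'a) * (K * f w)" for n
          by (intro AE_I2 mult_mono heat_le le) auto
        show "(\<integral>\<^sup>+w. heat s (0::'a) * (K * f w) \<partial>lborel) < \<infinity>"
          using K integral_f_less_top by (simp add: nn_integral_cmult ennreal_mult_less_top)
        \<comment> \<open>Products converge in \<open>ennreal\<close> unless 0 meets infinity; at
          positive times the kernel is neither.\<close>
        show "AE w in lborel. (\<lambda>n. heat s (w - a n) * F n s w) \<longlonglongrightarrow> heat s (w - x) * F' s w"
          using True heat_neq_0[OF True]
          by (intro AE_I2 tendsto_mult_ennreal tendsto_heat tendsto_intros lim a) auto
      qed measurable
    qed simp
    then show "AE s in lborel. (\<lambda>n. \<integral>\<^sup>+w. heat s (w - a n) * F n s w \<partial>lborel)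
        \<longlonglongrightarrow> (\<integral>\<^sup>+w. heat s (w - x) * F' s w \<partial>lborel)" by simp
  qed measurable
qed

text \<open>The weights are bounded and tend to 1, so they disappear in the limit, and the free
  duration leaves a potential. In the application \<open>H\<close> is the kernel of the long gap
  divided by the kernel at the full time t.\<close>

lemma tendsto_pinned_occupation:
  assumes H: "\<And>n. (\<lambda>(r, w). H n r w) \<in> borel_measurable (borel \<Otimes>\<^sub>M borel)"
    and le: "\<And>n r w. H n r w \<le> K" and K: "K < \<top>"
    and lim: "\<And>r w. 0 < r \<Longrightarrow> (\<lambda>n. H n r w) \<longlonglongrightarrow> 1"
    and b: "b \<longlonglongrightarrow> y"
  shows "(\<lambda>n. \<integral>\<^sup>+r. \<integral>\<^sup>+w. f w * H n r w * pinned f k r (b n) w \<partial>lborel \<partial>lborel) \<longlonglongrightarrow> green f (Suc k) y"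
  using H le lim b
proof (induction k arbitrary: H b y)
  case 0
  note [measurable (raw)] = measurable_compose[OF measurable_Pair 0(1), simplified]
  have "(\<lambda>n. \<integral>\<^sup>+r. \<integral>\<^sup>+w. heat r (w - b n) * (f w * H n r w) \<partial>lborel \<partial>lborel)
      \<longlonglongrightarrow> (\<integral>\<^sup>+r. \<integral>\<^sup>+w. heat r (w - y) * (f w * 1) \<partial>lborel \<partial>lborel)"
    by (intro tendsto_potential[OF _ _ _ K _ 0(4)] tendsto_mult_ennreal tendsto_const 0(3))
      (auto simp: mult.commute[of _ "f _"] intro!: mult_left_mono 0(2))
  then show ?case by (simp add: mult_ac)
next
  case (Suc k)
  note [measurable (raw)] = measurable_compose[OF measurable_Pair Suc(2), simplified]
  let ?G = "\<lambda>n s z. \<integral>\<^sup>+r. \<integral>\<^sup>+w. f w * H n (r + s) w * pinned f k r z w \<partial>lborel \<partial>lborel"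
  have "(\<lambda>n. \<integral>\<^sup>+s. \<integral>\<^sup>+z. heat s (z - b n) * (f z * ?G n s z) \<partial>lborel \<partial>lborel)
      \<longlonglongrightarrow> (\<integral>\<^sup>+s. \<integral>\<^sup>+z. heat s (z - y) * (f z * green f (Suc k) z) \<partial>lborel \<partial>lborel)"
  proof (rule tendsto_potential[where K="K * total ^ Suc k"])
    show "f z * ?G n s z \<le> K * total ^ Suc k * f z" for n s z
    proof -
      have "?G n s z \<le> (\<integral>\<^sup>+r. \<integral>\<^sup>+w. K * (f w * pinned f k r z w) \<partial>lborel \<partial>lborel)"
        using mult_right_mono[OF Suc(3), of "f _ * pinned f _ _ _ _"]
        by (intro nn_integral_mono) (simp add: mult_ac)
      also have "\<dots> = K * green f (Suc k) z"
        by (simp add: nn_integral_cmult nn_integral_pinned del: green.simps)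
      also have "\<dots> \<le> K * total ^ Suc k" by (intro mult_left_mono green_le) auto
      finally show ?thesis by (subst mult.commute) (intro mult_right_mono, auto)
    qed
    show "K * total ^ Suc k < \<top>"
      using K total_less_top by (simp add: ennreal_mult_less_top power_less_top_ennreal)
    show "(\<lambda>n. f z * ?G n s z) \<longlonglongrightarrow> f z * green f (Suc k) z" if "0 < s" for s z
    proof (intro tendsto_mult_ennreal tendsto_const Suc.IH)
      show "(\<lambda>n. H n (r + s) w) \<longlonglongrightarrow> 1" if "0 < r" for r w
        using that \<open>0 < s\<close> by (intro Suc) auto
    qed (use Suc in \<open>auto simp del: green.simps\<close>)
  qed (use Suc in \<open>auto simp del: green.simps\<close>)
  then show ?case
    by (subst nn_integral_pinned_Suc) (auto simp: mult.assoc Suc(2))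
qed

text \<open>Induction over the first gap. If it is shorter than t / 2, the long gap lies in the
  remaining bridge, to which the hypothesis applies; these are the summands with a visit before the
  long gap. Otherwise it is itself the long gap, which adds the summand i = 0.\<close>

theorem tendsto_pinned:
  assumes t: "filterlim t at_top sequentially" and a: "a \<longlonglongrightarrow> x" and b: "b \<longlonglongrightarrow> y"
  shows "(\<lambda>n. pinned f k (t n) (a n) (b n) / heat (t n) (0::'a)) \<longlonglongrightarrow> (\<Sum>i\<le>k. green f i x * green f (k - i) y)"
  using t a
proof (induction k arbitrary: t a x)
  case 0
  then show ?case
    using tendsto_heat_ratio(1)[OF 0(1) tendsto_diff[OF b 0(2)], of 0] by simp
next
  case (Suc k)
  let ?h = "\<lambda>n. heat (t n) (0::'a)"
  have pos: "\<forall>\<^sub>F n in sequentially. c < t n" for c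
    using filterlim_at_top_dense[THEN iffD1, OF Suc(2)] by simp
  \<comment> \<open>The cuts are complementary: s < t / 2 is open in \<open>F\<close>, and with r =
    t - s the condition r \<le> t / 2 in \<open>H\<close> means s \<ge> t / 2.\<close>
  define F where "F = (\<lambda>n s w. indicator {0<..<t n / 2} s * (f w * (pinned f k (t n - s) w (b n) / ?h n)))"
  define H where "H = (\<lambda>n r w. indicator {0<..t n / 2} r * (heat (t n - r) (w - a n) / ?h n))"
  have [measurable]: "(\<lambda>(s, w). F n s w) \<in> borel_measurable (borel \<Otimes>\<^sub>M borel)" for n
    unfolding F_def by measurable
  have [measurable]: "(\<lambda>(s, w). H n s w) \<in> borel_measurable (borel \<Otimes>\<^sub>M borel)" for n
    unfolding H_def by measurable
  \<comment> \<open>While s < t / 2, each of the k + 1 gaps has an average share (t - s) / (k + 1)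
    of at least t / (2 (k + 1)); scaling the kernel down to this time costs the constant in
    front.\<close>
  define K where "K = ennreal ((1 / (2 * real (Suc k))) powr (- real DIM('a) / 2)) * (\<Sum>i\<le>k. total ^ i * total ^ (k - i))"
  have "(\<lambda>n. \<integral>\<^sup>+s. \<integral>\<^sup>+w. heat s (w - a n) * F n s w \<partial>lborel \<partial>lborel)
     \<longlonglongrightarrow> (\<integral>\<^sup>+s. \<integral>\<^sup>+w. heat s (w - x) * (f w * (\<Sum>i\<le>k. green f i w * green f (k - i) y)) \<partial>lborel \<partial>lborel)"
  proof (rule tendsto_potential[where K=K])
    show "K < \<top>" unfolding K_def using total_less_top
      by (auto simp: ennreal_mult_less_top power_less_top_ennreal)
    show "F n s w \<le> K * f w" for n s w
    proof (cases "s \<in> {0<..<t n / 2}")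
      case True
      let ?c = "1 / (2 * real (Suc k))"
      have "pinned f k (t n - s) w (b n)
          \<le> heat ((t n - s) / real (Suc k)) (0::'a) * (\<Sum>i\<le>k. green f i w * green f (k - i) (b n))"
        using True by (intro pinned_le) auto
      also have "\<dots> \<le> heat (?c * t n) (0::'a) * (\<Sum>i\<le>k. total ^ i * total ^ (k - i))"
      proof (intro mult_mono heat_zero_antimono sum_mono green_le)
        have "t n / 2 \<le> t n - s" using True by simp
        from divide_right_mono[OF this, of "real (Suc k)"]
        show "?c * t n \<le> (t n - s) / real (Suc k)" by simp
      qed (use True in auto)
      also have "\<dots> = K * ?h n"
        unfolding K_def using True by (subst heat_zero_scale) (auto simp: mult_ac)
      finally have "pinned f k (t n - s) w (b n) / ?h n \<le> K"
        using True by (intro divide_le_posI_ennreal) (auto simp: heat_neq_0 mult.commute zero_less_iff_neq_zero)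
      then show ?thesis using True by (simp add: F_def mult.commute[of K] mult_left_mono)
    qed (simp add: F_def)
    show "(\<lambda>n. F n s w) \<longlonglongrightarrow> f w * (\<Sum>i\<le>k. green f i w * green f (k - i) y)" if "0 < s" for s w
    proof -
      have ts: "filterlim (\<lambda>n. t n - s) at_top sequentially"
        using filterlim_tendsto_add_at_top[OF tendsto_const[of "- s"] Suc(2)] by simp
      have "(\<lambda>n. f w * ((pinned f k (t n - s) w (b n) / heat (t n - s) (0::'a)) * (heat (t n - s) (0::'a) / ?h n)))
         \<longlonglongrightarrow> f w * ((\<Sum>i\<le>k. green f i w * green f (k - i) y) * 1)"
        by (intro tendsto_mult_ennreal tendsto_const Suc.IH[OF ts] tendsto_heat_ratio(1)[OF Suc(2), of _ 0])
          (auto simp: ennreal_mult_eq_top_iff)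
      \<comment> \<open>For a fixed s the cutoff in \<open>F\<close> is eventually inactive, and the
        kernel at the shortened time t - s cancels.\<close>
      moreover have "\<forall>\<^sub>F n in sequentially. f w * ((pinned f k (t n - s) w (b n) / heat (t n - s) (0::'a))
          * (heat (t n - s) (0::'a) / ?h n)) = F n s w"
        using pos[of "2 * s"]
      proof eventually_elim
        case (elim n)
        then have "heat (t n - s) (0::'a) \<noteq> 0" using that by (intro heat_neq_0) auto
        then have "x / heat (t n - s) (0::'a) * (heat (t n - s) (0::'a) / y) = x / y" for x y
          using ennreal_divide_self[of "heat (t n - s) (0::'a)"]
          by (simp add: divide_ennreal_def) (metis mult.assoc mult.commute mult_1)
        then show ?case using elim that by (simp add: F_def)
      qed
      ultimately show ?thesis by (simp add: tendsto_cong)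
    qed
  qed (use Suc in auto)
  also have "(\<integral>\<^sup>+s. \<integral>\<^sup>+w. heat s (w - x) * (f w * (\<Sum>i\<le>k. green f i w * green f (k - i) y)) \<partial>lborel \<partial>lborel)
      = (\<Sum>i\<le>k. green f (Suc i) x * green f (k - i) y)"
    by (simp add: sum_distrib_left nn_integral_sum nn_integral_multc mult.assoc[symmetric])
  finally have 1: "(\<lambda>n. \<integral>\<^sup>+s. \<integral>\<^sup>+w. heat s (w - a n) * F n s w \<partial>lborel \<partial>lborel)
     \<longlonglongrightarrow> (\<Sum>i\<le>k. green f (Suc i) x * green f (k - i) y)" .
  have 2: "(\<lambda>n. \<integral>\<^sup>+r. \<integral>\<^sup>+w. f w * H n r w * pinned f k r (b n) w \<partial>lborel \<partial>lborel) \<longlonglongrightarrow> green f (Suc k) y"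
  proof (rule tendsto_pinned_occupation[where K="ennreal ((1 / 2) powr (- real DIM('a) / 2))"])
    show "H n r w \<le> ennreal ((1 / 2) powr (- real DIM('a) / 2))" for n r w
    proof (cases "r \<in> {0<..t n / 2}")
      case True
      have "heat (t n - r) (w - a n) \<le> heat (1 / 2 * t n) (0::'a)"
        using True by (intro order_trans[OF heat_le heat_zero_antimono]) auto
      also have "\<dots> = ennreal ((1 / 2) powr (- real DIM('a) / 2)) * ?h n"
        using True by (subst heat_zero_scale) auto
      finally have "heat (t n - r) (w - a n) / ?h n \<le> ennreal ((1 / 2) powr (- real DIM('a) / 2))"
        using True by (intro divide_le_posI_ennreal) (auto simp: heat_neq_0 mult.commute zero_less_iff_neq_zero)
      then show ?thesis using True by (simp add: H_def)
    qed (simp add: H_def)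
    show "(\<lambda>n. H n r w) \<longlonglongrightarrow> 1" if "0 < r" for r w
    proof -
      have "(\<lambda>n. heat (t n - r) (w - a n) / ?h n) \<longlonglongrightarrow> 1"
        by (rule tendsto_heat_ratio(1)[OF Suc(2) tendsto_diff[OF tendsto_const Suc(3)]])
      moreover have "\<forall>\<^sub>F n in sequentially. heat (t n - r) (w - a n) / ?h n = H n r w"
        using pos[of "2 * r"] by eventually_elim (use that in \<open>simp add: H_def\<close>)
      ultimately show ?thesis by (simp add: tendsto_cong)
    qed
  qed (use b in auto)
  have "\<forall>\<^sub>F n in sequentially. pinned f (Suc k) (t n) (a n) (b n) / ?h n
      = (\<integral>\<^sup>+s. \<integral>\<^sup>+w. heat s (w - a n) * F n s w \<partial>lborel \<partial>lborel)
      + (\<integral>\<^sup>+r. \<integral>\<^sup>+w. f w * H n r w * pinned f k r (b n) w \<partial>lborel \<partial>lborel)"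
    using pos[of 0]
  proof eventually_elim
    case (elim n)
    have "pinned f (Suc k) (t n) (a n) (b n) / ?h n
       = (\<integral>\<^sup>+s. \<integral>\<^sup>+w. heat s (w - a n) * f w * (pinned f k (t n - s) w (b n) / ?h n) \<partial>lborel \<partial>lborel)"
      by (simp add: divide_ennreal_def nn_integral_multc mult.assoc[symmetric])
    also have "\<dots> = (\<integral>\<^sup>+s. \<integral>\<^sup>+w. heat s (w - a n) * F n s w
        + f w * H n (t n - s) w * pinned f k (t n - s) w (b n) \<partial>lborel \<partial>lborel)"
    proof (intro nn_integral_cong)
      fix s w
      consider "s \<le> 0" | "0 < s" "s < t n / 2" | "t n / 2 \<le> s" "s < t n" | "t n \<le> s" by linarith
      then show "heat s (w - a n) * f w * (pinned f k (t n - s) w (b n) / ?h n)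
         = heat s (w - a n) * F n s w + f w * H n (t n - s) w * pinned f k (t n - s) w (b n)"
        by cases (auto simp: F_def H_def pinned_nonpos divide_ennreal_def mult_ac elim)
    qed
    also have "\<dots> = (\<integral>\<^sup>+s. \<integral>\<^sup>+w. heat s (w - a n) * F n s w \<partial>lborel \<partial>lborel)
      + (\<integral>\<^sup>+s. \<integral>\<^sup>+w. f w * H n (t n - s) w * pinned f k (t n - s) w (b n) \<partial>lborel \<partial>lborel)"
      by (simp add: nn_integral_add)
    also have "(\<integral>\<^sup>+s. \<integral>\<^sup>+w. f w * H n (t n - s) w * pinned f k (t n - s) w (b n) \<partial>lborel \<partial>lborel)
       = (\<integral>\<^sup>+r. \<integral>\<^sup>+w. f w * H n r w * pinned f k r w (b n) \<partial>lborel \<partial>lborel)"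
      by (subst nn_integral_lborel_reflect[where F="\<lambda>r. \<integral>\<^sup>+w. f w * H n r w * pinned f k r w (b n) \<partial>lborel"]) auto
    finally show ?case by (simp add: pinned_commute[of f _ _ _ "b n"])
  qed
  moreover have "(\<lambda>n. (\<integral>\<^sup>+s. \<integral>\<^sup>+w. heat s (w - a n) * F n s w \<partial>lborel \<partial>lborel)
      + (\<integral>\<^sup>+r. \<integral>\<^sup>+w. f w * H n r w * pinned f k r (b n) w \<partial>lborel \<partial>lborel))
    \<longlonglongrightarrow> (\<Sum>i\<le>k. green f (Suc i) x * green f (k - i) y) + green f (Suc k) y"
    by (intro tendsto_add 1 2)
  moreover have "(\<Sum>i\<le>k. green f (Suc i) x * green f (k - i) y) + green f (Suc k) y
      = (\<Sum>i\<le>Suc k. green f i x * green f (Suc k - i) y)"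
    by (subst sum.atMost_Suc_shift) (simp add: add.commute del: green.simps(2))
  ultimately show ?case by (simp add: tendsto_cong)
qed

corollary tendsto_pinned_normalized:
  assumes t: "filterlim t at_top sequentially" and a: "a \<longlonglongrightarrow> x" and b: "b \<longlonglongrightarrow> y"
  shows "(\<lambda>n. pinned f k (t n) (a n) (b n) / heat (t n) (b n - a n)) \<longlonglongrightarrow> (\<Sum>i\<le>k. green f i x * green f (k - i) y)"
proof -
  have "(\<lambda>n. (pinned f k (t n) (a n) (b n) / heat (t n) (0::'a)) * (heat (t n) (0::'a) / heat (t n) (b n - a n)))
      \<longlonglongrightarrow> (\<Sum>i\<le>k. green f i x * green f (k - i) y) * 1"
    by (intro tendsto_mult_ennreal tendsto_pinned assms tendsto_heat_ratio(2)[OF t tendsto_diff[OF b a]])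
      (auto simp: ennreal_mult_eq_top_iff)
  moreover have "\<forall>\<^sub>F n in sequentially. (pinned f k (t n) (a n) (b n) / heat (t n) (0::'a)) * (heat (t n) (0::'a) / heat (t n) (b n - a n))
      = pinned f k (t n) (a n) (b n) / heat (t n) (b n - a n)"
    using filterlim_at_top_dense[THEN iffD1, OF t, rule_format, of 0]
  proof eventually_elim
    case (elim n)
    then show ?case
      using ennreal_divide_self[of "heat (t n) (0::'a)"] heat_neq_0[OF elim, of "0::'a"]
      by (simp add: divide_ennreal_def) (metis mult.assoc mult.commute mult_1)
  qed
  ultimately show ?thesis by (simp add: tendsto_cong)
qed

text \<open>The only loss beyond the sum of potentials is polynomial in k, apart from a kernel ratio
  that does not depend on k.\<close>

lemma pinned_normalized_le:
  assumes "0 < t"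
  shows "pinned f k t a b / heat t (b - a) \<le> ennreal (real (Suc k) powr (real DIM('a) / 2))
      * (heat t (0::'a) / heat t (b - a)) * (\<Sum>i\<le>k. green f i a * green f (k - i) b)"
proof -
  have "pinned f k t a b \<le> heat (1 / real (Suc k) * t) (0::'a) * (\<Sum>i\<le>k. green f i a * green f (k - i) b)"
    using pinned_le[OF f_measurable assms] by simp
  also have "heat (1 / real (Suc k) * t) (0::'a)
      = ennreal (real (Suc k) powr (real DIM('a) / 2)) * heat t (0::'a)"
  proof -
    have "(1 / real (Suc k)) powr (- real DIM('a) / 2) = real (Suc k) powr (real DIM('a) / 2)"
      by (subst powr_divide) (auto simp: powr_minus_divide)
    then show ?thesis using assms by (subst heat_zero_scale) auto
  qed
  finally have "pinned f k t a b * inverse (heat t (b - a))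
      \<le> ennreal (real (Suc k) powr (real DIM('a) / 2)) * heat t (0::'a)
         * (\<Sum>i\<le>k. green f i a * green f (k - i) b) * inverse (heat t (b - a))"
    by (rule mult_right_mono) simp
  then show ?thesis unfolding divide_ennreal_def by (simp only: mult_ac)
qed

text \<open>The part of the potential up to time \<open>e\<close> contributes little; after time \<open>e\<close> the heat
  kernels of different starting points are comparable.\<close>

lemma green_harnack:
  fixes e r :: real
  assumes e: "0 < e" and r: "R \<le> r"
  shows "\<exists>c<\<top>. \<forall>k. (SUP a\<in>cball 0 r. green f (Suc k) a)
           \<le> ennreal (e * V) * (SUP a\<in>cball 0 r. green f k a) + c * green f (Suc k) 0"
proof -
  define c where "c = ennreal (exp (r\<^sup>2 / (2 * e)) * 2 powr (real DIM('a) / 2))"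
  have "green f (Suc k) a \<le> ennreal (e * V) * (SUP a\<in>cball 0 r. green f k a) + c * green f (Suc k) 0"
    if a: "norm a \<le> r" for a k
  proof -
    let ?m = "SUP a\<in>cball 0 r. green f k a"
    have "heat s (w - a) * f w * green f k w
        \<le> heat s (w - a) * (ennreal V * ?m * indicator {0..e} s)
          + c * (heat (2 * s) (w - 0) * f w * green f k w)" (is "?l \<le> ?r1 + ?r2") for s w
    proof -
      consider "s \<le> 0" | "f w = 0" | "0 < s" "s \<le> e" "f w \<noteq> 0" | "e < s" by linarith
      then show ?thesis
      proof cases
        case 3
        \<comment> \<open>The support of f lies in the ball, so the supremum over the ball bounds
          the next potential at every point that counts. This closes the recursion on one fixed
          ball.\<close>
        then have "w \<in> cball 0 r" using f_support[of w] r by (auto simp: not_less[symmetric])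
        then have "f w * green f k w \<le> ennreal V * ?m" by (intro mult_mono f_le SUP_upper) auto
        then have "heat s (w - a) * (f w * green f k w) \<le> heat s (w - a) * (ennreal V * ?m)"
          by (rule mult_left_mono) simp
        then have "?l \<le> ?r1" using 3 by (simp add: mult_ac)
        then show ?thesis by (rule add_increasing2[OF zero_le])
      next
        case 4
        then have "heat s (w - a) \<le> c * heat (2 * s) w"
          unfolding c_def using e a by (intro heat_recenter) auto
        then have "heat s (w - a) * (f w * green f k w) \<le> c * heat (2 * s) w * (f w * green f k w)"
          by (rule mult_right_mono) simp
        then have "?l \<le> ?r2" by (simp add: mult_ac)
        then show ?thesis by (rule add_increasing[OF zero_le])
      qed auto
    qed
    then have "green f (Suc k) a \<le> (\<integral>\<^sup>+s. \<integral>\<^sup>+w. heat s (w - a) * (ennreal V * ?m * indicator {0..e} s)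
        + c * (heat (2 * s) (w - 0) * f w * green f k w) \<partial>lborel \<partial>lborel)"
      by (auto intro!: nn_integral_mono)
    also have "\<dots> = (\<integral>\<^sup>+s. (\<integral>\<^sup>+w. heat s (w - a) \<partial>lborel) * (ennreal V * ?m * indicator {0..e} s) \<partial>lborel)
        + c * (\<integral>\<^sup>+s. \<integral>\<^sup>+w. heat (2 * s) (w - 0) * f w * green f k w \<partial>lborel \<partial>lborel)"
      by (simp add: nn_integral_add nn_integral_multc nn_integral_cmult)
    \<comment> \<open>The factor 2, inserted by 1 \<le> 2, is the Jacobian that will undo the
      doubling of time caused by recentering at the origin.\<close>
    also have "\<dots> \<le> (\<integral>\<^sup>+s. 1 * (ennreal V * ?m * indicator {0..e} s) \<partial>lborel)
        + c * (2 * (\<integral>\<^sup>+s. \<integral>\<^sup>+w. heat (2 * s) (w - 0) * f w * green f k w \<partial>lborel \<partial>lborel))"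
      using mult_right_mono[of 1 "2::ennreal"]
      by (intro add_mono nn_integral_mono mult_right_mono mult_left_mono nn_integral_heat') simp_all
    also have "(\<integral>\<^sup>+s. 1 * (ennreal V * ?m * indicator {0..e} s) \<partial>lborel) = ennreal (e * V) * ?m"
    proof -
      have "ennreal (e * V) = ennreal V * ennreal e"
        using e by (subst ennreal_mult') (auto simp: mult.commute)
      then show ?thesis
        using e by (simp only: mult_1, subst nn_integral_cmult_indicator) (auto simp: mult_ac)
    qed
    also have "2 * (\<integral>\<^sup>+s. \<integral>\<^sup>+w. heat (2 * s) (w - 0) * f w * green f k w \<partial>lborel \<partial>lborel) = green f (Suc k) 0"
    proof -
      have "green f (Suc k) 0
          = ennreal \<bar>2\<bar> * (\<integral>\<^sup>+s. \<integral>\<^sup>+w. heat (0 + 2 * s) (w - 0) * f w * green f k w \<partial>lborel \<partial>lborel)"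
        unfolding green.simps by (rule nn_integral_real_affine) auto
      then show ?thesis by (simp del: green.simps)
    qed
    finally show ?thesis .
  qed
  then have "\<forall>k. (SUP a\<in>cball 0 r. green f (Suc k) a)
           \<le> ennreal (e * V) * (SUP a\<in>cball 0 r. green f k a) + c * green f (Suc k) 0"
    by (intro allI SUP_least) auto
  moreover have "c < \<top>" by (simp add: c_def)
  ultimately show ?thesis by blast
qed

text \<open>Weighting the Harnack recursion by powers of \<alpha>, the partial sums S of the suprema
  over a ball satisfy S \<le> (1 + c T) + S / 2, where T is the series at the origin. Hence
  convergence at one point bounds the terms on every ball, for the same \<alpha>.\<close>

lemma green_locally_bounded:
  fixes \<alpha> r :: real
  assumes \<alpha>: "0 < \<alpha>" and fin: "(\<Sum>k. ennreal \<alpha> ^ k * green f k 0) < \<top>"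
  shows "\<exists>C<\<top>. \<forall>k a. norm a \<le> r \<longrightarrow> ennreal \<alpha> ^ k * green f k a \<le> C"
proof -
  \<comment> \<open>The ball has to contain the support of f, and it must be nonempty, since
    otherwise the supremum for k = 0 would be 0 instead of 1.\<close>
  define q where "q = max R (max r 0)"
  \<comment> \<open>Chosen so that \<alpha> e V \<le> 1 / 2; the maximum with 1 keeps
    \<open>e\<close> positive and finite whatever V is.\<close>
  define e where "e = 1 / (2 * \<alpha> * max V 1)"
  have e: "0 < e" using \<alpha> by (simp add: e_def)
  have "\<alpha> * (e * V) \<le> 1 / 2"
    using \<alpha> by (cases "V \<le> 1") (auto simp: e_def field_simps)
  then have small: "ennreal \<alpha> * ennreal (e * V) \<le> ennreal (1 / 2)"
    using \<alpha> by (metis ennreal_leI ennreal_mult' less_imp_le)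
  obtain c where c: "c < \<top>" and step: "\<And>k. (SUP a\<in>cball 0 q. green f (Suc k) a)
           \<le> ennreal (e * V) * (SUP a\<in>cball 0 q. green f k a) + c * green f (Suc k) 0"
    using green_harnack[OF e, of q] by (auto simp: q_def)
  define m where "m k = (SUP a\<in>cball 0 q. green f k a)" for k
  define T where "T = (\<Sum>k. ennreal \<alpha> ^ k * green f k 0)"
  define S where "S n = (\<Sum>k\<le>n. ennreal \<alpha> ^ k * m k)" for n
  have m0: "m 0 = 1" by (simp add: m_def q_def)
  have m_fin: "m k < \<top>" for k
  proof -
    have "m k \<le> total ^ k" unfolding m_def by (intro SUP_least green_le)
    also have "\<dots> < \<top>" using total_less_top by (simp add: power_less_top_ennreal)
    finally show ?thesis .
  qed
  have S_fin: "S n < \<top>" for n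
    unfolding S_def using m_fin by (auto simp: ennreal_mult_less_top power_less_top_ennreal)
  have S_step: "S n \<le> (1 + c * T) + ennreal (1 / 2) * S n" for n
  proof (cases n)
    case 0
    then show ?thesis by (simp add: S_def m0 add_increasing2 add.assoc)
  next
    case (Suc n')
    have "S n = 1 + (\<Sum>k\<le>n'. ennreal \<alpha> ^ Suc k * m (Suc k))"
      unfolding S_def Suc by (subst sum.atMost_Suc_shift) (simp add: m0)
    also have "(\<Sum>k\<le>n'. ennreal \<alpha> ^ Suc k * m (Suc k))
       \<le> (\<Sum>k\<le>n'. ennreal (1 / 2) * (ennreal \<alpha> ^ k * m k) + c * (ennreal \<alpha> ^ Suc k * green f (Suc k) 0))"
    proof (intro sum_mono)
      fix k
      have "ennreal \<alpha> ^ Suc k * m (Suc k)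
          \<le> ennreal \<alpha> ^ Suc k * (ennreal (e * V) * m k + c * green f (Suc k) 0)"
        unfolding m_def by (intro mult_left_mono step) auto
      also have "\<dots> = (ennreal \<alpha> * ennreal (e * V)) * (ennreal \<alpha> ^ k * m k) + c * (ennreal \<alpha> ^ Suc k * green f (Suc k) 0)"
        by (simp only: distrib_left power_Suc mult_ac)
      also have "\<dots> \<le> ennreal (1 / 2) * (ennreal \<alpha> ^ k * m k) + c * (ennreal \<alpha> ^ Suc k * green f (Suc k) 0)"
        by (intro add_right_mono mult_right_mono small) auto
      finally show "ennreal \<alpha> ^ Suc k * m (Suc k) \<le> \<dots>" .
    qed
    also have "\<dots> = ennreal (1 / 2) * (\<Sum>k\<le>n'. ennreal \<alpha> ^ k * m k)
        + c * (\<Sum>k\<le>n'. ennreal \<alpha> ^ Suc k * green f (Suc k) 0)"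
      by (simp only: sum.distrib sum_distrib_left)
    finally have "S n \<le> 1 + (ennreal (1 / 2) * (\<Sum>k\<le>n'. ennreal \<alpha> ^ k * m k)
        + c * (\<Sum>k\<le>n'. ennreal \<alpha> ^ Suc k * green f (Suc k) 0))"
      by (simp only: add_left_mono)
    moreover have "(\<Sum>k\<le>n'. ennreal \<alpha> ^ k * m k) \<le> S n"
      unfolding S_def Suc by (intro sum_mono2) auto
    moreover have "(\<Sum>k\<le>n'. ennreal \<alpha> ^ Suc k * green f (Suc k) 0) \<le> T"
    proof -
      have "(\<Sum>k\<le>n'. ennreal \<alpha> ^ Suc k * green f (Suc k) 0) \<le> (\<Sum>k\<le>n. ennreal \<alpha> ^ k * green f k 0)"
        unfolding Suc by (subst sum.atMost_Suc_shift) (simp only: add_increasing zero_le order_refl)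
      also have "\<dots> \<le> T" unfolding T_def by (intro sum_le_suminf) auto
      finally show ?thesis .
    qed
    ultimately have "S n \<le> 1 + (ennreal (1 / 2) * S n + c * T)"
      by (meson add_mono mult_left_mono order_refl order_trans zero_le)
    then show ?thesis by (simp only: ac_simps)
  qed
  have S_le: "S n \<le> 2 * (1 + c * T)" for n
  proof -
    \<comment> \<open>Absorbing S / 2 into the left side is legitimate only because S is finite, so
      the inequality is moved to the reals.\<close>
    have cT: "1 + c * T < \<top>" using c fin by (simp add: T_def[symmetric] ennreal_mult_less_top)
    obtain s where s: "S n = ennreal s" "0 \<le> s" using S_fin[of n] by (cases "S n") auto
    obtain u where u: "1 + c * T = ennreal u" "0 \<le> u" using cT by (cases "1 + c * T") auto
    have "ennreal s \<le> ennreal u + ennreal (1 / 2) * ennreal s"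
      using S_step[of n] unfolding s(1) u(1) .
    also have "ennreal (1 / 2) * ennreal s = ennreal (1 / 2 * s)"
      by (rule ennreal_mult'[symmetric]) simp
    also have "ennreal u + \<dots> = ennreal (u + 1 / 2 * s)"
      by (rule ennreal_plus[symmetric]) (use s u in auto)
    finally have "s \<le> 2 * u" using s u by (subst (asm) ennreal_le_iff) auto
    then have "ennreal s \<le> ennreal (2 * u)" by (rule ennreal_leI)
    also have "\<dots> = 2 * ennreal u" using ennreal_mult'[of 2 u] by simp
    finally show ?thesis unfolding s(1) u(1) .
  qed
  have "ennreal \<alpha> ^ k * green f k a \<le> 2 * (1 + c * T)" if "norm a \<le> r" for k a
  proof -
    have "a \<in> cball 0 q" using that by (auto simp: q_def)
    then have "ennreal \<alpha> ^ k * green f k a \<le> ennreal \<alpha> ^ k * m k"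
      unfolding m_def by (intro mult_left_mono SUP_upper) auto
    also have "\<dots> \<le> S k" unfolding S_def by (rule member_le_sum) auto
    also note S_le
    finally show ?thesis .
  qed
  moreover have "2 * (1 + c * T) < \<top>"
    using c fin by (simp add: T_def[symmetric] ennreal_mult_less_top)
  ultimately show ?thesis by blast
qed

end

subsection \<open>Moments of additive functionals\<close>

text \<open>The integral of the product of \<phi> over chains s < u_1 < ... < u_k. Absolute times
  replace gaps here because \<phi> will be evaluated along a path.\<close>

primrec tail_iter :: "(real \<Rightarrow> ennreal) \<Rightarrow> nat \<Rightarrow> real \<Rightarrow> ennreal" where
  "tail_iter \<phi> 0 s = 1"
| "tail_iter \<phi> (Suc k) s = (\<integral>\<^sup>+u. (if s < u then \<phi> u * tail_iter \<phi> k u else 0) \<partial>lborel)"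

lemma tail_iter_measurable [measurable]:
  assumes [measurable]: "\<phi> \<in> borel_measurable borel"
  shows "tail_iter \<phi> k \<in> borel_measurable borel"
  by (induction k) auto

lemma tail_iter_1: "tail_iter \<phi> (Suc 0) s = (\<integral>\<^sup>+u. (if s < u then \<phi> u else 0) \<partial>lborel)"
  by (simp cong: if_cong)

text \<open>Inserting one more point \<open>u\<close> into an ordered chain \<open>s < s\<^sub>1 < \<dots> < s\<^sub>k\<close> can be done in \<open>k + 1\<close> places.\<close>

lemma tail_iter_mult:
  assumes [measurable]: "\<phi> \<in> borel_measurable borel"
  shows "tail_iter \<phi> (Suc 0) s * tail_iter \<phi> k s = of_nat (Suc k) * tail_iter \<phi> (Suc k) s"
proof (induction k arbitrary: s)
  case (Suc k)
  let ?T = "tail_iter \<phi>"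
  have "?T (Suc 0) s * ?T (Suc k) s
      = (\<integral>\<^sup>+u. \<integral>\<^sup>+r. (if s < u then \<phi> u else 0) * (if s < r then \<phi> r * ?T k r else 0) \<partial>lborel \<partial>lborel)"
    by (simp add: nn_integral_cmult nn_integral_multc cong: if_cong)
  \<comment> \<open>Either u precedes the first chain point r and extends the chain at its start, or
    it follows r and the induction hypothesis inserts it among the later points. The diagonal u = r
    is a null set.\<close>
  also have "\<dots> = (\<integral>\<^sup>+u. \<integral>\<^sup>+r. (if s < u then \<phi> u else 0) * (if u < r then \<phi> r * ?T k r else 0)
      + (if s < r then \<phi> r * ?T k r else 0) * (if r < u then \<phi> u else 0) \<partial>lborel \<partial>lborel)"
  proof (rule nn_integral_cong, rule nn_integral_cong_AE)
    fix u
    show "AE r in lborel. (if s < u then \<phi> u else 0) * (if s < r then \<phi> r * ?T k r else 0)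
       = (if s < u then \<phi> u else 0) * (if u < r then \<phi> r * ?T k r else 0)
       + (if s < r then \<phi> r * ?T k r else 0) * (if r < u then \<phi> u else 0)"
      using AE_lborel_singleton[of u] by eventually_elim (auto simp: mult.commute)
  qed
  also have "\<dots> = (\<integral>\<^sup>+u. \<integral>\<^sup>+r. (if s < u then \<phi> u else 0) * (if u < r then \<phi> r * ?T k r else 0) \<partial>lborel \<partial>lborel)
      + (\<integral>\<^sup>+u. \<integral>\<^sup>+r. (if s < r then \<phi> r * ?T k r else 0) * (if r < u then \<phi> u else 0) \<partial>lborel \<partial>lborel)"
    by (simp add: nn_integral_add)
  also have "(\<integral>\<^sup>+u. \<integral>\<^sup>+r. (if s < u then \<phi> u else 0) * (if u < r then \<phi> r * ?T k r else 0) \<partial>lborel \<partial>lborel)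
      = ?T (Suc (Suc k)) s"
    by (subst tail_iter.simps(2), intro nn_integral_cong) (simp add: nn_integral_cmult)
  also have "(\<integral>\<^sup>+u. \<integral>\<^sup>+r. (if s < r then \<phi> r * ?T k r else 0) * (if r < u then \<phi> u else 0) \<partial>lborel \<partial>lborel)
      = (\<integral>\<^sup>+r. \<integral>\<^sup>+u. (if s < r then \<phi> r * ?T k r else 0) * (if r < u then \<phi> u else 0) \<partial>lborel \<partial>lborel)"
    by (intro lborel_pair.Fubini') measurable
  also have "\<dots> = (\<integral>\<^sup>+r. (if s < r then \<phi> r * (?T (Suc 0) r * ?T k r) else 0) \<partial>lborel)"
    by (intro nn_integral_cong) (simp add: nn_integral_cmult tail_iter_1 mult_ac del: tail_iter.simps)
  also have "\<dots> = (\<integral>\<^sup>+r. of_nat (Suc k) * (if s < r then \<phi> r * ?T (Suc k) r else 0) \<partial>lborel)"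
    unfolding Suc by (intro nn_integral_cong) (simp add: mult_ac del: tail_iter.simps of_nat_Suc)
  also have "\<dots> = of_nat (Suc k) * ?T (Suc (Suc k)) s"
    by (simp add: nn_integral_cmult del: of_nat_Suc)
  finally show ?case by (simp add: distrib_right del: tail_iter.simps)
qed simp

lemma tail_iter_power:
  assumes [measurable]: "\<phi> \<in> borel_measurable borel"
  shows "tail_iter \<phi> (Suc 0) s ^ k = fact k * tail_iter \<phi> k s"
proof (induction k)
  case (Suc k)
  have "tail_iter \<phi> (Suc 0) s ^ Suc k = fact k * (tail_iter \<phi> (Suc 0) s * tail_iter \<phi> k s)"
    unfolding power_Suc Suc by (simp only: mult_ac)
  also have "\<dots> = fact (Suc k) * tail_iter \<phi> (Suc k) s"
    unfolding tail_iter_mult[OF assms] by (simp add: mult_ac del: tail_iter.simps)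
  finally show ?case .
qed simp

lemma tail_iter_measurable_pair:
  assumes \<phi>: "(\<lambda>(u, \<omega>). \<phi> u \<omega>) \<in> borel_measurable (borel \<Otimes>\<^sub>M M)"
  shows "(\<lambda>(s, \<omega>). tail_iter (\<lambda>u. \<phi> u \<omega>) k s) \<in> borel_measurable (borel \<Otimes>\<^sub>M M)"
proof (induction k)
  case (Suc k)
  note [measurable (raw)] = measurable_compose[OF measurable_Pair \<phi>, simplified]
    measurable_compose[OF measurable_Pair Suc, simplified]
  show ?case unfolding tail_iter.simps by measurable
qed simp

text \<open>The mean of f(z_1) ... f(z_m) F(z_m) for a path with heat kernel transitions. The
  recursion runs from the last time inwards, so that appending a time is one unfolding; for m = 0
  the weight is read at the starting point.\<close>

primrec cylinder :: "('a::euclidean_space \<Rightarrow> ennreal) \<Rightarrow> (nat \<Rightarrow> real) \<Rightarrow> 'a \<Rightarrow> nat \<Rightarrow> ('a \<Rightarrow> ennreal) \<Rightarrow> ennreal" where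
  "cylinder f \<sigma> a 0 F = F a"
| "cylinder f \<sigma> a (Suc m) F = cylinder f \<sigma> a m (\<lambda>z. \<integral>\<^sup>+w. heat (\<sigma> (Suc m) - \<sigma> m) (w - z) * f w * F w \<partial>lborel)"

lemma cylinder_cong: "(\<And>j. j \<le> m \<Longrightarrow> \<sigma> j = \<tau> j) \<Longrightarrow> cylinder f \<sigma> a m F = cylinder f \<tau> a m F"
  by (induction m arbitrary: F) auto

lemma cylinder_zero: "cylinder f \<sigma> a m (\<lambda>_. 0) = 0"
  by (induction m) auto

lemma nn_integral_cylinder:
  assumes [measurable]: "f \<in> borel_measurable borel"
    and h: "(\<lambda>(u, z). h u z) \<in> borel_measurable (borel \<Otimes>\<^sub>M borel)"
  shows "(\<integral>\<^sup>+u. cylinder f \<sigma> a m (h u) \<partial>(lborel :: real measure)) = cylinder f \<sigma> a m (\<lambda>z. \<integral>\<^sup>+u. h u z \<partial>lborel)"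
  using h
proof (induction m arbitrary: h)
  case (Suc m)
  note [measurable (raw)] = measurable_compose[OF measurable_Pair Suc(2), simplified]
  have "(\<integral>\<^sup>+u. \<integral>\<^sup>+w. heat (\<sigma> (Suc m) - \<sigma> m) (w - z) * f w * h u w \<partial>lborel \<partial>lborel)
     = (\<integral>\<^sup>+w. \<integral>\<^sup>+u. heat (\<sigma> (Suc m) - \<sigma> m) (w - z) * f w * h u w \<partial>lborel \<partial>lborel)" for z
    by (intro lborel_pair.Fubini') measurable
  then show ?case
    unfolding cylinder.simps by (subst Suc.IH) (auto simp: nn_integral_cmult)
qed simp

text \<open>\<open>D k s z\<close> is the contribution of k further visits after time s from
  position z. The first m visits are kept fixed so that the induction on k can move one integration
  time after the other into them. Both the motion and the bridge are instances: only
  \<open>D 0\<close> and the finite-dimensional identity \<open>fd\<close> differ.\<close>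

lemma nn_integral_chain:
  fixes D :: "nat \<Rightarrow> real \<Rightarrow> 'a::euclidean_space \<Rightarrow> ennreal"
  assumes "sigma_finite_measure M"
    and f [measurable]: "f \<in> borel_measurable borel"
    and \<phi>: "(\<lambda>(u, \<omega>). \<phi> u \<omega>) \<in> borel_measurable (borel \<Otimes>\<^sub>M M)"
    and D: "\<And>k. (\<lambda>(s, z). D k s z) \<in> borel_measurable (borel \<Otimes>\<^sub>M borel)"
    and D_Suc: "\<And>k s z. D (Suc k) s z = (\<integral>\<^sup>+u. \<integral>\<^sup>+w. heat (u - s) (w - z) * f w * D k u w \<partial>lborel \<partial>lborel)"
    and fd: "\<And>m \<sigma>. \<sigma> 0 = 0 \<Longrightarrow> (\<And>j. j < m \<Longrightarrow> \<sigma> j < \<sigma> (Suc j))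
       \<Longrightarrow> (\<integral>\<^sup>+\<omega>. (\<Prod>j<m. \<phi> (\<sigma> (Suc j)) \<omega>) \<partial>M) = cylinder f \<sigma> a m (D 0 (\<sigma> m))"
    and \<sigma>: "\<sigma> 0 = 0" "\<And>j. j < m \<Longrightarrow> \<sigma> j < \<sigma> (Suc j)"
  shows "(\<integral>\<^sup>+\<omega>. (\<Prod>j<m. \<phi> (\<sigma> (Suc j)) \<omega>) * tail_iter (\<lambda>u. \<phi> u \<omega>) k (\<sigma> m) \<partial>M) = cylinder f \<sigma> a m (D k (\<sigma> m))"
  using \<sigma>
proof (induction k arbitrary: m \<sigma>)
  case 0
  then show ?case using fd by simp
next
  case (Suc k)
  interpret M: sigma_finite_measure M by fact
  interpret pair_sigma_finite M lborel ..
  note [measurable (raw)] = measurable_compose[OF measurable_Pair \<phi>, simplified]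
    measurable_compose[OF measurable_Pair tail_iter_measurable_pair[OF \<phi>], simplified]
    measurable_compose[OF measurable_Pair D, simplified]
  let ?P = "\<lambda>\<omega>. \<Prod>j<m. \<phi> (\<sigma> (Suc j)) \<omega>"
  let ?T = "\<lambda>k u \<omega>. tail_iter (\<lambda>u. \<phi> u \<omega>) k u"
  \<comment> \<open>A later u becomes the fixed time number m + 1; for other u both sides vanish,
    the right one because the kernel is 0 at nonpositive times.\<close>
  have step: "(\<integral>\<^sup>+\<omega>. ?P \<omega> * (if \<sigma> m < u then \<phi> u \<omega> * ?T k u \<omega> else 0) \<partial>M)
      = cylinder f \<sigma> a m (\<lambda>z. \<integral>\<^sup>+w. heat (u - \<sigma> m) (w - z) * f w * D k u w \<partial>lborel)" for u
  proof (cases "\<sigma> m < u")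
    case True
    let ?\<tau> = "\<sigma>(Suc m := u)"
    have "(\<integral>\<^sup>+\<omega>. (\<Prod>j<Suc m. \<phi> (?\<tau> (Suc j)) \<omega>) * ?T k (?\<tau> (Suc m)) \<omega> \<partial>M)
        = cylinder f ?\<tau> a (Suc m) (D k (?\<tau> (Suc m)))"
      using Suc.prems True by (intro Suc.IH) (auto simp: less_Suc_eq)
    moreover have "cylinder f ?\<tau> a m F = cylinder f \<sigma> a m F" for F
      by (intro cylinder_cong) auto
    ultimately show ?thesis using True by (simp add: mult_ac)
  next
    case False
    then show ?thesis by (simp add: cylinder_zero)
  qed
  have "(\<integral>\<^sup>+\<omega>. ?P \<omega> * ?T (Suc k) (\<sigma> m) \<omega> \<partial>M)
      = (\<integral>\<^sup>+\<omega>. \<integral>\<^sup>+u. ?P \<omega> * (if \<sigma> m < u then \<phi> u \<omega> * ?T k u \<omega> else 0) \<partial>lborel \<partial>M)"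
  proof (intro nn_integral_cong)
    fix \<omega> assume "\<omega> \<in> space M"
    then have "(\<lambda>u. if \<sigma> m < u then \<phi> u \<omega> * ?T k u \<omega> else 0) \<in> borel_measurable borel" by measurable
    then show "?P \<omega> * ?T (Suc k) (\<sigma> m) \<omega>
        = (\<integral>\<^sup>+u. ?P \<omega> * (if \<sigma> m < u then \<phi> u \<omega> * ?T k u \<omega> else 0) \<partial>lborel)"
      by (simp add: nn_integral_cmult)
  qed
  also have "\<dots> = (\<integral>\<^sup>+u. \<integral>\<^sup>+\<omega>. ?P \<omega> * (if \<sigma> m < u then \<phi> u \<omega> * ?T k u \<omega> else 0) \<partial>M \<partial>lborel)"
    by (intro Fubini'[symmetric]) measurable
  also have "\<dots> = cylinder f \<sigma> a m (\<lambda>z. \<integral>\<^sup>+u. \<integral>\<^sup>+w. heat (u - \<sigma> m) (w - z) * f w * D k u w \<partial>lborel \<partial>lborel)"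
    unfolding step by (intro nn_integral_cylinder) measurable
  finally show ?case by (simp add: D_Suc)
qed

lemma nn_integral_power_additive_functional:
  fixes D :: "nat \<Rightarrow> real \<Rightarrow> 'a::euclidean_space \<Rightarrow> ennreal"
  assumes M: "sigma_finite_measure M"
    and f [measurable]: "f \<in> borel_measurable borel"
    and \<phi>: "(\<lambda>(u, \<omega>). \<phi> u \<omega>) \<in> borel_measurable (borel \<Otimes>\<^sub>M M)"
    and D: "\<And>k. (\<lambda>(s, z). D k s z) \<in> borel_measurable (borel \<Otimes>\<^sub>M borel)"
    and D_Suc: "\<And>k s z. D (Suc k) s z = (\<integral>\<^sup>+u. \<integral>\<^sup>+w. heat (u - s) (w - z) * f w * D k u w \<partial>lborel \<partial>lborel)"
    and fd: "\<And>m \<sigma>. \<sigma> 0 = 0 \<Longrightarrow> (\<And>j. j < m \<Longrightarrow> \<sigma> j < \<sigma> (Suc j))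
       \<Longrightarrow> (\<integral>\<^sup>+\<omega>. (\<Prod>j<m. \<phi> (\<sigma> (Suc j)) \<omega>) \<partial>M) = cylinder f \<sigma> a m (D 0 (\<sigma> m))"
  shows "(\<integral>\<^sup>+\<omega>. (\<integral>\<^sup>+u. (if 0 < u then \<phi> u \<omega> else 0) \<partial>lborel) ^ k \<partial>M) = fact k * D k 0 a"
proof -
  note [measurable (raw)] = measurable_compose[OF measurable_Pair \<phi>, simplified]
    measurable_compose[OF measurable_Pair tail_iter_measurable_pair[OF \<phi>], simplified]
  have "(\<integral>\<^sup>+u. (if 0 < u then \<phi> u \<omega> else 0) \<partial>lborel) ^ k = fact k * tail_iter (\<lambda>u. \<phi> u \<omega>) k 0"
    if "\<omega> \<in> space M" for \<omega>
  proof -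
    have [measurable]: "(\<lambda>u. \<phi> u \<omega>) \<in> borel_measurable borel" using that by measurable
    show ?thesis using tail_iter_power[of "\<lambda>u. \<phi> u \<omega>" 0 k] by (simp cong: if_cong)
  qed
  then have "(\<integral>\<^sup>+\<omega>. (\<integral>\<^sup>+u. (if 0 < u then \<phi> u \<omega> else 0) \<partial>lborel) ^ k \<partial>M)
      = fact k * (\<integral>\<^sup>+\<omega>. tail_iter (\<lambda>u. \<phi> u \<omega>) k 0 \<partial>M)"
    by (simp add: nn_integral_cmult cong: nn_integral_cong)
  also have "(\<integral>\<^sup>+\<omega>. tail_iter (\<lambda>u. \<phi> u \<omega>) k 0 \<partial>M) = D k 0 a"
    using nn_integral_chain[OF M f \<phi> D D_Suc fd, of "\<lambda>_. 0" 0 k] by simp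
  finally show ?thesis .
qed

subsection \<open>Finite-dimensional distributions\<close>

text \<open>For Brownian motion the product structure sits in the increments, and positions are
  their partial sums. Integrating out the last increment translates it to a transition kernel from
  the previous position.\<close>

lemma nn_integral_PiM_increments:
  fixes f F :: "'a::euclidean_space \<Rightarrow> ennreal"
  assumes [measurable]: "f \<in> borel_measurable borel" and F: "F \<in> borel_measurable borel"
  shows "(\<integral>\<^sup>+u. (\<Prod>j<m. f (a + (\<Sum>i<Suc j. u i))) * F (a + (\<Sum>i<m. u i))
           \<partial>Pi\<^sub>M {..<m} (\<lambda>i. density lborel (heat (\<sigma> (Suc i) - \<sigma> i)))) = cylinder f \<sigma> a m F"
  using F
proof (induction m arbitrary: F)
  case 0
  then show ?case by (simp add: nn_integral_count_space_finite PiM_empty)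
next
  case (Suc m)
  note [measurable] = Suc(2)
  define \<nu> where "\<nu> i = density lborel (heat (\<sigma> (Suc i) - \<sigma> i) :: 'a \<Rightarrow> ennreal)" for i
  have sets_\<nu> [measurable_cong, simp]: "sets (\<nu> i) = sets borel" for i by (simp add: \<nu>_def)
  \<comment> \<open>The times are not assumed increasing, so a factor may be the zero measure; total
    mass at most 1 is all that holds.\<close>
  have "finite_measure (\<nu> i)" for i
  proof
    have "emeasure (\<nu> i) (space (\<nu> i)) = (\<integral>\<^sup>+x. heat (\<sigma> (Suc i) - \<sigma> i) (x - (0::'a)) \<partial>lborel)"
      by (simp add: \<nu>_def emeasure_density)
    also have "\<dots> \<le> 1" by (rule nn_integral_heat')
    finally show "emeasure (\<nu> i) (space (\<nu> i)) \<noteq> \<infinity>" by (auto simp: top_unique)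
  qed
  then interpret product_sigma_finite \<nu>
    by (intro product_sigma_finite.intro finite_measure.sigma_finite_measure)
  have meas: "(\<lambda>u. (\<Prod>j<n. f (a + (\<Sum>i<Suc j. u i))) * G (a + (\<Sum>i<n. u i))) \<in> borel_measurable (Pi\<^sub>M {..<n} \<nu>)"
    if [measurable]: "G \<in> borel_measurable borel" for n and G :: "'a \<Rightarrow> ennreal"
  proof -
    have "(\<lambda>u. \<Sum>i<j. u i) \<in> borel_measurable (Pi\<^sub>M {..<n} \<nu>)" if "j \<le> n" for j
      using that by (intro borel_measurable_sum measurable_compose[OF measurable_component_singleton, of _ _ _ "\<lambda>x. x"]) auto
    then show ?thesis
      by (intro borel_measurable_times_ennreal borel_measurable_prod_ennreal
          measurable_compose[OF _ assms(1)] measurable_compose[OF _ that] borel_measurable_add borel_measurable_const) auto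
  qed
  have "(\<integral>\<^sup>+u. (\<Prod>j<Suc m. f (a + (\<Sum>i<Suc j. u i))) * F (a + (\<Sum>i<Suc m. u i)) \<partial>Pi\<^sub>M {..<Suc m} \<nu>)
    = (\<integral>\<^sup>+u. \<integral>\<^sup>+y. (\<Prod>j<m. f (a + (\<Sum>i<Suc j. u i))) * f (a + (\<Sum>i<m. u i) + y) * F (a + (\<Sum>i<m. u i) + y)
        \<partial>\<nu> m \<partial>Pi\<^sub>M {..<m} \<nu>)"
    unfolding lessThan_Suc using meas[OF Suc(2), of "Suc m"]
    by (subst product_nn_integral_insert) (auto simp: lessThan_Suc ac_simps)
  also have "\<dots> = (\<integral>\<^sup>+u. (\<Prod>j<m. f (a + (\<Sum>i<Suc j. u i)))
     * (\<integral>\<^sup>+w. heat (\<sigma> (Suc m) - \<sigma> m) (w - (a + (\<Sum>i<m. u i))) * f w * F w \<partial>lborel) \<partial>Pi\<^sub>M {..<m} \<nu>)"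
  proof (intro nn_integral_cong)
    fix u :: "nat \<Rightarrow> 'a"
    let ?z = "a + (\<Sum>i<m. u i)"
    have "(\<integral>\<^sup>+y. (\<Prod>j<m. f (a + (\<Sum>i<Suc j. u i))) * f (?z + y) * F (?z + y) \<partial>\<nu> m)
       = (\<Prod>j<m. f (a + (\<Sum>i<Suc j. u i))) * (\<integral>\<^sup>+y. heat (\<sigma> (Suc m) - \<sigma> m) y * f (?z + y) * F (?z + y) \<partial>lborel)"
      unfolding \<nu>_def by (simp add: nn_integral_density nn_integral_cmult[symmetric] mult_ac del: sum.lessThan_Suc)
    also have "(\<integral>\<^sup>+y. heat (\<sigma> (Suc m) - \<sigma> m) y * f (?z + y) * F (?z + y) \<partial>lborel)
       = (\<integral>\<^sup>+w. heat (\<sigma> (Suc m) - \<sigma> m) (w - ?z) * f w * F w \<partial>lborel)"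
      by (subst nn_integral_lborel_shift[of _ ?z, symmetric]) (auto simp: algebra_simps)
    finally show "(\<integral>\<^sup>+y. (\<Prod>j<m. f (a + (\<Sum>i<Suc j. u i))) * f (?z + y) * F (?z + y) \<partial>\<nu> m)
       = (\<Prod>j<m. f (a + (\<Sum>i<Suc j. u i))) * (\<integral>\<^sup>+w. heat (\<sigma> (Suc m) - \<sigma> m) (w - ?z) * f w * F w \<partial>lborel)" .
  qed
  also have "\<dots> = cylinder f \<sigma> a (Suc m) F"
    unfolding \<nu>_def cylinder.simps by (intro Suc.IH) measurable
  finally show ?case unfolding \<nu>_def .
qed

text \<open>For the bridge the law is a density in the positions themselves. Coordinate 0 is not
  integrated over, so the update \<open>z(0 := a)\<close> supplies the starting point.\<close>

lemma nn_integral_PiM_positions: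
  fixes f F :: "'a::euclidean_space \<Rightarrow> ennreal"
  assumes [measurable]: "f \<in> borel_measurable borel" and F: "F \<in> borel_measurable borel"
  shows "(\<integral>\<^sup>+z. (\<Prod>j<m. heat (\<sigma> (Suc j) - \<sigma> j) ((z(0 := a)) (Suc j) - (z(0 := a)) j) * f (z (Suc j))) * F ((z(0 := a)) m)
           \<partial>Pi\<^sub>M {1..m} (\<lambda>_. lborel)) = cylinder f \<sigma> a m F"
  using F
proof (induction m arbitrary: F)
  case 0
  then show ?case by (simp add: nn_integral_count_space_finite PiM_empty)
next
  case (Suc m)
  note [measurable] = Suc(2)
  interpret product_sigma_finite "\<lambda>_::nat. lborel :: 'a measure" ..
  have meas: "(\<lambda>z. (\<Prod>j<n. heat (\<sigma> (Suc j) - \<sigma> j) ((z(0 := a)) (Suc j) - (z(0 := a)) j) * f (z (Suc j))) * G ((z(0 := a)) n))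
       \<in> borel_measurable (Pi\<^sub>M {1..n} (\<lambda>_. lborel))"
    if [measurable]: "G \<in> borel_measurable borel" for n and G :: "'a \<Rightarrow> ennreal"
  proof -
    have "(\<lambda>z. (z(0 := a)) j) \<in> borel_measurable (Pi\<^sub>M {1..n} (\<lambda>_. lborel))" if "j \<le> n" for j
      using that by (cases j) (auto intro!: measurable_compose[OF measurable_component_singleton, of _ _ _ "\<lambda>x. x"])
    moreover from this have "(\<lambda>z. z (Suc j)) \<in> borel_measurable (Pi\<^sub>M {1..n} (\<lambda>_. lborel :: 'a measure))" if "j < n" for j
      using that by (auto intro!: measurable_compose[OF measurable_component_singleton, of _ _ _ "\<lambda>x. x"])
    ultimately show ?thesis
      by (intro borel_measurable_times_ennreal borel_measurable_prod_ennreal heat_measurable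
          measurable_compose[OF _ assms(1)] measurable_compose[OF _ that] borel_measurable_diff borel_measurable_const) auto
  qed
  have ins: "{1..Suc m} = insert (Suc m) {1..m}" by auto
  have "(\<integral>\<^sup>+z. (\<Prod>j<Suc m. heat (\<sigma> (Suc j) - \<sigma> j) ((z(0 := a)) (Suc j) - (z(0 := a)) j) * f (z (Suc j))) * F ((z(0 := a)) (Suc m))
         \<partial>Pi\<^sub>M {1..Suc m} (\<lambda>_. lborel))
     = (\<integral>\<^sup>+z. \<integral>\<^sup>+w. (\<Prod>j<m. heat (\<sigma> (Suc j) - \<sigma> j) ((z(0 := a)) (Suc j) - (z(0 := a)) j) * f (z (Suc j)))
        * (heat (\<sigma> (Suc m) - \<sigma> m) (w - (z(0 := a)) m) * f w * F w) \<partial>lborel \<partial>Pi\<^sub>M {1..m} (\<lambda>_. lborel))"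
  proof -
    have "(\<Prod>j<m. heat (\<sigma> (Suc j) - \<sigma> j) (((z(Suc m := w))(0 := a)) (Suc j) - ((z(Suc m := w))(0 := a)) j) * f ((z(Suc m := w)) (Suc j)))
        = (\<Prod>j<m. heat (\<sigma> (Suc j) - \<sigma> j) ((z(0 := a)) (Suc j) - (z(0 := a)) j) * f (z (Suc j)))"
      for z :: "nat \<Rightarrow> 'a" and w
      by (intro prod.cong) auto
    then show ?thesis
      unfolding ins
      by (subst product_nn_integral_insert[OF _ _ meas[OF Suc(2), of "Suc m", unfolded ins]])
        (auto simp: mult.assoc intro!: nn_integral_cong)
  qed
  also have "\<dots> = (\<integral>\<^sup>+z. (\<Prod>j<m. heat (\<sigma> (Suc j) - \<sigma> j) ((z(0 := a)) (Suc j) - (z(0 := a)) j) * f (z (Suc j)))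
        * (\<integral>\<^sup>+w. heat (\<sigma> (Suc m) - \<sigma> m) (w - (z(0 := a)) m) * f w * F w \<partial>lborel) \<partial>Pi\<^sub>M {1..m} (\<lambda>_. lborel))"
    by (intro nn_integral_cong nn_integral_cmult) measurable
  also have "\<dots> = cylinder f \<sigma> a (Suc m) F"
    unfolding cylinder.simps by (intro Suc.IH) measurable
  finally show ?case .
qed

text \<open>Rounding time down to multiples of 1 / (n + 1) leaves countably many times, where
  measurability of each \<open>X s\<close> suffices; continuity of the paths gives the pointwise
  limit.\<close>

lemma borel_measurable_continuous_process:
  fixes X :: "real \<Rightarrow> 'w \<Rightarrow> 'a::{metric_space, second_countable_topology}"
  assumes meas: "\<And>s. X s \<in> borel_measurable M"
    and cont: "\<And>\<omega>. \<omega> \<in> space M \<Longrightarrow> continuous_on UNIV (\<lambda>s. X s \<omega>)"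
  shows "(\<lambda>(s, \<omega>). X s \<omega>) \<in> borel_measurable (borel \<Otimes>\<^sub>M M)"
proof (rule borel_measurable_LIMSEQ_metric)
  fix n :: nat
  show "(\<lambda>p. X (real_of_int \<lfloor>fst p * real (Suc n)\<rfloor> / real (Suc n)) (snd p)) \<in> borel_measurable (borel \<Otimes>\<^sub>M M)"
    using meas by (intro measurable_compose_countable[where f="\<lambda>i p. X (real_of_int i / real (Suc n)) (snd p)"
          and g="\<lambda>p. \<lfloor>fst p * real (Suc n)\<rfloor>"]) auto
next
  fix p :: "real \<times> 'w" assume "p \<in> space (borel \<Otimes>\<^sub>M M)"
  then have p: "snd p \<in> space M" by (auto simp: space_pair_measure)
  have "(\<lambda>n. real_of_int \<lfloor>fst p * real (Suc n)\<rfloor> / real (Suc n)) \<longlonglongrightarrow> fst p"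
  proof (rule LIMSEQ_I)
    have "\<bar>real_of_int \<lfloor>fst p * real (Suc n)\<rfloor> / real (Suc n) - fst p\<bar> \<le> 1 / real (Suc n)" for n
    proof -
      have "\<bar>real_of_int \<lfloor>fst p * real (Suc n)\<rfloor> - fst p * real (Suc n)\<bar> \<le> 1" by linarith
      then have "\<bar>real_of_int \<lfloor>fst p * real (Suc n)\<rfloor> - fst p * real (Suc n)\<bar> / real (Suc n) \<le> 1 / real (Suc n)"
        by (intro divide_right_mono) auto
      moreover have "real_of_int \<lfloor>fst p * real (Suc n)\<rfloor> / real (Suc n) - fst p
          = (real_of_int \<lfloor>fst p * real (Suc n)\<rfloor> - fst p * real (Suc n)) / real (Suc n)"
        by (simp add: field_simps del: of_nat_Suc)
      ultimately show ?thesis by (simp add: abs_divide del: of_nat_Suc)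
    qed
    note bound = this
    fix r :: real assume "0 < r"
    then obtain n0 where n0: "1 / real (Suc n0) < r" by (metis nat_approx_posE)
    have "norm (real_of_int \<lfloor>fst p * real (Suc n)\<rfloor> / real (Suc n) - fst p) < r" if "n0 \<le> n" for n
    proof -
      have "1 / real (Suc n) \<le> 1 / real (Suc n0)" using that by (intro divide_left_mono) auto
      then show ?thesis using bound[of n] n0 by (simp only: real_norm_def)
    qed
    then show "\<exists>no. \<forall>n\<ge>no. norm (real_of_int \<lfloor>fst p * real (Suc n)\<rfloor> / real (Suc n) - fst p) < r"
      by blast
  qed
  from continuous_on_tendsto_compose[OF cont[OF p] this]
  show "(\<lambda>n. X (real_of_int \<lfloor>fst p * real (Suc n)\<rfloor> / real (Suc n)) (snd p)) \<longlonglongrightarrow> (case p of (s, \<omega>) \<Rightarrow> X s \<omega>)"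
    by (simp add: split_beta)
qed

text \<open>Clamping the time extends the paths continuously to the whole line, about which the
  definition of Brownian motion is silent for negative times.\<close>

lemma brownian_motion_measurable_pair:
  assumes "brownian_motion M z W"
  shows "(\<lambda>(s, \<omega>). W (max 0 s) \<omega>) \<in> borel_measurable (borel \<Otimes>\<^sub>M M)"
proof (rule borel_measurable_continuous_process)
  show "continuous_on UNIV (\<lambda>s. W (max 0 s) \<omega>)" if "\<omega> \<in> space M" for \<omega>
  proof -
    have "continuous_on {0..} (\<lambda>s. W s \<omega>)"
      using assms that unfolding brownian_motion_def by blast
    then show ?thesis
      by (rule continuous_on_compose2) (use assms in \<open>auto intro!: continuous_intros\<close>)
  qed
  have "\<forall>s\<ge>0. W s \<in> borel_measurable M"
    using assms unfolding brownian_motion_def by blast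
  then show "W (max 0 s) \<in> borel_measurable M" for s by simp
qed

lemma brownian_bridge_measurable_pair:
  assumes "brownian_bridge M t a b X" "0 \<le> t"
  shows "(\<lambda>(s, \<omega>). X (max 0 (min t s)) \<omega>) \<in> borel_measurable (borel \<Otimes>\<^sub>M M)"
proof (rule borel_measurable_continuous_process)
  show "continuous_on UNIV (\<lambda>s. X (max 0 (min t s)) \<omega>)" if "\<omega> \<in> space M" for \<omega>
  proof -
    have "continuous_on {0..t} (\<lambda>s. X s \<omega>)"
      using assms that unfolding brownian_bridge_def by blast
    then show ?thesis
      by (rule continuous_on_compose2) (use assms in \<open>auto intro!: continuous_intros\<close>)
  qed
  have "\<forall>s\<in>{0..t}. X s \<in> borel_measurable M"
    using assms unfolding brownian_bridge_def by blast
  then show "X (max 0 (min t s)) \<in> borel_measurable M" for s using assms(2) by simp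
qed

section \<open>Occupation moments of Brownian motion and of the bridge\<close>

lemma chain_nonneg:
  fixes \<sigma> :: "nat \<Rightarrow> real"
  assumes "\<sigma> 0 = 0" "\<And>j. j < m \<Longrightarrow> \<sigma> j < \<sigma> (Suc j)" "j \<le> m"
  shows "0 \<le> \<sigma> j"
  using assms(3) by (induction j) (use assms in \<open>auto simp: less_imp_le Suc_le_eq intro: order_trans\<close>)

lemma brownian_motion_cylinder:
  fixes f :: "'a::euclidean_space \<Rightarrow> ennreal"
  assumes W: "brownian_motion M a W" and f [measurable]: "f \<in> borel_measurable borel"
    and \<sigma>: "\<sigma> 0 = 0" "\<And>j. j < m \<Longrightarrow> \<sigma> j < \<sigma> (Suc j)"
  shows "(\<integral>\<^sup>+\<omega>. (\<Prod>j<m. f (W (\<sigma> (Suc j)) \<omega>)) \<partial>M) = cylinder f \<sigma> a m (\<lambda>_. 1)"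
\<comment> \<open>Independence becomes a product law for a nonempty family of increments; with no
  visits both sides are 1.\<close>
proof (cases "m = 0")
  case True
  interpret prob_space M using W by (simp add: brownian_motion_def)
  show ?thesis using True by (simp add: emeasure_space_1)
next
  case False
  interpret prob_space M using W by (simp add: brownian_motion_def)
  let ?\<Delta> = "\<lambda>i \<omega>. W (\<sigma> (Suc i)) \<omega> - W (\<sigma> i) \<omega>"
  have \<sigma>_pos: "0 \<le> \<sigma> j" if "j \<le> m" for j
    using chain_nonneg[OF \<sigma> that] .
  have meas: "?\<Delta> i \<in> borel_measurable M" if "i \<in> {..<m}" for i
    using W that \<sigma>_pos[of i] \<sigma>_pos[of "Suc i"]
    by (intro borel_measurable_diff) (auto simp: brownian_motion_def)
  have "0 \<le> \<sigma> 0 \<and> (\<forall>i<m. \<sigma> i < \<sigma> (Suc i))" using \<sigma> by simp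
  then have "indep_vars (\<lambda>_. borel) ?\<Delta> {..<m}"
    using W unfolding brownian_motion_def by blast
  then have "distr M (Pi\<^sub>M {..<m} (\<lambda>_. borel)) (\<lambda>\<omega>. \<lambda>i\<in>{..<m}. ?\<Delta> i \<omega>) = Pi\<^sub>M {..<m} (\<lambda>i. distr M borel (?\<Delta> i))"
    using False meas by (subst (asm) indep_vars_iff_distr_eq_PiM') auto
  also have "\<dots> = Pi\<^sub>M {..<m} (\<lambda>i. density lborel (heat (\<sigma> (Suc i) - \<sigma> i)))"
  proof (intro PiM_cong refl)
    fix i assume i: "i \<in> {..<m}"
    then have "0 \<le> \<sigma> i \<and> \<sigma> i < \<sigma> (Suc i)" using \<sigma> \<sigma>_pos[of i] by simp
    then have "distributed M lborel (?\<Delta> i) (\<lambda>u. ennreal (heat_kernel (\<sigma> (Suc i) - \<sigma> i) u))"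
      using W unfolding brownian_motion_def by blast
    then have "distr M lborel (?\<Delta> i) = density lborel (\<lambda>u. ennreal (heat_kernel (\<sigma> (Suc i) - \<sigma> i) u))"
      by (simp add: distributed_def)
    also have "(\<lambda>u::'a. ennreal (heat_kernel (\<sigma> (Suc i) - \<sigma> i) u)) = heat (\<sigma> (Suc i) - \<sigma> i)"
      using \<sigma>(2)[of i] i by (auto simp: heat_def)
    also have "distr M lborel (?\<Delta> i) = distr M borel (?\<Delta> i)"
      by (intro distr_cong) auto
    finally show "distr M borel (?\<Delta> i) = density lborel (heat (\<sigma> (Suc i) - \<sigma> i))" .
  qed
  finally have D: "distr M (Pi\<^sub>M {..<m} (\<lambda>_. borel)) (\<lambda>\<omega>. \<lambda>i\<in>{..<m}. ?\<Delta> i \<omega>)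
      = Pi\<^sub>M {..<m} (\<lambda>i. density lborel (heat (\<sigma> (Suc i) - \<sigma> i)))" .
  have W_eq: "W (\<sigma> (Suc j)) \<omega> = a + (\<Sum>i<Suc j. (\<lambda>i\<in>{..<m}. ?\<Delta> i \<omega>) i)" if "j < m" "\<omega> \<in> space M" for j \<omega>
  proof -
    have "(\<Sum>i<Suc j. (\<lambda>i\<in>{..<m}. ?\<Delta> i \<omega>) i) = (\<Sum>i<Suc j. ?\<Delta> i \<omega>)"
      using that by (intro sum.cong) auto
    also have "\<dots> = W (\<sigma> (Suc j)) \<omega> - W (\<sigma> 0) \<omega>"
      by (rule sum_lessThan_telescope)
    also have "W (\<sigma> 0) \<omega> = a" using W that \<sigma> by (simp add: brownian_motion_def)
    finally show ?thesis by simp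
  qed
  have "(\<integral>\<^sup>+\<omega>. (\<Prod>j<m. f (W (\<sigma> (Suc j)) \<omega>)) \<partial>M)
      = (\<integral>\<^sup>+\<omega>. (\<Prod>j<m. f (a + (\<Sum>i<Suc j. (\<lambda>i\<in>{..<m}. ?\<Delta> i \<omega>) i))) \<partial>M)"
    by (intro nn_integral_cong prod.cong refl arg_cong[where f=f] W_eq) auto
  also have "\<dots> = (\<integral>\<^sup>+u. (\<Prod>j<m. f (a + (\<Sum>i<Suc j. u i)))
      \<partial>distr M (Pi\<^sub>M {..<m} (\<lambda>_. borel)) (\<lambda>\<omega>. \<lambda>i\<in>{..<m}. ?\<Delta> i \<omega>))"
  proof (rule nn_integral_distr[symmetric])
    show "(\<lambda>\<omega>. \<lambda>i\<in>{..<m}. ?\<Delta> i \<omega>) \<in> measurable M (Pi\<^sub>M {..<m} (\<lambda>_. borel))"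
      using meas by (intro measurable_restrict)
    have "(\<lambda>u. \<Sum>i<j. u i) \<in> borel_measurable (Pi\<^sub>M {..<m} (\<lambda>_. borel :: 'a measure))" if "j \<le> m" for j
      using that by (intro borel_measurable_sum measurable_component_singleton) auto
    then have "(\<lambda>u. \<Prod>j<m. f (a + (\<Sum>i<Suc j. u i))) \<in> borel_measurable (Pi\<^sub>M {..<m} (\<lambda>_. borel))"
      by (intro borel_measurable_prod_ennreal measurable_compose[OF _ f] borel_measurable_add borel_measurable_const) auto
    then show "(\<lambda>u. \<Prod>j<m. f (a + (\<Sum>i<Suc j. u i)))
        \<in> borel_measurable (distr M (Pi\<^sub>M {..<m} (\<lambda>_. borel)) (\<lambda>\<omega>. \<lambda>i\<in>{..<m}. ?\<Delta> i \<omega>))"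
      by (simp only: measurable_distr_eq1)
  qed
  also have "\<dots> = cylinder f \<sigma> a m (\<lambda>_. 1)"
    unfolding D using nn_integral_PiM_increments[OF f, where F="\<lambda>_. 1" and m=m and a=a and \<sigma>=\<sigma>] by simp
  finally show ?thesis .
qed

lemma nn_integral_set_borel_pos:
  "(\<integral>\<^sup>+s\<in>{0..}. g s \<partial>lborel) = (\<integral>\<^sup>+s. (if 0 < s then g s else 0) \<partial>(lborel :: real measure))"
  by (intro nn_integral_cong_AE, rule AE_mp[OF AE_lborel_singleton[of 0]]) (auto simp: indicator_def)

text \<open>The factor k! counts the orders of the k times. By homogeneity in time the remaining
  contribution does not depend on the current time, so \<open>D\<close> ignores that
  argument.\<close>

theorem brownian_motion_moment:
  fixes f :: "'a::euclidean_space \<Rightarrow> ennreal"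
  assumes W: "brownian_motion M a W" and f [measurable]: "f \<in> borel_measurable borel"
  shows "(\<integral>\<^sup>+\<omega>. (\<integral>\<^sup>+s\<in>{0..}. f (W s \<omega>) \<partial>lborel) ^ k \<partial>M) = fact k * green f k a"
proof -
  interpret prob_space M using W by (simp add: brownian_motion_def)
  note [measurable (raw)] = measurable_compose[OF measurable_Pair brownian_motion_measurable_pair[OF W], simplified]
  have "(\<integral>\<^sup>+\<omega>. (\<integral>\<^sup>+s. (if 0 < s then f (W (max 0 s) \<omega>) else 0) \<partial>lborel) ^ k \<partial>M) = fact k * green f k a"
  proof (rule nn_integral_power_additive_functional[where D="\<lambda>k _ z. green f k z" and f=f])
    show "sigma_finite_measure M" by unfold_locales
    show "green f (Suc k) z = (\<integral>\<^sup>+u. \<integral>\<^sup>+w. heat (u - s) (w - z) * f w * green f k w \<partial>lborel \<partial>lborel)" for k s z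
      using nn_integral_lborel_shift[of "\<lambda>u. \<integral>\<^sup>+w. heat u (w - z) * f w * green f k w \<partial>lborel" s]
      by simp
    fix m \<sigma> assume \<sigma>: "\<sigma> 0 = (0::real)" "\<And>j. j < m \<Longrightarrow> \<sigma> j < \<sigma> (Suc j)"
    have "0 \<le> \<sigma> j" if "j \<le> m" for j
      using chain_nonneg[OF \<sigma> that] .
    then have "max 0 (\<sigma> (Suc j)) = \<sigma> (Suc j)" if "j < m" for j
      using that by (auto simp: Suc_le_eq)
    then show "(\<integral>\<^sup>+\<omega>. (\<Prod>j<m. f (W (max 0 (\<sigma> (Suc j))) \<omega>)) \<partial>M) = cylinder f \<sigma> a m (\<lambda>z. green f 0 z)"
      using brownian_motion_cylinder[where \<sigma>=\<sigma> and m=m, OF W f \<sigma>] by (simp cong: prod.cong_simp)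
  qed measurable
  moreover have "(\<integral>\<^sup>+s. (if 0 < s then f (W (max 0 s) \<omega>) else 0) \<partial>lborel) = (\<integral>\<^sup>+s\<in>{0..}. f (W s \<omega>) \<partial>lborel)" for \<omega>
    unfolding nn_integral_set_borel_pos by (intro nn_integral_cong) auto
  ultimately show ?thesis by simp
qed

lemma brownian_bridge_cylinder:
  fixes f :: "'a::euclidean_space \<Rightarrow> ennreal"
  assumes X: "brownian_bridge M t a b X" and t: "0 < t" and f [measurable]: "f \<in> borel_measurable borel"
    and \<sigma>: "\<sigma> 0 = 0" "\<And>j. j < m \<Longrightarrow> \<sigma> j < \<sigma> (Suc j)" and m: "\<sigma> m < t" "0 < m"
  shows "(\<integral>\<^sup>+\<omega>. (\<Prod>j<m. f (X (\<sigma> (Suc j)) \<omega>)) \<partial>M) = cylinder f \<sigma> a m (\<lambda>z. heat (t - \<sigma> m) (b - z) / heat t (b - a))"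
proof -
  \<comment> \<open>Appending the terminal time brings the chain into the form required for the
    bridge density; the last kernel of that density becomes the weight at the final
    position.\<close>
  let ?\<tau> = "\<sigma>(Suc m := t)"
  let ?\<rho> = "\<lambda>z. let \<zeta> = z(0 := a, Suc m := b) in
             ennreal ((\<Prod>j=0..m. heat_kernel (?\<tau> (Suc j) - ?\<tau> j) (\<zeta> (Suc j) - \<zeta> j)) / heat_kernel t (b - a))"
  have "distributed M (Pi\<^sub>M {1..m} (\<lambda>_. lborel)) (\<lambda>\<omega>. \<lambda>j\<in>{1..m}. X (?\<tau> j) \<omega>) ?\<rho>"
  proof -
    have "1 \<le> m \<and> ?\<tau> 0 = 0 \<and> ?\<tau> (Suc m) = t \<and> (\<forall>j\<le>m. ?\<tau> j < ?\<tau> (Suc j))"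
      using \<sigma> m by (auto simp: le_less)
    then show ?thesis
      using X unfolding brownian_bridge_def by blast
  qed
  from distributed_nn_integral[OF this, of "\<lambda>z. \<Prod>j<m. f (z (Suc j))"]
  have "(\<integral>\<^sup>+\<omega>. (\<Prod>j<m. f ((\<lambda>j\<in>{1..m}. X (?\<tau> j) \<omega>) (Suc j))) \<partial>M)
     = (\<integral>\<^sup>+z. ?\<rho> z * (\<Prod>j<m. f (z (Suc j))) \<partial>Pi\<^sub>M {1..m} (\<lambda>_. lborel))"
    by (auto intro!: borel_measurable_prod_ennreal measurable_compose[OF _ f]
        measurable_compose[OF measurable_component_singleton, of _ _ _ "\<lambda>x. x"])
  also have "(\<integral>\<^sup>+\<omega>. (\<Prod>j<m. f ((\<lambda>j\<in>{1..m}. X (?\<tau> j) \<omega>) (Suc j))) \<partial>M) = (\<integral>\<^sup>+\<omega>. (\<Prod>j<m. f (X (\<sigma> (Suc j)) \<omega>)) \<partial>M)"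
    by (intro nn_integral_cong prod.cong) auto
  also have "(\<integral>\<^sup>+z. ?\<rho> z * (\<Prod>j<m. f (z (Suc j))) \<partial>Pi\<^sub>M {1..m} (\<lambda>_. lborel))
     = (\<integral>\<^sup>+z. (\<Prod>j<m. heat (\<sigma> (Suc j) - \<sigma> j) ((z(0 := a)) (Suc j) - (z(0 := a)) j) * f (z (Suc j)))
        * (heat (t - \<sigma> m) (b - (z(0 := a)) m) / heat t (b - a)) \<partial>Pi\<^sub>M {1..m} (\<lambda>_. lborel))"
  proof (intro nn_integral_cong)
    fix z :: "nat \<Rightarrow> 'a"
    let ?\<zeta> = "z(0 := a, Suc m := b)"
    have "(\<Prod>j=0..m. heat_kernel (?\<tau> (Suc j) - ?\<tau> j) (?\<zeta> (Suc j) - ?\<zeta> j))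
        = (\<Prod>j<m. heat_kernel (\<sigma> (Suc j) - \<sigma> j) ((z(0 := a)) (Suc j) - (z(0 := a)) j)) * heat_kernel (t - \<sigma> m) (b - (z(0 := a)) m)"
    proof -
      have "{0..m} = insert m {..<m}" by auto
      moreover have "(\<Prod>j<m. heat_kernel (?\<tau> (Suc j) - ?\<tau> j) (?\<zeta> (Suc j) - ?\<zeta> j))
          = (\<Prod>j<m. heat_kernel (\<sigma> (Suc j) - \<sigma> j) ((z(0 := a)) (Suc j) - (z(0 := a)) j))"
        by (intro prod.cong) auto
      ultimately show ?thesis using m by (simp add: mult.commute)
    qed
    moreover have "(\<Prod>j<m. heat (\<sigma> (Suc j) - \<sigma> j) ((z(0 := a)) (Suc j) - (z(0 := a)) j))
        = ennreal (\<Prod>j<m. heat_kernel (\<sigma> (Suc j) - \<sigma> j) ((z(0 := a)) (Suc j) - (z(0 := a)) j))"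
      by (subst prod_ennreal[symmetric]) (use \<sigma>(2) in \<open>auto simp: heat_eq heat_kernel_pos less_imp_le intro!: prod.cong\<close>)
    moreover have "ennreal (p * heat_kernel (t - \<sigma> m) u / heat_kernel t (b - a))
        = ennreal p * (heat (t - \<sigma> m) u / heat t (b - a))" for u and p :: real
      using t m by (simp add: heat_eq divide_ennreal heat_kernel_pos less_imp_le ennreal_mult''[symmetric] flip: times_divide_eq_right)
    ultimately have "?\<rho> z = (\<Prod>j<m. heat (\<sigma> (Suc j) - \<sigma> j) ((z(0 := a)) (Suc j) - (z(0 := a)) j))
        * (heat (t - \<sigma> m) (b - (z(0 := a)) m) / heat t (b - a))"
      unfolding Let_def by (simp only:)
    then show "?\<rho> z * (\<Prod>j<m. f (z (Suc j)))
       = (\<Prod>j<m. heat (\<sigma> (Suc j) - \<sigma> j) ((z(0 := a)) (Suc j) - (z(0 := a)) j) * f (z (Suc j)))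
        * (heat (t - \<sigma> m) (b - (z(0 := a)) m) / heat t (b - a))"
      by (simp only: prod.distrib mult_ac)
  qed
  also have "\<dots> = cylinder f \<sigma> a m (\<lambda>z. heat (t - \<sigma> m) (b - z) / heat t (b - a))"
    by (rule nn_integral_PiM_positions) measurable
  finally show ?thesis .
qed

theorem brownian_bridge_moment:
  fixes f :: "'a::euclidean_space \<Rightarrow> ennreal"
  assumes X: "brownian_bridge M t a b X" and t: "0 < t" and f [measurable]: "f \<in> borel_measurable borel"
  shows "(\<integral>\<^sup>+\<omega>. (\<integral>\<^sup>+s\<in>{0..t}. f (X s \<omega>) \<partial>lborel) ^ k \<partial>M) = fact k * (pinned f k t a b / heat t (b - a))"
proof -
  interpret prob_space M using X by (simp add: brownian_bridge_def)
  note [measurable (raw)] = measurable_compose[OF measurable_Pair brownian_bridge_measurable_pair[OF X less_imp_le[OF t]], simplified]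
  \<comment> \<open>The chain lemma quantifies over all later times, so the integrand is switched
    off from t on. Leaving out the time t itself changes only a null set.\<close>
  let ?\<phi> = "\<lambda>s \<omega>. if s < t then f (X (max 0 (min t s)) \<omega>) else 0"
  let ?D = "\<lambda>k s z. pinned f k (t - s) z b / heat t (b - a)"
  have "(\<integral>\<^sup>+\<omega>. (\<integral>\<^sup>+s. (if 0 < s then ?\<phi> s \<omega> else 0) \<partial>lborel) ^ k \<partial>M) = fact k * ?D k 0 a"
  proof (rule nn_integral_power_additive_functional[where D="?D" and f=f])
    show "sigma_finite_measure M" by unfold_locales
    show "?D (Suc k) s z = (\<integral>\<^sup>+u. \<integral>\<^sup>+w. heat (u - s) (w - z) * f w * ?D k u w \<partial>lborel \<partial>lborel)" for k s z
      unfolding pinned.simps divide_ennreal_def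
      by (subst (1) nn_integral_lborel_shift[of _ s, symmetric]) (auto simp: nn_integral_multc mult.assoc[symmetric])
    fix m \<sigma> assume \<sigma>: "\<sigma> 0 = (0::real)" "\<And>j. j < m \<Longrightarrow> \<sigma> j < \<sigma> (Suc j)"
    have pos: "0 \<le> \<sigma> j" if "j \<le> m" for j
      using chain_nonneg[OF \<sigma> that] .
    consider "m = 0" | "0 < m" "\<sigma> m < t" | "0 < m" "t \<le> \<sigma> m" by linarith
    then show "(\<integral>\<^sup>+\<omega>. (\<Prod>j<m. ?\<phi> (\<sigma> (Suc j)) \<omega>) \<partial>M) = cylinder f \<sigma> a m (?D 0 (\<sigma> m))"
    proof cases
      case 1
      then show ?thesis using \<sigma> t heat_neq_0[OF t, of "b - a"] by (simp add: emeasure_space_1)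
    next
      case 2
      have "\<sigma> j \<le> \<sigma> m" if "j \<le> m" for j
        using that by (induction rule: inc_induct) (use \<sigma> in \<open>auto intro: order_trans[OF less_imp_le]\<close>)
      then have "\<sigma> (Suc j) < t" if "j < m" for j
        using that 2 by (meson Suc_leI order_le_less_trans)
      then have "?\<phi> (\<sigma> (Suc j)) \<omega> = f (X (\<sigma> (Suc j)) \<omega>)" if "j < m" for j \<omega>
        using that pos[of "Suc j"] by simp
      then show ?thesis
        using brownian_bridge_cylinder[where \<sigma>=\<sigma> and m=m, OF X t f \<sigma> 2(2,1)] by (simp cong: prod.cong_simp)
    next
      \<comment> \<open>Past the terminal time the last factor on the path side is 0, and so is the
        kernel of the nonpositive remaining duration.\<close>
      case 3
      then obtain n where "m = Suc n" by (cases m) auto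
      then have 0: "(\<Prod>j<m. ?\<phi> (\<sigma> (Suc j)) \<omega>) = 0" for \<omega>
        using 3 by simp
      show ?thesis unfolding 0 using 3 by (simp add: cylinder_zero)
    qed
  qed measurable
  moreover have "(\<integral>\<^sup>+s. (if 0 < s then ?\<phi> s \<omega> else 0) \<partial>lborel) = (\<integral>\<^sup>+s\<in>{0..t}. f (X s \<omega>) \<partial>lborel)" for \<omega>
  proof (rule nn_integral_cong_AE)
    show "AE s in lborel. (if 0 < s then ?\<phi> s \<omega> else 0) = f (X s \<omega>) * indicator {0..t} s"
      using AE_lborel_singleton[of 0] AE_lborel_singleton[of t]
      by eventually_elim (auto simp: indicator_def)
  qed
  ultimately show ?thesis by simp
qed

subsection \<open>Exponential moments as limits of power moments\<close>

text \<open>The n-th finite difference, with step b, of a polynomial of degree k < n vanishes.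
  Pascal's rule turns the sum for n + 1 into a difference of two sums for n.\<close>

lemma alternating_binomial_power_sum:
  fixes a b :: real
  shows "k < n \<Longrightarrow> (\<Sum>j\<le>n. (-1) ^ j * real (n choose j) * (a + real j * b) ^ k) = 0"
proof (induction n arbitrary: k a)
  case (Suc n)
  define S where "S a k = (\<Sum>j\<le>n. (-1) ^ j * real (n choose j) * (a + real j * b) ^ k)" for a k
  have "(\<Sum>j\<le>Suc n. (-1) ^ j * real (Suc n choose j) * (a + real j * b) ^ k)
      = a ^ k + (\<Sum>j\<le>n. (-1) ^ Suc j * real (Suc n choose Suc j) * (a + real (Suc j) * b) ^ k)"
    by (subst sum.atMost_Suc_shift) simp
  also have "(\<Sum>j\<le>n. (-1) ^ Suc j * real (Suc n choose Suc j) * (a + real (Suc j) * b) ^ k)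
     = (\<Sum>j\<le>n. (-1) ^ Suc j * real (n choose Suc j) * (a + real (Suc j) * b) ^ k) - S (a + b) k"
  proof -
    have e: "a + real (Suc j) * b = a + b + real j * b" for j by (simp add: algebra_simps)
    show ?thesis
      unfolding S_def sum_subtractf[symmetric] e
      by (intro sum.cong refl) (simp add: distrib_left distrib_right left_diff_distrib)
  qed
  also have "a ^ k + ((\<Sum>j\<le>n. (-1) ^ Suc j * real (n choose Suc j) * (a + real (Suc j) * b) ^ k) - S (a + b) k)
     = (\<Sum>j\<le>Suc n. (-1) ^ j * real (n choose j) * (a + real j * b) ^ k) - S (a + b) k"
    by (subst sum.atMost_Suc_shift) simp
  also have "\<dots> = S a k - S (a + b) k"
    by (simp add: S_def binomial_eq_0)
  also have "\<dots> = 0"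
  proof (cases "k < n")
    case True
    then show ?thesis using Suc.IH by (simp add: S_def)
  next
    case False
    \<comment> \<open>In this borderline case the difference of the two n-th powers has lower degree
      in the node, so the induction hypothesis applies to each of its terms.\<close>
    then have k: "k = n" using Suc.prems by simp
    have "S (a + b) n - S a n = (\<Sum>j\<le>n. (-1) ^ j * real (n choose j) * ((a + real j * b + b) ^ n - (a + real j * b) ^ n))"
      unfolding S_def by (simp add: sum_subtractf[symmetric] algebra_simps)
    also have "\<dots> = (\<Sum>j\<le>n. (-1) ^ j * real (n choose j) * (\<Sum>i<n. real (n choose i) * (a + real j * b) ^ i * b ^ (n - i)))"
    proof (intro sum.cong refl arg_cong2[where f=times])
      fix j
      have "(a + real j * b + b) ^ n = (\<Sum>i\<le>n. real (n choose i) * (a + real j * b) ^ i * b ^ (n - i))"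
        by (rule binomial_ring)
      then show "(a + real j * b + b) ^ n - (a + real j * b) ^ n
          = (\<Sum>i<n. real (n choose i) * (a + real j * b) ^ i * b ^ (n - i))"
        by (simp add: lessThan_Suc_atMost[symmetric])
    qed
    also have "\<dots> = (\<Sum>i<n. real (n choose i) * b ^ (n - i) * (\<Sum>j\<le>n. (-1) ^ j * real (n choose j) * (a + real j * b) ^ i))"
      by (simp only: sum_distrib_left, subst sum.swap) (simp only: mult_ac)
    also have "\<dots> = 0" using Suc.IH by simp
    finally show ?thesis using k by simp
  qed
  finally show ?case .
qed simp

text \<open>A vanishing finite difference with nodes a - b + j b, solved for the node j = 0. The
  other nodes are a + j b with j \<ge> 0, nonnegative whenever a and b are.\<close>

lemma power_diff_as_combination:
  fixes a b :: real
  shows "(a - b) ^ k = (\<Sum>j\<le>k. (-1) ^ j * real (Suc k choose Suc j) * (a + real j * b) ^ k)"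
proof -
  have "0 = (\<Sum>j\<le>Suc k. (-1) ^ j * real (Suc k choose j) * (a - b + real j * b) ^ k)"
    by (rule alternating_binomial_power_sum[symmetric]) simp
  also have "\<dots> = (a - b) ^ k + (\<Sum>j\<le>k. (-1) ^ Suc j * real (Suc k choose Suc j) * (a - b + real (Suc j) * b) ^ k)"
    by (subst sum.atMost_Suc_shift) simp
  also have "(\<Sum>j\<le>k. (-1) ^ Suc j * real (Suc k choose Suc j) * (a - b + real (Suc j) * b) ^ k)
      = - (\<Sum>j\<le>k. (-1) ^ j * real (Suc k choose Suc j) * (a + real j * b) ^ k)"
    by (simp add: sum_negf[symmetric] algebra_simps del: binomial_Suc_Suc)
  finally show ?thesis by simp
qed

lemma power_le_fact_exp:
  fixes x :: real
  assumes "0 \<le> x"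
  shows "x ^ k \<le> fact k * exp x"
proof -
  have "(\<lambda>n. x ^ n /\<^sub>R fact n) sums exp x" by (rule exp_converges)
  then have "(\<Sum>n\<in>{k}. x ^ n /\<^sub>R fact n) \<le> exp x"
    using assms by (metis (no_types, lifting) sum_le_suminf sums_iff finite.emptyI finite_insert
        inverse_nonnegative_iff_nonnegative fact_ge_zero scaleR_nonneg_nonneg zero_le_power)
  then show ?thesis by (simp add: field_simps)
qed

text \<open>An exponent b between |\<alpha>| and \<beta> divides the work: e^(b |z|) pays for z^k
  and leaves the geometric ratio |\<alpha>| / b, while the surplus \<beta> - b pays for the fixed
  power z^j.\<close>

lemma exp_series_term_bound:
  assumes "\<bar>\<alpha>\<bar> < \<beta>"
  shows "\<exists>\<theta> L. 0 \<le> \<theta> \<and> \<theta> < 1 \<and> 0 \<le> L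
      \<and> (\<forall>k (z::real). \<bar>\<alpha> ^ k / fact k * z ^ (j + k)\<bar> \<le> \<theta> ^ k * (L * exp (\<beta> * \<bar>z\<bar>)))"
proof -
  define b where "b = (\<bar>\<alpha>\<bar> + \<beta>) / 2"
  have b: "\<bar>\<alpha>\<bar> < b" "b < \<beta>" "0 < b" using assms by (auto simp: b_def)
  have "\<bar>\<alpha> ^ k / fact k * z ^ (j + k)\<bar> \<le> (\<bar>\<alpha>\<bar> / b) ^ k * (fact j / (\<beta> - b) ^ j * exp (\<beta> * \<bar>z\<bar>))" for k z
  proof -
    have "((\<beta> - b) * \<bar>z\<bar>) ^ j * (b * \<bar>z\<bar>) ^ k \<le> (fact j * exp ((\<beta> - b) * \<bar>z\<bar>)) * (fact k * exp (b * \<bar>z\<bar>))"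
      using b by (intro mult_mono power_le_fact_exp) auto
    also have "\<dots> = fact j * fact k * exp (\<beta> * \<bar>z\<bar>)"
      by (simp add: algebra_simps flip: exp_add)
    finally have "(\<beta> - b) ^ j * b ^ k * \<bar>z\<bar> ^ (j + k) \<le> fact j * fact k * exp (\<beta> * \<bar>z\<bar>)"
      by (simp add: power_mult_distrib power_add mult_ac)
    then have *: "\<bar>z\<bar> ^ (j + k) / fact k \<le> fact j / (\<beta> - b) ^ j * exp (\<beta> * \<bar>z\<bar>) / b ^ k"
      using b by (simp add: field_simps)
    have "\<bar>\<alpha> ^ k / fact k * z ^ (j + k)\<bar> = \<bar>\<alpha>\<bar> ^ k * (\<bar>z\<bar> ^ (j + k) / fact k)"
      by (simp add: abs_mult power_abs)
    also have "\<dots> \<le> \<bar>\<alpha>\<bar> ^ k * (fact j / (\<beta> - b) ^ j * exp (\<beta> * \<bar>z\<bar>) / b ^ k)"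
      by (intro mult_left_mono *) auto
    finally show ?thesis by (simp add: power_divide mult_ac)
  qed
  then show ?thesis
    using b by (intro exI[of _ "\<bar>\<alpha>\<bar> / b"] exI[of _ "fact j / (\<beta> - b) ^ j"]) auto
qed

lemma integrable_exp_abs:
  assumes [measurable]: "Z \<in> borel_measurable M"
    and K: "(\<integral>\<^sup>+\<omega>. ennreal (exp (\<beta> * \<bar>Z \<omega>\<bar>)) \<partial>M) \<le> ennreal K"
  shows "integrable M (\<lambda>\<omega>. exp (\<beta> * \<bar>Z \<omega>\<bar>) :: real)"
  using order_le_less_trans[OF K] by (intro integrableI_nonneg) auto

lemma weighted_exp_expectation:
  assumes Z [measurable]: "Z \<in> borel_measurable M" and G [measurable]: "G \<in> borel_measurable M"
    and G01: "\<And>\<omega>. 0 \<le> G \<omega>" "\<And>\<omega>. G \<omega> \<le> 1"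
    and K: "(\<integral>\<^sup>+\<omega>. ennreal (exp (\<beta> * \<bar>Z \<omega>\<bar>)) \<partial>M) \<le> ennreal K" "0 \<le> K"
    and \<theta>: "0 \<le> \<theta>" "\<theta> < 1" "0 \<le> L"
      "\<And>k (z::real). \<bar>\<alpha> ^ k / fact k * z ^ (j + k)\<bar> \<le> \<theta> ^ k * (L * exp (\<beta> * \<bar>z\<bar>))"
  shows "(\<Sum>k. \<alpha> ^ k / fact k * (\<integral>\<omega>. G \<omega> * Z \<omega> ^ (j + k) \<partial>M)) = (\<integral>\<omega>. G \<omega> * Z \<omega> ^ j * exp (\<alpha> * Z \<omega>) \<partial>M)" (is ?A)
    and "\<bar>\<alpha> ^ k / fact k * (\<integral>\<omega>. G \<omega> * Z \<omega> ^ (j + k) \<partial>M)\<bar> \<le> \<theta> ^ k * (L * K)"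
proof -
  note int = integrable_exp_abs[OF Z K(1)]
  have bnd: "norm (\<alpha> ^ k / fact k * (G \<omega> * Z \<omega> ^ (j + k))) \<le> \<theta> ^ k * (L * exp (\<beta> * \<bar>Z \<omega>\<bar>))" for k \<omega>
  proof -
    have "norm (\<alpha> ^ k / fact k * (G \<omega> * Z \<omega> ^ (j + k))) = G \<omega> * \<bar>\<alpha> ^ k / fact k * Z \<omega> ^ (j + k)\<bar>"
      using G01 by (simp add: abs_mult)
    also have "\<dots> \<le> 1 * (\<theta> ^ k * (L * exp (\<beta> * \<bar>Z \<omega>\<bar>)))"
      by (intro mult_mono G01 \<theta>(4)) auto
    finally show ?thesis by simp
  qed
  have intk: "integrable M (\<lambda>\<omega>. \<alpha> ^ k / fact k * (G \<omega> * Z \<omega> ^ (j + k)))" for k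
  proof (rule Bochner_Integration.integrable_bound)
    show "integrable M (\<lambda>\<omega>. \<theta> ^ k * (L * exp (\<beta> * \<bar>Z \<omega>\<bar>)))"
      by (intro integrable_mult_right int)
    show "AE \<omega> in M. norm (\<alpha> ^ k / fact k * (G \<omega> * Z \<omega> ^ (j + k))) \<le> norm (\<theta> ^ k * (L * exp (\<beta> * \<bar>Z \<omega>\<bar>)))"
      by (intro AE_I2 order_trans[OF bnd]) simp
  qed measurable
  have intE: "(\<integral>\<omega>. exp (\<beta> * \<bar>Z \<omega>\<bar>) \<partial>M) \<le> K"
    using K by (subst integral_eq_nn_integral) (auto intro!: enn2real_leI)
  have intb: "(\<integral>\<omega>. norm (\<alpha> ^ k / fact k * (G \<omega> * Z \<omega> ^ (j + k))) \<partial>M) \<le> \<theta> ^ k * (L * K)" for k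
  proof -
    have "(\<integral>\<omega>. norm (\<alpha> ^ k / fact k * (G \<omega> * Z \<omega> ^ (j + k))) \<partial>M) \<le> (\<integral>\<omega>. \<theta> ^ k * (L * exp (\<beta> * \<bar>Z \<omega>\<bar>)) \<partial>M)"
      by (intro integral_mono integrable_norm intk bnd integrable_mult_right int)
    also have "\<dots> = \<theta> ^ k * (L * (\<integral>\<omega>. exp (\<beta> * \<bar>Z \<omega>\<bar>) \<partial>M))" by simp
    also have "\<dots> \<le> \<theta> ^ k * (L * K)" using \<theta> by (intro mult_left_mono intE) auto
    finally show ?thesis .
  qed
  have "\<bar>\<alpha> ^ k / fact k * (\<integral>\<omega>. G \<omega> * Z \<omega> ^ (j + k) \<partial>M)\<bar> = norm (\<integral>\<omega>. \<alpha> ^ k / fact k * (G \<omega> * Z \<omega> ^ (j + k)) \<partial>M)"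
    by simp
  also have "\<dots> \<le> \<theta> ^ k * (L * K)" by (rule order_trans[OF integral_norm_bound intb])
  finally show "\<bar>\<alpha> ^ k / fact k * (\<integral>\<omega>. G \<omega> * Z \<omega> ^ (j + k) \<partial>M)\<bar> \<le> \<theta> ^ k * (L * K)" .
  have sum1: "summable (\<lambda>k. norm (\<alpha> ^ k / fact k * (G \<omega> * Z \<omega> ^ (j + k))))" for \<omega>
    using bnd \<theta> by (intro summable_comparison_test[OF _ summable_mult2[OF summable_geometric]]) auto
  have sum2: "summable (\<lambda>k. \<integral>\<omega>. norm (\<alpha> ^ k / fact k * (G \<omega> * Z \<omega> ^ (j + k))) \<partial>M)"
    using intb \<theta> by (intro summable_comparison_test[OF _ summable_mult2[OF summable_geometric]]) auto
  have "(\<Sum>k. \<alpha> ^ k / fact k * (G \<omega> * Z \<omega> ^ (j + k))) = G \<omega> * Z \<omega> ^ j * exp (\<alpha> * Z \<omega>)" for \<omega>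
  proof -
    have "(\<lambda>k. G \<omega> * Z \<omega> ^ j * ((\<alpha> * Z \<omega>) ^ k /\<^sub>R fact k)) sums (G \<omega> * Z \<omega> ^ j * exp (\<alpha> * Z \<omega>))"
      by (intro sums_mult exp_converges)
    then show ?thesis
      by (simp add: sums_iff power_mult_distrib power_add divide_inverse mult_ac)
  qed
  then have "(\<integral>\<omega>. G \<omega> * Z \<omega> ^ j * exp (\<alpha> * Z \<omega>) \<partial>M) = (\<integral>\<omega>. (\<Sum>k. \<alpha> ^ k / fact k * (G \<omega> * Z \<omega> ^ (j + k))) \<partial>M)"
    by simp
  also have "\<dots> = (\<Sum>k. \<integral>\<omega>. \<alpha> ^ k / fact k * (G \<omega> * Z \<omega> ^ (j + k)) \<partial>M)"
    by (intro integral_suminf intk AE_I2 sum1 sum2)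
  finally show ?A
    by simp
qed

text \<open>Tannery's theorem for the exponential series. The weights and the spare power j make the
  conclusion, read for all j with the exponential joined to the weight, an instance of the
  hypothesis \<open>lim\<close>, so the lemma can be applied repeatedly.\<close>

lemma weighted_exp_tendsto:
  fixes Z G :: "nat \<Rightarrow> 'b \<Rightarrow> real" and S H :: "'c \<Rightarrow> real"
  assumes meas: "\<And>n. Z n \<in> borel_measurable (N n)" "\<And>n. G n \<in> borel_measurable (N n)"
      "S \<in> borel_measurable Q" "H \<in> borel_measurable Q"
    and G: "\<And>n \<omega>. 0 \<le> G n \<omega>" "\<And>n \<omega>. G n \<omega> \<le> 1" and H: "\<And>\<omega>. 0 \<le> H \<omega>" "\<And>\<omega>. H \<omega> \<le> 1"
    and K: "\<And>n. (\<integral>\<^sup>+\<omega>. ennreal (exp (\<beta> * \<bar>Z n \<omega>\<bar>)) \<partial>N n) \<le> ennreal K"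
      "(\<integral>\<^sup>+\<omega>. ennreal (exp (\<beta> * \<bar>S \<omega>\<bar>)) \<partial>Q) \<le> ennreal K" "0 \<le> K"
    and \<alpha>: "\<bar>\<alpha>\<bar> < \<beta>"
    and lim: "\<And>k. (\<lambda>n. \<integral>\<omega>. G n \<omega> * Z n \<omega> ^ k \<partial>N n) \<longlonglongrightarrow> (\<integral>\<omega>. H \<omega> * S \<omega> ^ k \<partial>Q)"
  shows "(\<lambda>n. \<integral>\<omega>. G n \<omega> * Z n \<omega> ^ j * exp (\<alpha> * Z n \<omega>) \<partial>N n) \<longlonglongrightarrow> (\<integral>\<omega>. H \<omega> * S \<omega> ^ j * exp (\<alpha> * S \<omega>) \<partial>Q)"
proof -
  obtain \<theta> L where \<theta>: "0 \<le> \<theta>" "\<theta> < 1" "0 \<le> L"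
      "\<And>k (z::real). \<bar>\<alpha> ^ k / fact k * z ^ (j + k)\<bar> \<le> \<theta> ^ k * (L * exp (\<beta> * \<bar>z\<bar>))"
    using exp_series_term_bound[OF \<alpha>, of j] by blast
  note N = weighted_exp_expectation[OF meas(1,2) G K(1,3) \<theta>]
  note Q = weighted_exp_expectation[OF meas(3,4) H K(2,3) \<theta>]
  have "(\<lambda>n. \<Sum>k. \<alpha> ^ k / fact k * (\<integral>\<omega>. G n \<omega> * Z n \<omega> ^ (j + k) \<partial>N n))
      \<longlonglongrightarrow> (\<Sum>k. \<alpha> ^ k / fact k * (\<integral>\<omega>. H \<omega> * S \<omega> ^ (j + k) \<partial>Q))"
  proof (rule tannerys_theorem[where M="\<lambda>k. \<theta> ^ k * (L * K)", THEN conjunct2, THEN conjunct2])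
    show "\<forall>\<^sub>F (k, n) in sequentially \<times>\<^sub>F sequentially.
        norm (\<alpha> ^ k / fact k * (\<integral>\<omega>. G n \<omega> * Z n \<omega> ^ (j + k) \<partial>N n)) \<le> \<theta> ^ k * (L * K)"
      using N(2) by (intro always_eventually) auto
    show "summable (\<lambda>k. \<theta> ^ k * (L * K))" using \<theta> by (intro summable_mult2 summable_geometric) auto
  qed (auto intro!: tendsto_intros lim)
  then show ?thesis unfolding N(1) Q(1) .
qed

text \<open>Monotone convergence allows the value infinity on both sides, so finiteness of an
  exponential moment becomes convergence of the series. Almost sure finiteness of \<open>A\<close>
  protects against \<open>enn2real\<close> sending infinity to 0.\<close>

lemma nn_integral_exp_series:
  assumes [measurable]: "A \<in> borel_measurable M" and fin: "AE \<omega> in M. A \<omega> < \<top>" and \<beta>: "0 \<le> \<beta>"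
    and mom: "\<And>k. (\<integral>\<^sup>+\<omega>. A \<omega> ^ k \<partial>M) = fact k * c k"
  shows "(\<integral>\<^sup>+\<omega>. ennreal (exp (\<beta> * enn2real (A \<omega>))) \<partial>M) = (\<Sum>k. ennreal \<beta> ^ k * c k)"
proof -
  have "AE \<omega> in M. ennreal (exp (\<beta> * enn2real (A \<omega>))) = (\<Sum>k. ennreal (\<beta> ^ k / fact k) * A \<omega> ^ k)"
    using fin
  proof eventually_elim
    case (elim \<omega>)
    then obtain a where a: "A \<omega> = ennreal a" "0 \<le> a" by (cases "A \<omega>") auto
    have "(\<lambda>k. (\<beta> * a) ^ k /\<^sub>R fact k) sums exp (\<beta> * a)" by (rule exp_converges)
    then have "(\<Sum>k. ennreal ((\<beta> * a) ^ k /\<^sub>R fact k)) = ennreal (exp (\<beta> * a))"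
      using \<beta> a by (intro suminf_ennreal_eq) auto
    moreover have "ennreal ((\<beta> * a) ^ k /\<^sub>R fact k) = ennreal (\<beta> ^ k / fact k) * A \<omega> ^ k" for k
      using \<beta> a by (simp add: ennreal_power ennreal_mult''[symmetric] power_mult_distrib divide_inverse mult_ac)
    ultimately show ?case using a by simp
  qed
  then have "(\<integral>\<^sup>+\<omega>. ennreal (exp (\<beta> * enn2real (A \<omega>))) \<partial>M) = (\<integral>\<^sup>+\<omega>. (\<Sum>k. ennreal (\<beta> ^ k / fact k) * A \<omega> ^ k) \<partial>M)"
    by (rule nn_integral_cong_AE)
  also have "\<dots> = (\<Sum>k. ennreal (\<beta> ^ k / fact k) * (fact k * c k))"
    by (subst nn_integral_suminf) (auto simp: nn_integral_cmult mom)
  also have "\<dots> = (\<Sum>k. ennreal \<beta> ^ k * c k)"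
  proof (intro suminf_cong)
    fix k
    have "ennreal (\<beta> ^ k / fact k) * fact k = ennreal \<beta> ^ k"
    proof -
      have "(fact k :: ennreal) = ennreal (fact k)"
        by (metis ennreal_of_nat_eq_real_of_nat of_nat_fact)
      then show ?thesis using \<beta> by (simp add: ennreal_mult''[symmetric] ennreal_power)
    qed
    then show "ennreal (\<beta> ^ k / fact k) * (fact k * c k) = ennreal \<beta> ^ k * c k"
      by (simp only: mult.assoc[symmetric])
  qed
  finally show ?thesis .
qed

text \<open>The convergence theorems are applied along sequences. Dropping an initial segment lets a
  property that holds for all large t hold for every term.\<close>

lemma tendsto_at_top_along:
  fixes F :: "real \<Rightarrow> 'b::first_countable_topology"
  assumes P: "eventually P at_top"
    and lim: "\<And>t. filterlim t at_top sequentially \<Longrightarrow> (\<And>n. P (t n)) \<Longrightarrow> (\<lambda>n. F (t n)) \<longlonglongrightarrow> l"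
  shows "(F \<longlongrightarrow> l) at_top"
proof (rule tendsto_at_topI_sequentially)
  fix t :: "nat \<Rightarrow> real" assume t: "filterlim t at_top sequentially"
  then have "\<forall>\<^sub>F n in sequentially. P (t n)" using P by (simp add: filterlim_iff)
  then obtain k where k: "\<And>n. k \<le> n \<Longrightarrow> P (t n)" by (auto simp: eventually_sequentially)
  have "filterlim (\<lambda>n. t (n + k)) at_top sequentially"
    using filterlim_compose[OF t filterlim_add_const_nat_at_top] .
  then have "(\<lambda>n. F (t (n + k))) \<longlonglongrightarrow> l" by (rule lim) (use k in auto)
  then show "(\<lambda>n. F (t n)) \<longlonglongrightarrow> l" by (rule LIMSEQ_offset)
qed

section \<open>Exponential bounds uniform in the length of the bridge\<close>

lemma heat_ratio_le:
  fixes a b :: "'a::euclidean_space"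
  assumes "1 \<le> t" "norm a \<le> r" "norm b \<le> r"
  shows "heat t (0::'a) / heat t (b - a) \<le> ennreal (exp (2 * r\<^sup>2))"
proof -
  have "norm (b - a) \<le> 2 * r" using norm_triangle_ineq4[of b a] assms by simp
  then have "(norm (b - a))\<^sup>2 \<le> (2 * r)\<^sup>2" by (intro power_mono) auto
  then have "(norm (b - a))\<^sup>2 \<le> 4 * r\<^sup>2" by (simp add: power_mult_distrib)
  also have "\<dots> \<le> 4 * r\<^sup>2 * t" using assms mult_left_mono[of 1 t "4 * r\<^sup>2"] by simp
  finally have "(norm (b - a))\<^sup>2 / (2 * t) \<le> 2 * r\<^sup>2" using assms by (simp add: field_simps)
  moreover have "heat t (0::'a) / heat t (b - a) = ennreal (exp ((norm (b - a))\<^sup>2 / (2 * t)))"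
    using assms by (simp add: heat_eq heat_kernel_def divide_ennreal exp_minus field_simps)
  ultimately show ?thesis by (simp add: ennreal_leI)
qed

context bounded_potential
begin

text \<open>The local bound at \<gamma> makes the k-th term at most a polynomial in k times (\<beta>
  / \<gamma>)^k, uniformly in t \<ge> 1 and in the endpoints, so a geometric series
  dominates.\<close>

lemma pinned_normalized_series_bounded:
  fixes \<beta> \<gamma> r :: real
  assumes \<beta>: "0 \<le> \<beta>" "\<beta> < \<gamma>" and fin: "(\<Sum>k. ennreal \<gamma> ^ k * green f k 0) < \<top>"
  shows "\<exists>K\<ge>0. \<forall>t\<ge>1. \<forall>a b. norm a \<le> r \<longrightarrow> norm b \<le> r \<longrightarrow>
           (\<Sum>k. ennreal \<beta> ^ k * (pinned f k t a b / heat t (b - a))) \<le> ennreal K"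
proof -
  have \<gamma>: "0 < \<gamma>" using \<beta> by simp
  obtain C' where C': "C' < \<top>" "\<And>k a. norm a \<le> r \<Longrightarrow> ennreal \<gamma> ^ k * green f k a \<le> C'"
    using green_locally_bounded[OF \<gamma> fin, of r] by blast
  then obtain C where C: "0 \<le> C" "C' = ennreal C" by (cases C') auto
  \<comment> \<open>DIM bounds the exponent DIM / 2 from the longest gap, and one more power
    accounts for its k + 1 possible positions.\<close>
  define p where "p = Suc DIM('a)"
  define B where "B = exp (2 * r\<^sup>2) * C\<^sup>2"
  have B: "0 \<le> B" by (simp add: B_def)
  obtain \<theta> where \<theta>: "\<beta> / \<gamma> < \<theta>" "\<theta> < 1"
    using dense[of "\<beta> / \<gamma>" 1] \<beta> \<gamma> by auto
  have \<theta>0: "0 < \<theta>" using \<theta> \<beta> \<gamma> by (smt (verit) divide_nonneg_pos)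
  \<comment> \<open>The polynomial will be traded for e^(e k); the rate has to be small enough to
    keep the ratio below \<theta>. The logarithm that provides it needs \<beta> > 0.\<close>
  obtain e where e: "0 < e" "(\<beta> / \<gamma>) * exp e \<le> \<theta>"
  proof (cases "\<beta> = 0")
    case True
    then show ?thesis using that[of 1] \<theta>0 by simp
  next
    case False
    then have "0 < \<beta> / \<gamma>" using \<beta> \<gamma> by simp
    then show ?thesis using that[of "ln (\<theta> / (\<beta> / \<gamma>))"] \<theta> \<theta>0 \<beta> \<gamma> by (simp add: field_simps)
  qed
  define L where "L = B * (fact p / e ^ p * exp e)"
  have L: "0 \<le> L" using B e by (simp add: L_def)
  have term_le: "ennreal \<beta> ^ k * (pinned f k t a b / heat t (b - a)) \<le> ennreal (L * \<theta> ^ k)"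
    if "1 \<le> t" "norm a \<le> r" "norm b \<le> r" for k t a b
  proof -
    have sum_le: "ennreal \<gamma> ^ k * (\<Sum>i\<le>k. green f i a * green f (k - i) b) \<le> ennreal (real (Suc k) * C\<^sup>2)"
    proof -
      have "ennreal \<gamma> ^ k * (\<Sum>i\<le>k. green f i a * green f (k - i) b)
          = (\<Sum>i\<le>k. (ennreal \<gamma> ^ i * green f i a) * (ennreal \<gamma> ^ (k - i) * green f (k - i) b))"
        unfolding sum_distrib_left
      proof (intro sum.cong refl)
        fix i assume "i \<in> {..k}"
        then have "ennreal \<gamma> ^ k = ennreal \<gamma> ^ i * ennreal \<gamma> ^ (k - i)" by (simp flip: power_add)
        then show "ennreal \<gamma> ^ k * (green f i a * green f (k - i) b)
           = (ennreal \<gamma> ^ i * green f i a) * (ennreal \<gamma> ^ (k - i) * green f (k - i) b)"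
          by (simp only: mult_ac)
      qed
      also have "\<dots> \<le> (\<Sum>i\<le>k. C' * C')"
        using that by (intro sum_mono mult_mono C') auto
      also have "\<dots> = ennreal (real (Suc k) * C\<^sup>2)"
        using C by (simp add: ennreal_mult' power2_eq_square ennreal_of_nat_eq_real_of_nat del: of_nat_Suc)
      finally show ?thesis .
    qed
    have pow_le: "real (Suc k) powr (real DIM('a) / 2) * real (Suc k) \<le> fact p / e ^ p * exp e * exp e ^ k"
    proof -
      have "real (Suc k) powr (real DIM('a) / 2) \<le> real (Suc k) powr (real DIM('a))"
        by (intro powr_mono) auto
      also have "\<dots> = real (Suc k) ^ DIM('a)" by (simp add: powr_realpow)
      finally have "real (Suc k) powr (real DIM('a) / 2) * real (Suc k) \<le> real (Suc k) ^ p"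
        by (simp add: p_def mult_right_mono mult.commute del: of_nat_Suc)
      also have "\<dots> = (e * real (Suc k)) ^ p / e ^ p" using e by (simp add: power_mult_distrib del: of_nat_Suc)
      also have "\<dots> \<le> fact p * exp (e * real (Suc k)) / e ^ p"
        using e by (intro divide_right_mono power_le_fact_exp) auto
      also have "exp (e * real (Suc k)) = exp e * exp e ^ k"
        by (simp add: exp_of_nat_mult[symmetric] algebra_simps flip: exp_add)
      finally show ?thesis by simp
    qed
    have "ennreal \<beta> ^ k = ennreal ((\<beta> / \<gamma>) ^ k) * ennreal \<gamma> ^ k"
      using \<beta> \<gamma> by (simp add: ennreal_power ennreal_mult''[symmetric] power_divide)
    then have "ennreal \<beta> ^ k * (pinned f k t a b / heat t (b - a))
      \<le> ennreal ((\<beta> / \<gamma>) ^ k) * ennreal \<gamma> ^ k * (ennreal (real (Suc k) powr (real DIM('a) / 2))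
          * (heat t (0::'a) / heat t (b - a)) * (\<Sum>i\<le>k. green f i a * green f (k - i) b))"
      using that by (auto simp del: of_nat_Suc intro!: mult_left_mono pinned_normalized_le)
    also have "\<dots> = ennreal ((\<beta> / \<gamma>) ^ k) * ennreal (real (Suc k) powr (real DIM('a) / 2))
          * (heat t (0::'a) / heat t (b - a)) * (ennreal \<gamma> ^ k * (\<Sum>i\<le>k. green f i a * green f (k - i) b))"
      by (simp only: mult_ac)
    also have "\<dots> \<le> ennreal ((\<beta> / \<gamma>) ^ k) * ennreal (real (Suc k) powr (real DIM('a) / 2))
          * ennreal (exp (2 * r\<^sup>2)) * ennreal (real (Suc k) * C\<^sup>2)"
      using that by (intro mult_mono heat_ratio_le sum_le) auto
    also have "\<dots> = ennreal ((\<beta> / \<gamma>) ^ k * (B * (real (Suc k) powr (real DIM('a) / 2) * real (Suc k))))"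
      using \<beta> \<gamma> by (simp add: B_def ennreal_mult''[symmetric] mult_ac del: of_nat_Suc)
    also have "\<dots> \<le> ennreal ((\<beta> / \<gamma>) ^ k * (B * (fact p / e ^ p * exp e * exp e ^ k)))"
      using \<beta> \<gamma> B by (intro ennreal_leI mult_left_mono pow_le) auto
    also have "(\<beta> / \<gamma>) ^ k * (B * (fact p / e ^ p * exp e * exp e ^ k)) = L * ((\<beta> / \<gamma>) * exp e) ^ k"
      unfolding L_def power_mult_distrib by (simp only: mult_ac)
    also have "ennreal (L * ((\<beta> / \<gamma>) * exp e) ^ k) \<le> ennreal (L * \<theta> ^ k)"
      using \<beta> \<gamma> e L by (intro ennreal_leI mult_left_mono power_mono) auto
    finally show ?thesis .
  qed
  have "(\<lambda>k. L * \<theta> ^ k) sums (L * (1 / (1 - \<theta>)))"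
    using \<theta> \<theta>0 by (intro sums_mult geometric_sums) auto
  then have "(\<Sum>k. ennreal (L * \<theta> ^ k)) = ennreal (L * (1 / (1 - \<theta>)))"
    using L \<theta>0 by (intro suminf_ennreal_eq) auto
  moreover have "(\<Sum>k. ennreal \<beta> ^ k * (pinned f k t a b / heat t (b - a))) \<le> (\<Sum>k. ennreal (L * \<theta> ^ k))"
    if "1 \<le> t" "norm a \<le> r" "norm b \<le> r" for t a b
    using term_le[OF that] by (intro suminf_le) auto
  ultimately show ?thesis
    using L \<theta> by (intro exI[of _ "L * (1 / (1 - \<theta>))"]) auto
qed

end

subsection \<open>Path integrals as random variables\<close>

text \<open>Only values of the path at times in I are constrained, so joint measurability is
  demanded after multiplication by the indicator of I, with real test functions to make that product
  meaningful.\<close>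

definition measurable_path :: "'w measure \<Rightarrow> real set \<Rightarrow> (real \<Rightarrow> 'w \<Rightarrow> 'a::euclidean_space) \<Rightarrow> bool" where
  "measurable_path M I X \<longleftrightarrow> (\<forall>h::'a \<Rightarrow> real. h \<in> borel_measurable borel
     \<longrightarrow> (\<lambda>(s, \<omega>). indicator I s * h (X s \<omega>)) \<in> borel_measurable (borel \<Otimes>\<^sub>M M))"

lemma measurable_path_brownian_motion:
  assumes "brownian_motion M z W"
  shows "measurable_path M {0..} W"
  unfolding measurable_path_def
proof (intro allI impI)
  fix h :: "'b \<Rightarrow> real" assume [measurable]: "h \<in> borel_measurable borel"
  note [measurable] = brownian_motion_measurable_pair[OF assms]
  have "(\<lambda>(s, \<omega>). indicator {0..} s * h (W s \<omega>))
      = (\<lambda>p. indicator {0..} (fst p) * h (case p of (s, \<omega>) \<Rightarrow> W (max 0 s) \<omega>))"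
    by (auto simp: fun_eq_iff indicator_def)
  also have "\<dots> \<in> borel_measurable (borel \<Otimes>\<^sub>M M)" by measurable
  finally show "(\<lambda>(s, \<omega>). indicator {0..} s * h (W s \<omega>)) \<in> borel_measurable (borel \<Otimes>\<^sub>M M)" .
qed

lemma measurable_path_brownian_bridge:
  assumes "brownian_bridge M t a b X" "0 \<le> t"
  shows "measurable_path M {0..t} X"
  unfolding measurable_path_def
proof (intro allI impI)
  fix h :: "'b \<Rightarrow> real" assume [measurable]: "h \<in> borel_measurable borel"
  note [measurable] = brownian_bridge_measurable_pair[OF assms]
  have "(\<lambda>(s, \<omega>). indicator {0..t} s * h (X s \<omega>))
      = (\<lambda>p. indicator {0..t} (fst p) * h (case p of (s, \<omega>) \<Rightarrow> X (max 0 (min t s)) \<omega>))"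
    by (auto simp: fun_eq_iff indicator_def)
  also have "\<dots> \<in> borel_measurable (borel \<Otimes>\<^sub>M M)" by measurable
  finally show "(\<lambda>(s, \<omega>). indicator {0..t} s * h (X s \<omega>)) \<in> borel_measurable (borel \<Otimes>\<^sub>M M)" .
qed

lemma measurable_path_section:
  fixes h :: "'a::euclidean_space \<Rightarrow> real"
  assumes "measurable_path M I X" "h \<in> borel_measurable borel" "\<omega> \<in> space M"
  shows "(\<lambda>s. indicator I s * h (X s \<omega>)) \<in> borel_measurable lborel"
proof -
  have "(\<lambda>(s, \<omega>). indicator I s * h (X s \<omega>)) \<in> borel_measurable (borel \<Otimes>\<^sub>M M)"
    using assms unfolding measurable_path_def by blast
  from measurable_compose[OF measurable_Pair2'[OF assms(3)] this] show ?thesis by simp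
qed

lemma measurable_path_lborel:
  fixes h :: "'a::euclidean_space \<Rightarrow> real"
  assumes "measurable_path M I X" "h \<in> borel_measurable borel"
  shows "(\<lambda>(s, \<omega>). indicator I s * h (X s \<omega>)) \<in> borel_measurable (lborel \<Otimes>\<^sub>M M)"
proof -
  have "borel_measurable (lborel \<Otimes>\<^sub>M M) = (borel_measurable (borel \<Otimes>\<^sub>M M) :: (real \<times> 'b \<Rightarrow> real) set)"
    by (intro measurable_cong_sets sets_pair_measure_cong) auto
  then show ?thesis using assms unfolding measurable_path_def by blast
qed

lemma path_integral_measurable:
  assumes "measurable_path M I X" "h \<in> borel_measurable borel"
  shows "path_integral I h X \<in> borel_measurable M"
proof -
  have [measurable]: "(\<lambda>(s, \<omega>). indicator I s * h (X s \<omega>)) \<in> borel_measurable (lborel \<Otimes>\<^sub>M M)"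
    using measurable_path_lborel[OF assms] .
  have "(\<lambda>\<omega>. \<integral>s. (case (s, \<omega>) of (s, \<omega>) \<Rightarrow> indicator I s * h (X s \<omega>)) \<partial>lborel) \<in> borel_measurable M"
    by measurable
  moreover have "path_integral I h X = (\<lambda>\<omega>. \<integral>s. (case (s, \<omega>) of (s, \<omega>) \<Rightarrow> indicator I s * h (X s \<omega>)) \<partial>lborel)"
    by (simp add: path_integral_def set_lebesgue_integral_def fun_eq_iff)
  ultimately show ?thesis by simp
qed

lemma nn_path_integral_measurable:
  assumes "measurable_path M I X" "h \<in> borel_measurable borel"
  shows "(\<lambda>\<omega>. \<integral>\<^sup>+s\<in>I. ennreal (h (X s \<omega>)) \<partial>lborel) \<in> borel_measurable M"
proof -
  have [measurable]: "(\<lambda>(s, \<omega>). indicator I s * h (X s \<omega>)) \<in> borel_measurable (lborel \<Otimes>\<^sub>M M)"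
    using measurable_path_lborel[OF assms] .
  have "(\<lambda>\<omega>. \<integral>\<^sup>+s. ennreal (case (s, \<omega>) of (s, \<omega>) \<Rightarrow> indicator I s * h (X s \<omega>)) \<partial>lborel) \<in> borel_measurable M"
    by measurable
  moreover have "(\<lambda>\<omega>. \<integral>\<^sup>+s\<in>I. ennreal (h (X s \<omega>)) \<partial>lborel)
      = (\<lambda>\<omega>. \<integral>\<^sup>+s. ennreal (case (s, \<omega>) of (s, \<omega>) \<Rightarrow> indicator I s * h (X s \<omega>)) \<partial>lborel)"
    by (intro ext nn_integral_cong) (auto simp: indicator_def)
  ultimately show ?thesis by simp
qed

text \<open>This remains true when the integral diverges: the Bochner integral then defaults to 0,
  and so does \<open>enn2real\<close> at infinity.\<close>

lemma path_integral_eq_nn: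
  assumes "measurable_path M I X" "h \<in> borel_measurable borel" "\<omega> \<in> space M" "\<And>z. 0 \<le> h z"
  shows "path_integral I h X \<omega> = enn2real (\<integral>\<^sup>+s\<in>I. ennreal (h (X s \<omega>)) \<partial>lborel)"
proof -
  have "path_integral I h X \<omega> = enn2real (\<integral>\<^sup>+s. ennreal (indicator I s * h (X s \<omega>)) \<partial>lborel)"
    unfolding path_integral_def set_lebesgue_integral_def
    using measurable_path_section[OF assms(1-3)] assms(4)
    by (subst integral_eq_nn_integral) auto
  also have "(\<integral>\<^sup>+s. ennreal (indicator I s * h (X s \<omega>)) \<partial>lborel) = (\<integral>\<^sup>+s\<in>I. ennreal (h (X s \<omega>)) \<partial>lborel)"
    by (intro nn_integral_cong) (auto simp: indicator_def)
  finally show ?thesis .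
qed

lemma path_integral_nonneg: "(\<And>z. 0 \<le> h z) \<Longrightarrow> 0 \<le> path_integral I h X \<omega>"
  unfolding path_integral_def set_lebesgue_integral_def by (intro integral_nonneg_AE) auto

lemma abs_path_integral_le: "\<bar>path_integral I h X \<omega>\<bar> \<le> path_integral I (\<lambda>z. \<bar>h z\<bar>) X \<omega>"
  using integral_norm_bound[of lborel "\<lambda>s. indicator I s *\<^sub>R h (X s \<omega>)"]
  unfolding path_integral_def set_lebesgue_integral_def by (simp add: abs_mult)

text \<open>The nonnegative functions whose occupation integrals are the nodes a + j b, where a and
  b are the integrals of the positive and the negative part.\<close>

definition sign_mix :: "('a \<Rightarrow> real) \<Rightarrow> nat \<Rightarrow> 'a \<Rightarrow> real" where
  "sign_mix h j z = max 0 (h z) + real j * max 0 (- h z)"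

lemma sign_mix_nonneg: "0 \<le> sign_mix h j z"
  by (simp add: sign_mix_def)

lemma sign_mix_measurable [measurable]:
  assumes [measurable]: "h \<in> borel_measurable M"
  shows "sign_mix h j \<in> borel_measurable M"
  unfolding sign_mix_def by measurable

lemma path_integral_sign_mix:
  assumes X: "measurable_path M I X" and h [measurable]: "h \<in> borel_measurable borel" and \<omega>: "\<omega> \<in> space M"
    and fin: "(\<integral>\<^sup>+s\<in>I. ennreal \<bar>h (X s \<omega>)\<bar> \<partial>lborel) < \<top>"
  shows "path_integral I h X \<omega> = path_integral I (\<lambda>z. max 0 (h z)) X \<omega> - path_integral I (\<lambda>z. max 0 (- h z)) X \<omega>" (is ?A)
    and "path_integral I (sign_mix h j) X \<omega>
       = path_integral I (\<lambda>z. max 0 (h z)) X \<omega> + real j * path_integral I (\<lambda>z. max 0 (- h z)) X \<omega>" (is ?B)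
proof -
  have int: "set_integrable lborel I (\<lambda>s. g (X s \<omega>))"
    if [measurable]: "g \<in> borel_measurable borel" and le: "\<And>z. \<bar>g z\<bar> \<le> \<bar>h z\<bar>" for g
    unfolding set_integrable_def
  proof (rule integrableI_bounded)
    show "(\<lambda>s. indicator I s *\<^sub>R g (X s \<omega>)) \<in> borel_measurable lborel"
      using measurable_path_section[OF X that(1) \<omega>] by simp
    have "(\<integral>\<^sup>+s. ennreal (norm (indicator I s *\<^sub>R g (X s \<omega>))) \<partial>lborel) \<le> (\<integral>\<^sup>+s\<in>I. ennreal \<bar>h (X s \<omega>)\<bar> \<partial>lborel)"
      by (intro nn_integral_mono) (auto simp: indicator_def le intro!: ennreal_leI)
    then show "(\<integral>\<^sup>+s. ennreal (norm (indicator I s *\<^sub>R g (X s \<omega>))) \<partial>lborel) < \<infinity>"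
      using fin by (simp add: order_le_less_trans)
  qed
  have p: "set_integrable lborel I (\<lambda>s. max 0 (h (X s \<omega>)))"
    by (rule int[of "\<lambda>z. max 0 (h z)"]) auto
  have n: "set_integrable lborel I (\<lambda>s. max 0 (- h (X s \<omega>)))"
    by (rule int[of "\<lambda>z. max 0 (- h z)"]) auto
  have "path_integral I h X \<omega> = (LINT s:I|lborel. max 0 (h (X s \<omega>)) - max 0 (- h (X s \<omega>)))"
    unfolding path_integral_def by (intro arg_cong2[where f="set_lebesgue_integral lborel"] ext refl) auto
  also have "\<dots> = path_integral I (\<lambda>z. max 0 (h z)) X \<omega> - path_integral I (\<lambda>z. max 0 (- h z)) X \<omega>"
    unfolding path_integral_def by (rule set_integral_diff(2)[OF p n])
  finally show ?A .
  show ?B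
    unfolding path_integral_def sign_mix_def using p n
    by (subst set_integral_add) (auto intro: set_integrable_mult_right)
qed

lemma signed_moment:
  fixes w :: "nat \<Rightarrow> 'b \<Rightarrow> real"
  assumes v [measurable]: "v \<in> borel_measurable M"
    and AE: "AE \<omega> in M. v \<omega> = p \<omega> - n \<omega> \<and> (\<forall>j. w j \<omega> = p \<omega> + real j * n \<omega>)"
    and int: "\<And>j. integrable M (\<lambda>\<omega>. w j \<omega> ^ k)"
  shows "integrable M (\<lambda>\<omega>. v \<omega> ^ k)"
    and "(\<integral>\<omega>. v \<omega> ^ k \<partial>M) = (\<Sum>j\<le>k. (-1) ^ j * real (Suc k choose Suc j) * (\<integral>\<omega>. w j \<omega> ^ k \<partial>M))" (is ?B)
proof -
  have int': "integrable M (\<lambda>\<omega>. \<Sum>j\<le>k. (-1) ^ j * real (Suc k choose Suc j) * w j \<omega> ^ k)"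
    by (intro Bochner_Integration.integrable_sum integrable_mult_right int)
  have eq: "AE \<omega> in M. v \<omega> ^ k = (\<Sum>j\<le>k. (-1) ^ j * real (Suc k choose Suc j) * w j \<omega> ^ k)"
    using AE by eventually_elim (simp add: power_diff_as_combination del: binomial_Suc_Suc)
  show "integrable M (\<lambda>\<omega>. v \<omega> ^ k)"
    using int' eq by (subst integrable_cong_AE[OF _ _ eq]) (auto intro: borel_measurable_integrable)
  have "(\<integral>\<omega>. v \<omega> ^ k \<partial>M) = (\<integral>\<omega>. (\<Sum>j\<le>k. (-1) ^ j * real (Suc k choose Suc j) * w j \<omega> ^ k) \<partial>M)"
    using int' eq by (intro integral_cong_AE) (auto intro: borel_measurable_integrable)
  also have "\<dots> = (\<Sum>j\<le>k. (-1) ^ j * real (Suc k choose Suc j) * (\<integral>\<omega>. w j \<omega> ^ k \<partial>M))"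
    by (subst Bochner_Integration.integral_sum) (auto intro!: integrable_mult_right int simp del: binomial_Suc_Suc)
  finally show ?B .
qed

lemma exp_moment_eq_integral:
  assumes [measurable]: "Z \<in> borel_measurable M"
    and K: "(\<integral>\<^sup>+\<omega>. ennreal (exp (\<beta> * \<bar>Z \<omega>\<bar>)) \<partial>M) \<le> ennreal K"
    and le: "\<And>\<omega>. \<alpha> * Z \<omega> \<le> \<beta> * \<bar>Z \<omega>\<bar>"
  shows "exp_moment M \<alpha> Z = ennreal (\<integral>\<omega>. exp (\<alpha> * Z \<omega>) \<partial>M)"
  unfolding exp_moment_def
proof (rule nn_integral_eq_integral)
  show "integrable M (\<lambda>\<omega>. exp (\<alpha> * Z \<omega>))"
    by (rule Bochner_Integration.integrable_bound[OF integrable_exp_abs[OF assms(1) K]]) (auto simp: le)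
qed auto

lemma AE_less_top_if_nn_integral:
  assumes "A \<in> borel_measurable M" "(\<integral>\<^sup>+\<omega>. A \<omega> ^ 1 \<partial>M) < \<top>"
  shows "AE \<omega> in M. A \<omega> < (\<top>::ennreal)"
  using nn_integral_PInf_AE[OF assms(1)] assms(2) by (auto simp: less_top)

lemma nn_integral_enn2real_power:
  assumes "AE \<omega> in M. A \<omega> < \<top>" "\<And>\<omega>. \<omega> \<in> space M \<Longrightarrow> Z \<omega> = enn2real (A \<omega>)"
  shows "(\<integral>\<^sup>+\<omega>. ennreal (Z \<omega>) ^ k \<partial>M) = (\<integral>\<^sup>+\<omega>. A \<omega> ^ k \<partial>M)"
  using assms(1) by (intro nn_integral_cong_AE) (auto simp: assms(2) elim!: AE_mp)

subsection \<open>The limit theorem\<close>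

definition admissible :: "('a::euclidean_space \<Rightarrow> real) \<Rightarrow> bool" where
  "admissible g \<longleftrightarrow> g \<in> borel_measurable borel \<and> (\<forall>z. 0 \<le> g z) \<and> bounded (range g) \<and> bounded {z. g z \<noteq> 0}"

lemma admissible_potential:
  assumes "admissible (g :: 'a::euclidean_space \<Rightarrow> real)" "DIM('a) \<ge> 3"
  obtains V R where "bounded_potential (\<lambda>z. ennreal (g z)) V R"
proof -
  obtain V where V: "\<And>z. \<bar>g z\<bar> \<le> V"
    using assms(1) unfolding admissible_def bounded_iff by (metis rangeI real_norm_def)
  obtain R where R: "\<And>z. g z \<noteq> 0 \<Longrightarrow> norm z \<le> R"
    using assms(1) by (auto simp: admissible_def bounded_iff)
  have "bounded_potential (\<lambda>z. ennreal (g z)) V R"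
  proof
    show "ennreal (g z) \<le> ennreal V" for z using V[of z] by (intro ennreal_leI) auto
    show "ennreal (g z) = 0" if "R < norm z" for z using R[of z] that by force
  qed (use assms in \<open>auto simp: admissible_def\<close>)
  then show ?thesis by (rule that)
qed

locale long_bridge =
  fixes v :: "'a::euclidean_space \<Rightarrow> real"
    and x y :: "real \<Rightarrow> 'a" and x\<^sub>0 y\<^sub>0 :: 'a
    and N :: "real \<Rightarrow> 'b measure" and X :: "real \<Rightarrow> real \<Rightarrow> 'b \<Rightarrow> 'a"
    and M :: "'a \<Rightarrow> 'w measure" and W :: "'a \<Rightarrow> real \<Rightarrow> 'w \<Rightarrow> 'a"
  assumes dim: "DIM('a) \<ge> 3"
    and v_measurable [measurable]: "v \<in> borel_measurable borel"
    and v_bounded: "bounded (range v)"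
    and v_support: "bounded {z. v z \<noteq> 0}"
    and x_lim: "(x \<longlongrightarrow> x\<^sub>0) at_top"
    and y_lim: "(y \<longlongrightarrow> y\<^sub>0) at_top"
    and bridge: "\<And>t. t > 0 \<Longrightarrow> brownian_bridge (N t) t (x t) (y t) (X t)"
    and motion: "\<And>z. brownian_motion (M z) z (W z)"
begin

definition occupation :: "('a \<Rightarrow> real) \<Rightarrow> 'a \<Rightarrow> 'w \<Rightarrow> real" where
  "occupation g z = path_integral {0..} g (W z)"

definition bridge_occupation :: "('a \<Rightarrow> real) \<Rightarrow> real \<Rightarrow> 'b \<Rightarrow> real" where
  "bridge_occupation g t = path_integral {0..t} g (X t)"

text \<open>A concrete realization of the two independent motions; the given variables
  \<open>U\<close> and \<open>U'\<close> enter only through the law of their sum.\<close>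

definition limit_space :: "('w \<times> 'w) measure" where
  "limit_space = M x\<^sub>0 \<Otimes>\<^sub>M M y\<^sub>0"

definition limit_sum :: "('a \<Rightarrow> real) \<Rightarrow> 'w \<times> 'w \<Rightarrow> real" where
  "limit_sum g p = occupation g x\<^sub>0 (fst p) + occupation g y\<^sub>0 (snd p)"

lemma admissible_abs: "admissible (\<lambda>z. \<bar>v z\<bar>)"
  using v_bounded v_support by (auto simp: admissible_def bounded_iff)

lemma admissible_sign_mix: "admissible (sign_mix v j)"
proof -
  obtain V where V: "\<And>z. \<bar>v z\<bar> \<le> V" using v_bounded by (auto simp: bounded_iff)
  have "\<bar>sign_mix v j z\<bar> \<le> V + real j * V" for z
    unfolding sign_mix_def using V[of z]
    by (intro abs_triangle_ineq[THEN order_trans] add_mono) (auto simp: abs_mult intro!: mult_left_mono)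
  then have "bounded (range (sign_mix v j))" by (intro boundedI[of _ "V + real j * V"]) auto
  moreover have "bounded {z. sign_mix v j z \<noteq> 0}"
    by (rule bounded_subset[OF v_support]) (auto simp: sign_mix_def)
  ultimately show ?thesis by (simp add: admissible_def sign_mix_nonneg)
qed

lemma motion_path: "measurable_path (M z) {0..} (W z)"
  by (rule measurable_path_brownian_motion[OF motion])

lemma bridge_path: "0 < t \<Longrightarrow> measurable_path (N t) {0..t} (X t)"
  by (intro measurable_path_brownian_bridge[OF bridge]) auto

lemma occupation_measurable [measurable]:
  "g \<in> borel_measurable borel \<Longrightarrow> occupation g z \<in> borel_measurable (M z)"
  unfolding occupation_def by (rule path_integral_measurable[OF motion_path])

lemma bridge_occupation_measurable:
  "0 < t \<Longrightarrow> g \<in> borel_measurable borel \<Longrightarrow> bridge_occupation g t \<in> borel_measurable (N t)"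
  unfolding bridge_occupation_def by (rule path_integral_measurable[OF bridge_path])

lemma limit_sum_measurable:
  assumes [measurable]: "g \<in> borel_measurable borel"
  shows "limit_sum g \<in> borel_measurable limit_space"
  unfolding limit_sum_def limit_space_def by measurable

lemma occupation_moment_nn:
  assumes g: "admissible g"
  shows "AE \<omega> in M z. (\<integral>\<^sup>+s\<in>{0..}. ennreal (g (W z s \<omega>)) \<partial>lborel) < \<top>"
    and "(\<integral>\<^sup>+\<omega>. ennreal (occupation g z \<omega>) ^ k \<partial>M z) = fact k * green (\<lambda>z. ennreal (g z)) k z"
proof -
  obtain V R where "bounded_potential (\<lambda>z. ennreal (g z)) V R"
    using admissible_potential[OF g dim] .
  then interpret bounded_potential "\<lambda>z. ennreal (g z)" V R .
  have gm: "g \<in> borel_measurable borel" and g0: "\<And>z. 0 \<le> g z" using g by (auto simp: admissible_def)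
  have mom: "(\<integral>\<^sup>+\<omega>. (\<integral>\<^sup>+s\<in>{0..}. ennreal (g (W z s \<omega>)) \<partial>lborel) ^ k \<partial>M z) = fact k * green (\<lambda>z. ennreal (g z)) k z" for k
    by (rule brownian_motion_moment[OF motion f_measurable])
  \<comment> \<open>The first moment is finite, so the extended integral is finite almost everywhere
    and default values do no harm afterwards.\<close>
  show AE: "AE \<omega> in M z. (\<integral>\<^sup>+s\<in>{0..}. ennreal (g (W z s \<omega>)) \<partial>lborel) < \<top>"
    using mom[of 1] green_less_top(1)[of 1 z]
    by (intro AE_less_top_if_nn_integral nn_path_integral_measurable[OF motion_path gm]) (simp del: green.simps)
  show "(\<integral>\<^sup>+\<omega>. ennreal (occupation g z \<omega>) ^ k \<partial>M z) = fact k * green (\<lambda>z. ennreal (g z)) k z"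
    unfolding mom[symmetric] occupation_def
    by (intro nn_integral_enn2real_power AE path_integral_eq_nn[OF motion_path gm] g0)
qed

lemma bridge_occupation_moment_nn:
  assumes g: "admissible g" and t: "0 < t"
  shows "AE \<omega> in N t. (\<integral>\<^sup>+s\<in>{0..t}. ennreal (g (X t s \<omega>)) \<partial>lborel) < \<top>"
    and "(\<integral>\<^sup>+\<omega>. ennreal (bridge_occupation g t \<omega>) ^ k \<partial>N t)
      = fact k * (pinned (\<lambda>z. ennreal (g z)) k t (x t) (y t) / heat t (y t - x t))"
    and "pinned (\<lambda>z. ennreal (g z)) k t (x t) (y t) / heat t (y t - x t) < \<top>"
proof -
  obtain V R where "bounded_potential (\<lambda>z. ennreal (g z)) V R"
    using admissible_potential[OF g dim] .
  then interpret bounded_potential "\<lambda>z. ennreal (g z)" V R .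
  let ?p = "\<lambda>k. pinned (\<lambda>z. ennreal (g z)) k t (x t) (y t) / heat t (y t - x t)"
  have gm: "g \<in> borel_measurable borel" and g0: "\<And>z. 0 \<le> g z" using g by (auto simp: admissible_def)
  have mom: "(\<integral>\<^sup>+\<omega>. (\<integral>\<^sup>+s\<in>{0..t}. ennreal (g (X t s \<omega>)) \<partial>lborel) ^ k \<partial>N t) = fact k * ?p k" for k
    by (rule brownian_bridge_moment[OF bridge[OF t] t f_measurable])
  have fin: "?p k < \<top>" for k
  proof -
    have "?p k \<le> ennreal (real (Suc k) powr (real DIM('a) / 2))
      * (heat t (0::'a) / heat t (y t - x t)) * (\<Sum>i\<le>k. green (\<lambda>z. ennreal (g z)) i (x t) * green (\<lambda>z. ennreal (g z)) (k - i) (y t))"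
      by (rule pinned_normalized_le[OF t])
    also have "\<dots> < \<top>"
      using heat_neq_0[OF t, of "y t - x t"]
      by (auto simp: ennreal_mult_less_top ennreal_divide_eq_top_iff less_top[symmetric] ennreal_mult_eq_top_iff)
    finally show ?thesis .
  qed
  then show "?p k < \<top>" .
  show AE: "AE \<omega> in N t. (\<integral>\<^sup>+s\<in>{0..t}. ennreal (g (X t s \<omega>)) \<partial>lborel) < \<top>"
    using mom[of 1] fin[of 1]
    by (intro AE_less_top_if_nn_integral nn_path_integral_measurable[OF bridge_path[OF t] gm]) (simp del: pinned.simps)
  show "(\<integral>\<^sup>+\<omega>. ennreal (bridge_occupation g t \<omega>) ^ k \<partial>N t) = fact k * ?p k"
    unfolding mom[symmetric] bridge_occupation_def
    by (intro nn_integral_enn2real_power AE path_integral_eq_nn[OF bridge_path[OF t] gm] g0)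
qed

lemma pair_prob_space_limit: "pair_prob_space (M x\<^sub>0) (M y\<^sub>0)"
proof -
  interpret x: prob_space "M x\<^sub>0" using motion by (auto simp: brownian_motion_def)
  interpret y: prob_space "M y\<^sub>0" using motion by (auto simp: brownian_motion_def)
  show ?thesis ..
qed

lemma nn_integral_limit_space_times:
  assumes F: "F \<in> borel_measurable (M x\<^sub>0)" and G: "G \<in> borel_measurable (M y\<^sub>0)"
  shows "(\<integral>\<^sup>+p. F (fst p) * G (snd p) \<partial>limit_space) = (\<integral>\<^sup>+\<omega>. F \<omega> \<partial>M x\<^sub>0) * (\<integral>\<^sup>+\<omega>. (G \<omega> :: ennreal) \<partial>M y\<^sub>0)"
proof -
  interpret pair_prob_space "M x\<^sub>0" "M y\<^sub>0" by (rule pair_prob_space_limit)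
  note [measurable] = F G
  show ?thesis
    unfolding limit_space_def by (subst M2.nn_integral_fst[symmetric]) (auto simp: nn_integral_cmult nn_integral_multc)
qed

text \<open>The binomial coefficient times i! (k - i)! is k!. Hence the sum over the position of the
  long gap is exactly the k-th moment of a sum of two independent variables.\<close>

lemma limit_sum_moment_nn:
  assumes g: "admissible g"
  shows "(\<integral>\<^sup>+p. ennreal (limit_sum g p) ^ k \<partial>limit_space)
      = fact k * (\<Sum>i\<le>k. green (\<lambda>z. ennreal (g z)) i x\<^sub>0 * green (\<lambda>z. ennreal (g z)) (k - i) y\<^sub>0)"
proof -
  interpret pair_prob_space "M x\<^sub>0" "M y\<^sub>0" by (rule pair_prob_space_limit)
  have [measurable]: "g \<in> borel_measurable borel" and g0: "\<And>z. 0 \<le> g z" using g by (auto simp: admissible_def)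
  have nonneg: "0 \<le> occupation g z \<omega>" for z \<omega>
    unfolding occupation_def by (rule path_integral_nonneg[OF g0])
  let ?F = "\<lambda>z i \<omega>. ennreal (occupation g z \<omega>) ^ i"
  have "ennreal (limit_sum g p) ^ k
     = (\<Sum>i\<le>k. of_nat (k choose i) * (?F x\<^sub>0 i (fst p) * ?F y\<^sub>0 (k - i) (snd p)))" for p
    unfolding limit_sum_def by (simp add: nonneg binomial_ring mult.assoc)
  then have "(\<integral>\<^sup>+p. ennreal (limit_sum g p) ^ k \<partial>limit_space)
     = (\<integral>\<^sup>+p. (\<Sum>i\<le>k. of_nat (k choose i) * (?F x\<^sub>0 i (fst p) * ?F y\<^sub>0 (k - i) (snd p))) \<partial>limit_space)"
    by simp
  also have "\<dots> = (\<Sum>i\<le>k. of_nat (k choose i) * (\<integral>\<^sup>+p. ?F x\<^sub>0 i (fst p) * ?F y\<^sub>0 (k - i) (snd p) \<partial>limit_space))"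
    unfolding limit_space_def by (simp add: nn_integral_sum nn_integral_cmult)
  also have "\<dots> = (\<Sum>i\<le>k. of_nat (k choose i) * (fact i * green (\<lambda>z. ennreal (g z)) i x\<^sub>0
        * (fact (k - i) * green (\<lambda>z. ennreal (g z)) (k - i) y\<^sub>0)))"
    by (subst nn_integral_limit_space_times) (simp_all add: occupation_moment_nn[OF g])
  also have "\<dots> = (\<Sum>i\<le>k. fact k * (green (\<lambda>z. ennreal (g z)) i x\<^sub>0 * green (\<lambda>z. ennreal (g z)) (k - i) y\<^sub>0))"
  proof (intro sum.cong refl)
    fix i assume "i \<in> {..k}"
    then have "(fact i * fact (k - i) * (k choose i) :: nat) = fact k"
      by (intro binomial_fact_lemma) auto
    then have "of_nat (fact i * fact (k - i) * (k choose i)) = (of_nat (fact k) :: ennreal)" by simp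
    then have "(fact k :: ennreal) = of_nat (k choose i) * fact i * fact (k - i)"
      by (simp add: mult_ac)
    then show "of_nat (k choose i) * (fact i * green (\<lambda>z. ennreal (g z)) i x\<^sub>0
        * (fact (k - i) * green (\<lambda>z. ennreal (g z)) (k - i) y\<^sub>0))
      = fact k * (green (\<lambda>z. ennreal (g z)) i x\<^sub>0 * green (\<lambda>z. ennreal (g z)) (k - i) y\<^sub>0)"
      by (simp only: mult_ac)
  qed
  finally show ?thesis by (simp only: sum_distrib_left)
qed

lemma limit_sum_moment_less_top:
  assumes g: "admissible g"
  shows "(\<integral>\<^sup>+p. ennreal (limit_sum g p) ^ k \<partial>limit_space) < \<top>"
proof -
  obtain V R where "bounded_potential (\<lambda>z. ennreal (g z)) V R"
    using admissible_potential[OF g dim] .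
  then interpret bounded_potential "\<lambda>z. ennreal (g z)" V R .
  have "(fact k :: ennreal) < \<top>" by (metis of_nat_fact of_nat_less_top)
  then show ?thesis
    unfolding limit_sum_moment_nn[OF g] by (simp add: ennreal_mult_less_top)
qed

section \<open>Convergence of power moments\<close>

lemma tendsto_moment_admissible:
  assumes g: "admissible g" and t: "filterlim t at_top sequentially" "\<And>n. 0 < t n"
  shows "(\<lambda>n. \<integral>\<omega>. bridge_occupation g (t n) \<omega> ^ k \<partial>N (t n)) \<longlonglongrightarrow> (\<integral>p. limit_sum g p ^ k \<partial>limit_space)"
proof -
  obtain V R where "bounded_potential (\<lambda>z. ennreal (g z)) V R"
    using admissible_potential[OF g dim] .
  then interpret bounded_potential "\<lambda>z. ennreal (g z)" V R .
  have gm: "g \<in> borel_measurable borel" and g0: "\<And>z. 0 \<le> g z" using g by (auto simp: admissible_def)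
  have nonneg: "0 \<le> bridge_occupation g t \<omega>" "0 \<le> limit_sum g p" for t \<omega> p
    unfolding bridge_occupation_def limit_sum_def occupation_def by (auto intro!: path_integral_nonneg g0 add_nonneg_nonneg)
  let ?l = "\<Sum>i\<le>k. green (\<lambda>z. ennreal (g z)) i x\<^sub>0 * green (\<lambda>z. ennreal (g z)) (k - i) y\<^sub>0"
  let ?p = "\<lambda>n. pinned (\<lambda>z. ennreal (g z)) k (t n) (x (t n)) (y (t n)) / heat (t n) (y (t n) - x (t n))"
  have "(\<lambda>n. fact k * ?p n) \<longlonglongrightarrow> fact k * ?l"
  proof (intro tendsto_mult_ennreal tendsto_const tendsto_pinned_normalized t)
    show "(\<lambda>n. x (t n)) \<longlonglongrightarrow> x\<^sub>0" "(\<lambda>n. y (t n)) \<longlonglongrightarrow> y\<^sub>0"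
      using filterlim_compose[OF x_lim t(1)] filterlim_compose[OF y_lim t(1)] by auto
  qed (auto simp: ennreal_mult_eq_top_iff)
  moreover have "fact k * ?p n = ennreal (\<integral>\<omega>. bridge_occupation g (t n) \<omega> ^ k \<partial>N (t n))" for n
  proof -
    have "(fact k :: ennreal) < \<top>" by (metis of_nat_fact of_nat_less_top)
    then have fin: "fact k * ?p n < \<top>"
      using bridge_occupation_moment_nn(3)[OF g t(2)] by (simp add: ennreal_mult_less_top)
    have eq: "(\<integral>\<^sup>+\<omega>. ennreal (bridge_occupation g (t n) \<omega> ^ k) \<partial>N (t n)) = fact k * ?p n"
      using bridge_occupation_moment_nn(2)[OF g t(2)] by (simp add: ennreal_power nonneg)
    have "integrable (N (t n)) (\<lambda>\<omega>. bridge_occupation g (t n) \<omega> ^ k)"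
      using eq fin bridge_occupation_measurable[OF t(2) gm] by (intro integrableI_nonneg) (auto simp: nonneg)
    from nn_integral_eq_integral[OF this] show ?thesis using eq nonneg by simp
  qed
  moreover have "fact k * ?l = ennreal (\<integral>p. limit_sum g p ^ k \<partial>limit_space)"
  proof -
    have "integrable limit_space (\<lambda>p. limit_sum g p ^ k)"
      using limit_sum_moment_less_top[OF g, of k] limit_sum_measurable[OF gm]
      by (intro integrableI_nonneg) (auto simp: nonneg ennreal_power[symmetric])
    from nn_integral_eq_integral[OF this] show ?thesis
      unfolding limit_sum_moment_nn[OF g, symmetric] by (simp add: nonneg ennreal_power)
  qed
  ultimately show ?thesis by (simp add: nonneg integral_nonneg_AE)
qed

lemma bridge_signed:
  assumes t: "0 < t"
  shows "integrable (N t) (\<lambda>\<omega>. bridge_occupation v t \<omega> ^ k)" (is ?I)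
    and "(\<integral>\<omega>. bridge_occupation v t \<omega> ^ k \<partial>N t)
      = (\<Sum>j\<le>k. (-1) ^ j * real (Suc k choose Suc j) * (\<integral>\<omega>. bridge_occupation (sign_mix v j) t \<omega> ^ k \<partial>N t))" (is ?E)
proof -
  have AE: "AE \<omega> in N t. bridge_occupation v t \<omega>
        = bridge_occupation (\<lambda>z. max 0 (v z)) t \<omega> - bridge_occupation (\<lambda>z. max 0 (- v z)) t \<omega>
      \<and> (\<forall>j. bridge_occupation (sign_mix v j) t \<omega>
        = bridge_occupation (\<lambda>z. max 0 (v z)) t \<omega> + real j * bridge_occupation (\<lambda>z. max 0 (- v z)) t \<omega>)"
    using bridge_occupation_moment_nn(1)[OF admissible_abs t] AE_space unfolding bridge_occupation_def
    by eventually_elim (auto simp: path_integral_sign_mix[OF bridge_path[OF t] v_measurable])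
  have int: "integrable (N t) (\<lambda>\<omega>. bridge_occupation (sign_mix v j) t \<omega> ^ k)" for j
  proof (rule integrableI_nonneg)
    have nonneg: "0 \<le> bridge_occupation (sign_mix v j) t \<omega>" for \<omega>
      unfolding bridge_occupation_def by (intro path_integral_nonneg sign_mix_nonneg)
    show "AE \<omega> in N t. 0 \<le> bridge_occupation (sign_mix v j) t \<omega> ^ k" using nonneg by simp
    show "(\<lambda>\<omega>. bridge_occupation (sign_mix v j) t \<omega> ^ k) \<in> borel_measurable (N t)"
      using bridge_occupation_measurable[OF t, of "sign_mix v j"] by simp
    have "(fact k :: ennreal) < \<top>" by (metis of_nat_fact of_nat_less_top)
    then show "(\<integral>\<^sup>+\<omega>. ennreal (bridge_occupation (sign_mix v j) t \<omega> ^ k) \<partial>N t) < \<infinity>"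
      using bridge_occupation_moment_nn(2,3)[OF admissible_sign_mix t, of j k]
      by (simp add: ennreal_power[symmetric] nonneg ennreal_mult_less_top)
  qed
  note * = signed_moment[OF bridge_occupation_measurable[OF t v_measurable] AE int]
  show ?I ?E by (rule *)+
qed

lemma limit_signed:
  shows "integrable limit_space (\<lambda>p. limit_sum v p ^ k)" (is ?I)
    and "(\<integral>p. limit_sum v p ^ k \<partial>limit_space)
      = (\<Sum>j\<le>k. (-1) ^ j * real (Suc k choose Suc j) * (\<integral>p. limit_sum (sign_mix v j) p ^ k \<partial>limit_space))" (is ?E)
proof -
  interpret pair_prob_space "M x\<^sub>0" "M y\<^sub>0" by (rule pair_prob_space_limit)
  let ?A = "\<lambda>z \<omega>. \<integral>\<^sup>+s\<in>{0..}. ennreal \<bar>v (W z s \<omega>)\<bar> \<partial>lborel"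
  have [measurable]: "?A z \<in> borel_measurable (M z)" for z
    by (rule nn_path_integral_measurable[OF motion_path]) measurable
  have "AE p in limit_space. ?A x\<^sub>0 (fst p) < \<top> \<and> ?A y\<^sub>0 (snd p) < \<top>"
    unfolding limit_space_def
  proof (rule AE_pair_measure)
    show "AE \<omega> in M x\<^sub>0. AE \<omega>' in M y\<^sub>0. ?A x\<^sub>0 (fst (\<omega>, \<omega>')) < \<top> \<and> ?A y\<^sub>0 (snd (\<omega>, \<omega>')) < \<top>"
      using occupation_moment_nn(1)[OF admissible_abs, of x\<^sub>0]
    proof eventually_elim
      case (elim \<omega>)
      show ?case using occupation_moment_nn(1)[OF admissible_abs, of y\<^sub>0]
        by eventually_elim (use elim in simp)
    qed
  qed measurable
  then have AE: "AE p in limit_space. limit_sum v p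
        = limit_sum (\<lambda>z. max 0 (v z)) p - limit_sum (\<lambda>z. max 0 (- v z)) p
      \<and> (\<forall>j. limit_sum (sign_mix v j) p = limit_sum (\<lambda>z. max 0 (v z)) p + real j * limit_sum (\<lambda>z. max 0 (- v z)) p)"
    using AE_space unfolding limit_sum_def occupation_def
  proof eventually_elim
    case (elim p)
    then have sp: "fst p \<in> space (M x\<^sub>0)" "snd p \<in> space (M y\<^sub>0)"
      by (auto simp: limit_space_def space_pair_measure)
    show ?case
      using elim path_integral_sign_mix[OF motion_path v_measurable sp(1)] path_integral_sign_mix[OF motion_path v_measurable sp(2)]
      by (auto simp: algebra_simps)
  qed
  have int: "integrable limit_space (\<lambda>p. limit_sum (sign_mix v j) p ^ k)" for j
  proof (rule integrableI_nonneg)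
    have nonneg: "0 \<le> limit_sum (sign_mix v j) p" for p
      unfolding limit_sum_def occupation_def by (intro add_nonneg_nonneg path_integral_nonneg sign_mix_nonneg)
    show "AE p in limit_space. 0 \<le> limit_sum (sign_mix v j) p ^ k" using nonneg by simp
    show "(\<lambda>p. limit_sum (sign_mix v j) p ^ k) \<in> borel_measurable limit_space"
      using limit_sum_measurable[of "sign_mix v j"] by simp
    show "(\<integral>\<^sup>+p. ennreal (limit_sum (sign_mix v j) p ^ k) \<partial>limit_space) < \<infinity>"
      using limit_sum_moment_less_top[OF admissible_sign_mix, of j k]
      by (simp add: ennreal_power[symmetric] nonneg)
  qed
  note * = signed_moment[OF limit_sum_measurable[OF v_measurable] AE int]
  show ?I ?E by (rule *)+
qed

text \<open>The coefficients of the combination are the same for the bridge and for the limit, and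
  their number is fixed by k, so convergence for nonnegative functions transfers termwise.\<close>

lemma tendsto_moment:
  assumes t: "filterlim t at_top sequentially" "\<And>n. 0 < t n"
  shows "(\<lambda>n. \<integral>\<omega>. bridge_occupation v (t n) \<omega> ^ k \<partial>N (t n)) \<longlonglongrightarrow> (\<integral>p. limit_sum v p ^ k \<partial>limit_space)"
  unfolding limit_signed(2) bridge_signed(2)[OF t(2)]
  by (intro tendsto_intros tendsto_moment_admissible admissible_sign_mix t)


section \<open>Convergence of exponential moments\<close>

lemma occupation_exp_moment:
  assumes g: "admissible g" and \<beta>: "0 \<le> \<beta>"
  shows "exp_moment (M z) \<beta> (occupation g z) = (\<Sum>k. ennreal \<beta> ^ k * green (\<lambda>z. ennreal (g z)) k z)"
proof -
  have gm: "g \<in> borel_measurable borel" and g0: "\<And>z. 0 \<le> g z" using g by (auto simp: admissible_def)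
  have "exp_moment (M z) \<beta> (occupation g z)
      = (\<integral>\<^sup>+\<omega>. ennreal (exp (\<beta> * enn2real (\<integral>\<^sup>+s\<in>{0..}. ennreal (g (W z s \<omega>)) \<partial>lborel))) \<partial>M z)"
    unfolding exp_moment_def occupation_def
    by (intro nn_integral_cong) (simp add: path_integral_eq_nn[OF motion_path gm _ g0])
  also have "\<dots> = (\<Sum>k. ennreal \<beta> ^ k * green (\<lambda>z. ennreal (g z)) k z)"
    using gm by (intro nn_integral_exp_series nn_path_integral_measurable[OF motion_path gm]
        occupation_moment_nn(1)[OF g] \<beta> brownian_motion_moment[OF motion]) simp
  finally show ?thesis .
qed

lemma bridge_occupation_exp_moment:
  assumes g: "admissible g" and \<beta>: "0 \<le> \<beta>" and t: "0 < t"
  shows "exp_moment (N t) \<beta> (bridge_occupation g t)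
       = (\<Sum>k. ennreal \<beta> ^ k * (pinned (\<lambda>z. ennreal (g z)) k t (x t) (y t) / heat t (y t - x t)))"
proof -
  have gm: "g \<in> borel_measurable borel" and g0: "\<And>z. 0 \<le> g z" using g by (auto simp: admissible_def)
  have "exp_moment (N t) \<beta> (bridge_occupation g t)
      = (\<integral>\<^sup>+\<omega>. ennreal (exp (\<beta> * enn2real (\<integral>\<^sup>+s\<in>{0..t}. ennreal (g (X t s \<omega>)) \<partial>lborel))) \<partial>N t)"
    unfolding exp_moment_def bridge_occupation_def
    by (intro nn_integral_cong) (simp add: path_integral_eq_nn[OF bridge_path[OF t] gm _ g0])
  also have "\<dots> = (\<Sum>k. ennreal \<beta> ^ k * (pinned (\<lambda>z. ennreal (g z)) k t (x t) (y t) / heat t (y t - x t)))"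
    using gm by (intro nn_integral_exp_series nn_path_integral_measurable[OF bridge_path[OF t] gm]
        bridge_occupation_moment_nn(1)[OF g t] \<beta> brownian_bridge_moment[OF bridge[OF t] t]) simp
  finally show ?thesis .
qed

lemma limit_sum_exp_moment:
  assumes [measurable]: "g \<in> borel_measurable borel"
  shows "exp_moment limit_space \<alpha> (limit_sum g)
       = exp_moment (M x\<^sub>0) \<alpha> (occupation g x\<^sub>0) * exp_moment (M y\<^sub>0) \<alpha> (occupation g y\<^sub>0)"
proof -
  have "exp_moment limit_space \<alpha> (limit_sum g)
      = (\<integral>\<^sup>+p. ennreal (exp (\<alpha> * occupation g x\<^sub>0 (fst p))) * ennreal (exp (\<alpha> * occupation g y\<^sub>0 (snd p))) \<partial>limit_space)"
    unfolding exp_moment_def limit_sum_def by (simp add: distrib_left exp_add ennreal_mult'')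
  also have "\<dots> = exp_moment (M x\<^sub>0) \<alpha> (occupation g x\<^sub>0) * exp_moment (M y\<^sub>0) \<alpha> (occupation g y\<^sub>0)"
    unfolding exp_moment_def by (rule nn_integral_limit_space_times) measurable
  finally show ?thesis .
qed

text \<open>The absolute value of the integral of v is at most the integral of |v|, whose
  exponential moment is a series of nonnegative terms. An exponent strictly between \<beta> and the
  critical one supplies the room that the series bound needs.\<close>

lemma uniform_exp_bound:
  assumes fin: "\<And>z \<beta>. 0 \<le> \<beta> \<Longrightarrow> \<beta> < \<alpha>\<^sub>s \<Longrightarrow> exp_moment (M z) \<beta> (occupation (\<lambda>z. \<bar>v z\<bar>) z) < \<infinity>"
    and \<beta>: "0 \<le> \<beta>" "\<beta> < \<alpha>\<^sub>s"
  shows "\<exists>K\<ge>0. (\<forall>t\<ge>1. norm (x t) \<le> r \<longrightarrow> norm (y t) \<le> r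
        \<longrightarrow> (\<integral>\<^sup>+\<omega>. ennreal (exp (\<beta> * \<bar>bridge_occupation v t \<omega>\<bar>)) \<partial>N t) \<le> ennreal K)
      \<and> (\<integral>\<^sup>+p. ennreal (exp (\<beta> * \<bar>limit_sum v p\<bar>)) \<partial>limit_space) \<le> ennreal K"
proof -
  obtain V R where "bounded_potential (\<lambda>z. ennreal \<bar>v z\<bar>) V R"
    using admissible_potential[OF admissible_abs dim] .
  then interpret bounded_potential "\<lambda>z. ennreal \<bar>v z\<bar>" V R .
  obtain \<gamma> where \<gamma>: "\<beta> < \<gamma>" "\<gamma> < \<alpha>\<^sub>s" using dense \<beta> by blast
  have "(\<Sum>k. ennreal \<gamma> ^ k * green (\<lambda>z. ennreal \<bar>v z\<bar>) k 0) < \<top>"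
    using fin[of \<gamma> 0] \<gamma> \<beta> occupation_exp_moment[OF admissible_abs, of \<gamma> 0] by simp
  from pinned_normalized_series_bounded[OF \<beta>(1) \<gamma>(1) this, of r]
  obtain K1 where K1: "0 \<le> K1" "\<And>t a b. 1 \<le> t \<Longrightarrow> norm a \<le> r \<Longrightarrow> norm b \<le> r \<Longrightarrow>
      (\<Sum>k. ennreal \<beta> ^ k * (pinned (\<lambda>z. ennreal \<bar>v z\<bar>) k t a b / heat t (b - a))) \<le> ennreal K1"
    by blast
  have "exp_moment limit_space \<beta> (limit_sum (\<lambda>z. \<bar>v z\<bar>)) < \<top>"
    using fin[OF \<beta>] by (subst limit_sum_exp_moment) (auto simp: ennreal_mult_less_top)
  then obtain K2 where K2: "exp_moment limit_space \<beta> (limit_sum (\<lambda>z. \<bar>v z\<bar>)) = ennreal K2" "0 \<le> K2"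
    by (cases "exp_moment limit_space \<beta> (limit_sum (\<lambda>z. \<bar>v z\<bar>))") auto
  show ?thesis
  proof (intro exI[of _ "max K1 K2"] conjI allI impI)
    fix t assume t: "1 \<le> t" "norm (x t) \<le> r" "norm (y t) \<le> r"
    have "(\<integral>\<^sup>+\<omega>. ennreal (exp (\<beta> * \<bar>bridge_occupation v t \<omega>\<bar>)) \<partial>N t)
        \<le> exp_moment (N t) \<beta> (bridge_occupation (\<lambda>z. \<bar>v z\<bar>) t)"
      unfolding exp_moment_def bridge_occupation_def
      using \<beta> abs_path_integral_le[of "{0..t}" v "X t"]
      by (intro nn_integral_mono) (auto intro!: mult_left_mono)
    also have "\<dots> \<le> ennreal K1"
      using t by (subst bridge_occupation_exp_moment[OF admissible_abs \<beta>(1)]) (auto intro: K1)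
    also have "\<dots> \<le> ennreal (max K1 K2)" by (intro ennreal_leI) auto
    finally show "(\<integral>\<^sup>+\<omega>. ennreal (exp (\<beta> * \<bar>bridge_occupation v t \<omega>\<bar>)) \<partial>N t) \<le> ennreal (max K1 K2)" .
  next
    have "\<bar>limit_sum v p\<bar> \<le> limit_sum (\<lambda>z. \<bar>v z\<bar>) p" for p
      unfolding limit_sum_def occupation_def
      by (intro order_trans[OF abs_triangle_ineq] add_mono abs_path_integral_le)
    then have "(\<integral>\<^sup>+p. ennreal (exp (\<beta> * \<bar>limit_sum v p\<bar>)) \<partial>limit_space) \<le> exp_moment limit_space \<beta> (limit_sum (\<lambda>z. \<bar>v z\<bar>))"
      unfolding exp_moment_def using \<beta> by (intro nn_integral_mono) (auto intro!: mult_left_mono)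
    also have "\<dots> \<le> ennreal (max K1 K2)" unfolding K2 by (intro ennreal_leI) auto
    finally show "(\<integral>\<^sup>+p. ennreal (exp (\<beta> * \<bar>limit_sum v p\<bar>)) \<partial>limit_space) \<le> ennreal (max K1 K2)" .
  qed (use K1 in auto)
qed

text \<open>One statement for both ranges of \<alpha>: the symmetric one for signed v, and the half
  line for v \<ge> 0. The threshold \<open>\<alpha>\<^sub>s\<close> stands for either critical
  number.\<close>

lemma tendsto_exp_moment:
  assumes fin: "\<And>z \<beta>. 0 \<le> \<beta> \<Longrightarrow> \<beta> < \<alpha>\<^sub>s \<Longrightarrow> exp_moment (M z) \<beta> (occupation (\<lambda>z. \<bar>v z\<bar>) z) < \<infinity>"
    and \<alpha>\<^sub>s: "0 < \<alpha>\<^sub>s" and \<alpha>: "\<alpha> < \<alpha>\<^sub>s" "- \<alpha>\<^sub>s < \<alpha> \<or> (\<forall>z. 0 \<le> v z)"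
  shows "((\<lambda>t. exp_moment (N t) \<alpha> (bridge_occupation v t)) \<longlongrightarrow> exp_moment limit_space \<alpha> (limit_sum v)) at_top"
proof (rule tendsto_at_top_along)
  define r where "r = max (norm x\<^sub>0) (norm y\<^sub>0) + 1"
  have "\<forall>\<^sub>F t in at_top. norm (x t) < r" "\<forall>\<^sub>F t in at_top. norm (y t) < r"
    by (intro order_tendstoD[OF tendsto_norm[OF x_lim]] order_tendstoD[OF tendsto_norm[OF y_lim]]; simp add: r_def)+
  then show "\<forall>\<^sub>F t in at_top. 1 \<le> t \<and> norm (x t) \<le> r \<and> norm (y t) \<le> r"
    using eventually_ge_at_top[of 1] by eventually_elim auto
  fix t :: "nat \<Rightarrow> real"
  assume t: "filterlim t at_top sequentially" and good: "\<And>n. 1 \<le> t n \<and> norm (x (t n)) \<le> r \<and> norm (y (t n)) \<le> r"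
  then have pos: "0 < t n" for n by (metis less_le_trans zero_less_one)
  define Z where "Z n = bridge_occupation v (t n)" for n
  define \<N> where "\<N> n = N (t n)" for n
  let ?S = "limit_sum v"
  \<comment> \<open>In the symmetric range this is halfway between |\<alpha>| and the threshold. For
    very negative \<alpha> any value above the step \<delta> used below and under the threshold
    would do.\<close>
  define \<beta> where "\<beta> = (if - \<alpha>\<^sub>s < \<alpha> then (\<bar>\<alpha>\<bar> + \<alpha>\<^sub>s) / 2 else 3 * \<alpha>\<^sub>s / 4)"
  have \<beta>: "0 \<le> \<beta>" "\<beta> < \<alpha>\<^sub>s" using \<alpha> \<alpha>\<^sub>s by (auto simp: \<beta>_def)
  obtain K where K: "0 \<le> K" "\<And>n. (\<integral>\<^sup>+\<omega>. ennreal (exp (\<beta> * \<bar>Z n \<omega>\<bar>)) \<partial>\<N> n) \<le> ennreal K"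
      "(\<integral>\<^sup>+p. ennreal (exp (\<beta> * \<bar>?S p\<bar>)) \<partial>limit_space) \<le> ennreal K"
    using uniform_exp_bound[OF fin \<beta>, of r] good unfolding Z_def \<N>_def by blast
  have Zm [measurable]: "Z n \<in> borel_measurable (\<N> n)" for n
    unfolding Z_def \<N>_def by (intro bridge_occupation_measurable pos) measurable
  have Sm [measurable]: "?S \<in> borel_measurable limit_space"
    by (intro limit_sum_measurable) measurable
  have moments: "(\<lambda>n. \<integral>\<omega>. Z n \<omega> ^ k \<partial>\<N> n) \<longlonglongrightarrow> (\<integral>p. ?S p ^ k \<partial>limit_space)" for k
    unfolding Z_def \<N>_def by (rule tendsto_moment[OF t pos])
  have conv: "(\<lambda>n. \<integral>\<omega>. exp (\<alpha> * Z n \<omega>) \<partial>\<N> n) \<longlonglongrightarrow> (\<integral>p. exp (\<alpha> * ?S p) \<partial>limit_space)"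
  proof (cases "- \<alpha>\<^sub>s < \<alpha>")
    case True
    have "(\<lambda>n. \<integral>\<omega>. 1 * Z n \<omega> ^ 0 * exp (\<alpha> * Z n \<omega>) \<partial>\<N> n) \<longlonglongrightarrow> (\<integral>p. 1 * ?S p ^ 0 * exp (\<alpha> * ?S p) \<partial>limit_space)"
      by (rule weighted_exp_tendsto[where \<beta>=\<beta> and K=K]) (use True \<alpha> K moments in \<open>auto simp: \<beta>_def\<close>)
    then show ?thesis by simp
  next
    case False
    then have v0: "0 \<le> v z" for z using \<alpha> by blast
    have Z0: "0 \<le> Z n \<omega>" and S0: "0 \<le> ?S p" for n \<omega> p
      unfolding Z_def bridge_occupation_def limit_sum_def occupation_def
      by (intro path_integral_nonneg add_nonneg_nonneg v0)+
    define \<delta> where "\<delta> = \<alpha>\<^sub>s / 2"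
    have \<delta>: "0 < \<delta>" "\<delta> < \<beta>" using False \<alpha>\<^sub>s by (auto simp: \<delta>_def \<beta>_def)
    \<comment> \<open>Each induction step expands only one more factor e^(-\<delta> Z), for which
      \<delta> < \<beta> suffices; the factors already treated are at most 1 because Z \<ge> 0 and
      serve as the weight. All powers j are carried along, since the expansion of the next factor
      uses them all.\<close>
    have damped: "(\<lambda>n. \<integral>\<omega>. exp (- (real m * \<delta> * Z n \<omega>)) * Z n \<omega> ^ j \<partial>\<N> n)
        \<longlonglongrightarrow> (\<integral>p. exp (- (real m * \<delta> * ?S p)) * ?S p ^ j \<partial>limit_space)" for m j
    proof (induction m arbitrary: j)
      case 0
      then show ?case using moments by simp
    next
      case (Suc m)
      have "(\<lambda>n. \<integral>\<omega>. exp (- (real m * \<delta> * Z n \<omega>)) * Z n \<omega> ^ j * exp (- \<delta> * Z n \<omega>) \<partial>\<N> n)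
        \<longlonglongrightarrow> (\<integral>p. exp (- (real m * \<delta> * ?S p)) * ?S p ^ j * exp (- \<delta> * ?S p) \<partial>limit_space)"
        using \<delta> Z0 S0 by (intro weighted_exp_tendsto[where \<beta>=\<beta> and K=K] K Suc) auto
      moreover have "exp (- (real m * \<delta> * u)) * u ^ j * exp (- \<delta> * u) = exp (- (real (Suc m) * \<delta> * u)) * u ^ j" for u
        by (simp add: algebra_simps flip: exp_add)
      ultimately show ?case by (simp only:)
    qed
    \<comment> \<open>Enough damping steps to pass \<alpha>: the correction \<alpha> + m \<delta>
      lies in [0, \<delta>) and is itself small enough to be expanded.\<close>
    define m where "m = nat \<lceil>- \<alpha> / \<delta>\<rceil>"
    have neg: "\<alpha> < 0" using False \<alpha>\<^sub>s by simp
    have m: "- \<alpha> / \<delta> \<le> real m" "real m < - \<alpha> / \<delta> + 1"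
    proof -
      have "0 < - \<alpha> / \<delta>" using neg \<delta> by (simp add: divide_less_0_iff)
      then have "real m = real_of_int \<lceil>- \<alpha> / \<delta>\<rceil>" by (simp add: m_def)
      then show "- \<alpha> / \<delta> \<le> real m" "real m < - \<alpha> / \<delta> + 1" by linarith+
    qed
    then have \<alpha>': "0 \<le> \<alpha> + real m * \<delta>" "\<alpha> + real m * \<delta> < \<delta>"
      using \<delta> by (simp_all add: field_simps)
    have "(\<lambda>n. \<integral>\<omega>. exp (- (real m * \<delta> * Z n \<omega>)) * Z n \<omega> ^ 0 * exp ((\<alpha> + real m * \<delta>) * Z n \<omega>) \<partial>\<N> n)
        \<longlonglongrightarrow> (\<integral>p. exp (- (real m * \<delta> * ?S p)) * ?S p ^ 0 * exp ((\<alpha> + real m * \<delta>) * ?S p) \<partial>limit_space)"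
      using \<delta> \<alpha>' Z0 S0 by (intro weighted_exp_tendsto[where \<beta>=\<beta> and K=K] K damped) auto
    moreover have "exp (- (real m * \<delta> * u)) * u ^ 0 * exp ((\<alpha> + real m * \<delta>) * u) = exp (\<alpha> * u)" for u
      by (simp add: algebra_simps flip: exp_add)
    ultimately show ?thesis by simp
  qed
  \<comment> \<open>This makes the extended exponential moments finite, so the convergence of real
    integrals can be read as convergence in \<open>ennreal\<close>.\<close>
  have le: "\<alpha> * u \<le> \<beta> * \<bar>u\<bar>" if "- \<alpha>\<^sub>s < \<alpha> \<or> 0 \<le> u" for u
  proof (cases "- \<alpha>\<^sub>s < \<alpha>")
    case True
    then have "\<bar>\<alpha>\<bar> \<le> \<beta>" using \<alpha> by (auto simp: \<beta>_def)
    then have "\<bar>\<alpha>\<bar> * \<bar>u\<bar> \<le> \<beta> * \<bar>u\<bar>" by (intro mult_right_mono) auto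
    then show ?thesis using abs_ge_self[of "\<alpha> * u"] by (simp add: abs_mult)
  next
    case False
    then have "0 \<le> u" "\<alpha> \<le> \<beta>" using that \<alpha>\<^sub>s \<beta> by auto
    then show ?thesis by (simp add: mult_right_mono)
  qed
  have cond: "- \<alpha>\<^sub>s < \<alpha> \<or> 0 \<le> Z n \<omega>" "- \<alpha>\<^sub>s < \<alpha> \<or> 0 \<le> ?S p" for n \<omega> p
    using \<alpha>(2) unfolding Z_def bridge_occupation_def limit_sum_def occupation_def
    by (auto intro!: path_integral_nonneg add_nonneg_nonneg)
  have "exp_moment (\<N> n) \<alpha> (Z n) = ennreal (\<integral>\<omega>. exp (\<alpha> * Z n \<omega>) \<partial>\<N> n)" for n
    by (rule exp_moment_eq_integral[OF Zm K(2) le[OF cond(1)]])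
  moreover have "exp_moment limit_space \<alpha> ?S = ennreal (\<integral>p. exp (\<alpha> * ?S p) \<partial>limit_space)"
    by (rule exp_moment_eq_integral[OF Sm K(3) le[OF cond(2)]])
  ultimately have "(\<lambda>n. exp_moment (\<N> n) \<alpha> (Z n)) \<longlonglongrightarrow> exp_moment limit_space \<alpha> ?S"
    using conv by (simp add: tendsto_ennrealI)
  then show "(\<lambda>n. exp_moment (N (t n)) \<alpha> (bridge_occupation v (t n))) \<longlonglongrightarrow> exp_moment limit_space \<alpha> ?S"
    by (simp add: Z_def \<N>_def)
qed

text \<open>Independence makes the joint law of \<open>U\<close> and \<open>U'\<close> the product
  of the two occupation laws, which is also the joint law of the coordinates on the product space;
  addition then gives the same law for the sums.\<close>

lemma distr_independent_sum:
  assumes P: "prob_space P" and indep: "prob_space.indep_var P borel U borel U'"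
    and U: "distr P borel U = distr (M x\<^sub>0) borel (occupation v x\<^sub>0)"
    and U': "distr P borel U' = distr (M y\<^sub>0) borel (occupation v y\<^sub>0)"
  shows "(\<lambda>\<omega>. U \<omega> + U' \<omega> :: real) \<in> borel_measurable P"
    and "distr P borel (\<lambda>\<omega>. U \<omega> + U' \<omega>) = distr limit_space borel (limit_sum v)"
proof -
  interpret prob_space P by fact
  interpret Q: pair_prob_space "M x\<^sub>0" "M y\<^sub>0" by (rule pair_prob_space_limit)
  have [measurable]: "U \<in> borel_measurable P" "U' \<in> borel_measurable P"
    using indep by (auto dest: indep_var_rv1 indep_var_rv2)
  show "(\<lambda>\<omega>. U \<omega> + U' \<omega>) \<in> borel_measurable P" by measurable
  have "distr P borel (\<lambda>\<omega>. U \<omega> + U' \<omega>)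
      = distr (distr P (borel \<Otimes>\<^sub>M borel) (\<lambda>\<omega>. (U \<omega>, U' \<omega>))) borel (\<lambda>p. fst p + snd p)"
    by (subst distr_distr) (auto simp: comp_def)
  also have "distr P (borel \<Otimes>\<^sub>M borel) (\<lambda>\<omega>. (U \<omega>, U' \<omega>))
      = distr (M x\<^sub>0) borel (occupation v x\<^sub>0) \<Otimes>\<^sub>M distr (M y\<^sub>0) borel (occupation v y\<^sub>0)"
    using indep unfolding indep_var_distribution_eq U U' by simp
  also have "\<dots> = distr limit_space (borel \<Otimes>\<^sub>M borel) (\<lambda>(\<omega>, \<omega>'). (occupation v x\<^sub>0 \<omega>, occupation v y\<^sub>0 \<omega>'))"
    unfolding limit_space_def
    by (intro pair_measure_distr prob_space_imp_sigma_finite Q.M2.prob_space_distr) measurable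
  also have "distr \<dots> borel (\<lambda>p. fst p + snd p) = distr limit_space borel (limit_sum v)"
    unfolding limit_space_def
    by (subst distr_distr) (auto simp: comp_def limit_sum_def split_beta' intro!: distr_cong)
  finally show "distr P borel (\<lambda>\<omega>. U \<omega> + U' \<omega>) = distr limit_space borel (limit_sum v)" .
qed

end

theorem theorem1:
  fixes v :: "'a::euclidean_space \<Rightarrow> real"
    and x y :: "real \<Rightarrow> 'a" and x\<^sub>0 y\<^sub>0 :: 'a
    and N :: "real \<Rightarrow> 'b measure" and X :: "real \<Rightarrow> real \<Rightarrow> 'b \<Rightarrow> 'a" and Z :: "real \<Rightarrow> 'b \<Rightarrow> real"
    and M :: "'a \<Rightarrow> 'w measure" and W :: "'a \<Rightarrow> real \<Rightarrow> 'w \<Rightarrow> 'a" and Y :: "'a \<Rightarrow> 'w \<Rightarrow> real"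
    and P :: "'p measure" and U U' :: "'p \<Rightarrow> real"
    and \<alpha>\<^sub>0 :: real
  assumes dim: "DIM('a) \<ge> 3"
    and v_measurable: "v \<in> borel_measurable borel"
    and v_bounded: "bounded (range v)"
    and v_support: "bounded {z. v z \<noteq> 0}"
    and x_lim: "(x \<longlongrightarrow> x\<^sub>0) at_top"
    and y_lim: "(y \<longlongrightarrow> y\<^sub>0) at_top"
    and bridge: "\<And>t. t > 0 \<Longrightarrow> brownian_bridge (N t) t (x t) (y t) (X t)"
    and Z_eq: "\<And>t. t > 0 \<Longrightarrow> Z t = path_integral {0..t} v (X t)"
    and motion: "\<And>z. brownian_motion (M z) z (W z)"
    and Y_eq: "\<And>z. Y z = path_integral {0..} v (W z)"
    and P: "prob_space P"
    and indep: "prob_space.indep_var P borel U borel U'"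
    and U_distr: "distr P borel U = distr (M x\<^sub>0) borel (Y x\<^sub>0)"
    and U'_distr: "distr P borel U' = distr (M y\<^sub>0) borel (Y y\<^sub>0)"
    and alpha0_pos: "\<alpha>\<^sub>0 > 0"
    and alpha0: "\<And>z \<alpha>. \<bar>\<alpha>\<bar> < \<alpha>\<^sub>0 \<Longrightarrow>
           exp_moment (M z) \<alpha> (path_integral {0..} (\<lambda>u. \<bar>v u\<bar>) (W z)) < \<infinity>"
  shows "(\<forall>k::nat. k > 0 \<longrightarrow>
            (\<forall>t>0. integrable (N t) (\<lambda>\<omega>. Z t \<omega> ^ k)) \<and>
            integrable P (\<lambda>\<omega>. (U \<omega> + U' \<omega>) ^ k) \<and>
            ((\<lambda>t. \<integral>\<omega>. Z t \<omega> ^ k \<partial>N t) \<longlongrightarrow> (\<integral>\<omega>. (U \<omega> + U' \<omega>) ^ k \<partial>P)) at_top) \<and>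
         (\<forall>\<alpha>. -\<alpha>\<^sub>0 < \<alpha> \<and> \<alpha> < \<alpha>\<^sub>0 \<longrightarrow>
            ((\<lambda>t. exp_moment (N t) \<alpha> (Z t)) \<longlongrightarrow> exp_moment P \<alpha> (\<lambda>\<omega>. U \<omega> + U' \<omega>)) at_top \<and>
            exp_moment P \<alpha> (\<lambda>\<omega>. U \<omega> + U' \<omega>)
              = exp_moment (M x\<^sub>0) \<alpha> (Y x\<^sub>0) * exp_moment (M y\<^sub>0) \<alpha> (Y y\<^sub>0)) \<and>
         ((\<forall>z. v z \<ge> 0) \<and> \<not> (AE z in lborel. v z = 0) \<longrightarrow>
            (\<forall>\<alpha>\<^sub>1>0. (\<forall>z \<alpha>. \<alpha> < \<alpha>\<^sub>1 \<longrightarrow> exp_moment (M z) \<alpha> (Y z) < \<infinity>) \<and>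
                     (\<forall>z \<alpha>. \<alpha> > \<alpha>\<^sub>1 \<longrightarrow> exp_moment (M z) \<alpha> (Y z) = \<infinity>) \<longrightarrow>
               (\<forall>\<alpha><\<alpha>\<^sub>1.
                  ((\<lambda>t. exp_moment (N t) \<alpha> (Z t)) \<longlongrightarrow> exp_moment P \<alpha> (\<lambda>\<omega>. U \<omega> + U' \<omega>)) at_top \<and>
                  exp_moment P \<alpha> (\<lambda>\<omega>. U \<omega> + U' \<omega>)
                    = exp_moment (M x\<^sub>0) \<alpha> (Y x\<^sub>0) * exp_moment (M y\<^sub>0) \<alpha> (Y y\<^sub>0))))"
proof -
  interpret long_bridge v x y x\<^sub>0 y\<^sub>0 N X M W
    by unfold_locales (fact dim v_measurable v_bounded v_support x_lim y_lim bridge motion)+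
  have Y: "Y z = occupation v z" for z by (simp add: Y_eq occupation_def)
  have Z: "Z t = bridge_occupation v t" if "0 < t" for t using Z_eq[OF that] by (simp add: bridge_occupation_def)
  note sum = distr_independent_sum[OF P indep U_distr[unfolded Y] U'_distr[unfolded Y]]
  have [measurable]: "limit_sum v \<in> borel_measurable limit_space"
    by (rule limit_sum_measurable[OF v_measurable])
  note [measurable] = sum(1)
  have exp_sum: "exp_moment P \<alpha> (\<lambda>\<omega>. U \<omega> + U' \<omega>) = exp_moment limit_space \<alpha> (limit_sum v)" for \<alpha>
  proof -
    have "exp_moment P \<alpha> (\<lambda>\<omega>. U \<omega> + U' \<omega>) = (\<integral>\<^sup>+u. ennreal (exp (\<alpha> * u)) \<partial>distr P borel (\<lambda>\<omega>. U \<omega> + U' \<omega>))"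
      unfolding exp_moment_def by (subst nn_integral_distr) auto
    also have "\<dots> = exp_moment limit_space \<alpha> (limit_sum v)"
      unfolding exp_moment_def sum(2) by (subst nn_integral_distr) auto
    finally show ?thesis .
  qed
  have product: "exp_moment P \<alpha> (\<lambda>\<omega>. U \<omega> + U' \<omega>) = exp_moment (M x\<^sub>0) \<alpha> (Y x\<^sub>0) * exp_moment (M y\<^sub>0) \<alpha> (Y y\<^sub>0)" for \<alpha>
    unfolding exp_sum Y by (rule limit_sum_exp_moment[OF v_measurable])
  have ev: "\<forall>\<^sub>F t in at_top. Z t = bridge_occupation v t"
    using eventually_gt_at_top[of 0] by eventually_elim (rule Z)
  have exp_lim: "((\<lambda>t. exp_moment (N t) \<alpha> (Z t)) \<longlongrightarrow> exp_moment P \<alpha> (\<lambda>\<omega>. U \<omega> + U' \<omega>)) at_top"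
    if "0 < \<alpha>\<^sub>s" "\<And>z \<beta>. 0 \<le> \<beta> \<Longrightarrow> \<beta> < \<alpha>\<^sub>s \<Longrightarrow> exp_moment (M z) \<beta> (occupation (\<lambda>z. \<bar>v z\<bar>) z) < \<infinity>"
      "\<alpha> < \<alpha>\<^sub>s" "- \<alpha>\<^sub>s < \<alpha> \<or> (\<forall>z. 0 \<le> v z)" for \<alpha> \<alpha>\<^sub>s
  proof -
    have "\<forall>\<^sub>F t in at_top. exp_moment (N t) \<alpha> (bridge_occupation v t) = exp_moment (N t) \<alpha> (Z t)"
      using ev by eventually_elim simp
    then show ?thesis
      unfolding exp_sum using tendsto_exp_moment[OF that(2,1,3,4)] by (rule tendsto_cong[THEN iffD1])
  qed
  have moments: "(\<forall>t>0. integrable (N t) (\<lambda>\<omega>. Z t \<omega> ^ k)) \<and> integrable P (\<lambda>\<omega>. (U \<omega> + U' \<omega>) ^ k)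
      \<and> ((\<lambda>t. \<integral>\<omega>. Z t \<omega> ^ k \<partial>N t) \<longlongrightarrow> (\<integral>\<omega>. (U \<omega> + U' \<omega>) ^ k \<partial>P)) at_top" for k
  proof (intro conjI allI impI)
    show "integrable (N t) (\<lambda>\<omega>. Z t \<omega> ^ k)" if "0 < t" for t
      unfolding Z[OF that] by (rule bridge_signed(1)[OF that])
    have "integrable (distr P borel (\<lambda>\<omega>. U \<omega> + U' \<omega>)) (\<lambda>u. u ^ k)"
      unfolding sum(2) using limit_signed(1)[of k] by (subst integrable_distr_eq) auto
    then show "integrable P (\<lambda>\<omega>. (U \<omega> + U' \<omega>) ^ k)"
      by (subst (asm) integrable_distr_eq) auto
    have "(\<integral>\<omega>. (U \<omega> + U' \<omega>) ^ k \<partial>P) = (\<integral>u. u ^ k \<partial>distr P borel (\<lambda>\<omega>. U \<omega> + U' \<omega>))"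
      by (subst integral_distr) auto
    also have "\<dots> = (\<integral>p. limit_sum v p ^ k \<partial>limit_space)"
      unfolding sum(2) by (subst integral_distr) auto
    finally have eq: "(\<integral>\<omega>. (U \<omega> + U' \<omega>) ^ k \<partial>P) = (\<integral>p. limit_sum v p ^ k \<partial>limit_space)" .
    show "((\<lambda>t. \<integral>\<omega>. Z t \<omega> ^ k \<partial>N t) \<longlongrightarrow> (\<integral>\<omega>. (U \<omega> + U' \<omega>) ^ k \<partial>P)) at_top"
      unfolding eq
    proof (rule tendsto_at_top_along[OF eventually_gt_at_top[of 0]])
      fix t :: "nat \<Rightarrow> real" assume "filterlim t at_top sequentially" "\<And>n. 0 < t n"
      then show "(\<lambda>n. \<integral>\<omega>. Z (t n) \<omega> ^ k \<partial>N (t n)) \<longlonglongrightarrow> (\<integral>p. limit_sum v p ^ k \<partial>limit_space)"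
        using tendsto_moment[of t k] by (simp add: Z)
    qed
  qed
  show ?thesis
  proof (intro conjI allI impI moments[THEN conjunct1, rule_format] moments[THEN conjunct2, THEN conjunct1]
      moments[THEN conjunct2, THEN conjunct2] product)
    fix \<alpha> assume "- \<alpha>\<^sub>0 < \<alpha> \<and> \<alpha> < \<alpha>\<^sub>0"
    then show "((\<lambda>t. exp_moment (N t) \<alpha> (Z t)) \<longlongrightarrow> exp_moment P \<alpha> (\<lambda>\<omega>. U \<omega> + U' \<omega>)) at_top"
      using alpha0 alpha0_pos by (intro exp_lim[of \<alpha>\<^sub>0]) (auto simp: occupation_def)
  next
    fix \<alpha>\<^sub>1 \<alpha> :: real
    assume v: "(\<forall>z. 0 \<le> v z) \<and> \<not> (AE z in lborel. v z = 0)" and \<alpha>\<^sub>1: "0 < \<alpha>\<^sub>1" "\<alpha> < \<alpha>\<^sub>1"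
      and fin: "(\<forall>z \<alpha>. \<alpha> < \<alpha>\<^sub>1 \<longrightarrow> exp_moment (M z) \<alpha> (Y z) < \<infinity>) \<and> (\<forall>z \<alpha>. \<alpha>\<^sub>1 < \<alpha> \<longrightarrow> exp_moment (M z) \<alpha> (Y z) = \<infinity>)"
    \<comment> \<open>For nonnegative v the exponential moments of the integral of |v| are those of
      Y itself, so the threshold for Y can be used in place of the one for |v|.\<close>
    have "(\<lambda>z. \<bar>v z\<bar>) = v" using v by auto
    then show "((\<lambda>t. exp_moment (N t) \<alpha> (Z t)) \<longlongrightarrow> exp_moment P \<alpha> (\<lambda>\<omega>. U \<omega> + U' \<omega>)) at_top"
      using v fin \<alpha>\<^sub>1 by (intro exp_lim[of \<alpha>\<^sub>1]) (auto simp: Y)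
  qed
qed

end
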